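(* Let $g$ be a $q$-wavelet associated with the $q$-Bessel operator in $\mathcal{S}_{*q,\alpha}(\mathbb{R}_q)$. Then for every $f\in\mathcal{S}_{*q,\alpha}(\mathbb{R}_q)$, $$\Psi_{q,g}^\alpha(f)(a,\cdot)=W_{\alpha,q}^{-1}\left[\Phi_{q,W_{\alpha,q}(g)}\left(W_{\alpha,q}(f)\right)(a,\cdot)\right],\qquad a\in\mathbb{R}_{q,+}.$$
   Context: Fix $q\in\,]0,1[$ with $\frac{\log(1-q)}{\log q}\in\mathbb{Z}$ and $\alpha>-\frac12$. Functions are complex valued. $(a;q)_0=1$, $(a;q)_n=\prod_{k=0}^{n-1}(1-aq^k)$, $(a;q)_\infty=\prod_{k\ge0}(1-aq^k)$; $\Gamma_q(x)=\frac{(q;q)_\infty}{(q^x;q)_\infty}(1-q)^{1-x}$, and $\Gamma_{q^2}$ is the same with $q$ replaced by $q^2$. $\mathbb{R}_{q,+}=\{q^n:n\in\mathbb{Z}\}$, $\widetilde{\mathbb{R}}_{q,+}=\mathbb{R}_{q,+}\cup\{0\}$, $\mathbb{R}_q=\{\pm q^n:n\in\mathbb{Z}\}\cup\{0\}$. Jackson integrals: $\int_0^af(x)d_qx=(1-q)a\sum_{n\ge0}f(aq^n)q^n$, $\int_0^\infty f(x)d_qx=(1-q)\sum_{n\in\mathbb{Z}}f(q^n)q^n$, $\int_a^\infty=\int_0^\infty-\int_0^a$. $q$-derivative: $D_qf(x)=\frac{f(x)-f(qx)}{(1-q)x}$ for $x\ne0$, $D_qf(0)=f'(0)$. $\mathcal{S}_{*q}(\mathbb{R}_q)$: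 the restrictions to $\mathbb{R}_q$ of even, infinitely $q$-differentiable functions $f$ on $\mathbb{R}$ with $P_{n,m,q}(f)=\sup_{x\in\mathbb{R},\,0\le k\le n}|(1+x^2)^mD_q^kf(x)|<\infty$ for all $n,m\in\mathbb{N}$, with the induced topology of these semi-norms. For $\beta\in\{\alpha,-\frac12\}$, $\mathcal{S}_{*q,\beta}(\mathbb{R}_q)=\{f\in\mathcal{S}_{*q}(\mathbb{R}_q):\int_0^\infty f(x)x^{2k+2\beta+1}d_qx=0,\ k=0,1,\dots\}$. For $\beta\in\{\alpha,-\frac12\}$: $j_\beta^{(3)}(z;q^2)=\sum_{n\ge0}\frac{(-1)^nq^{n(n-1)}(1-q)^{2n}z^{2n}}{(q^2;q^2)_n(q^{2\beta+2};q^2)_n}$, $c_{\beta,q}=\frac{(1+q^{-1})^{-\beta}}{\Gamma_{q^2}(\beta+1)}$, $\mathcal{F}_{\beta,q}(f)(\lambda)=c_{\beta,q}\int_0^\infty f(x)j_\beta^{(3)}(\lambda x;q^2)x^{2\beta+1}d_qx$, with $\mathcal{F}_{\beta,q}^{-1}=q^{-4\beta-2}\mathcal{F}_{\beta,q}$. $\mathcal{F}_{\alpha,q}$ is the $q$-Bessel Fourier transform and $\mathcal{F}_q=\mathcal{F}_{-1/2,q}$ the $q$-Fourier-cosine transform. For $x\in\widetilde{\mathbb{R}}_{q,+}$ the translation $T^\beta_{q,x}$ is given by $\mathcal{F}_{\beta,q}(T^\beta_{q,x}f)(\lambda)=j_\beta^{(3)}(\lambda x;q^2)\mathcal{F}_{\beta,q}(f)(\lambda)$;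 $T_{q,x}=T^{-1/2}_{q,x}$. $q$-Weyl transform: $W_{\alpha,q}(f)(x)=\frac{q(1+q^{-1})^{-\alpha+1/2}}{\Gamma_{q^2}(\alpha+1/2)}\int_{qx}^\infty\frac{(q^2x^2/t^2;q^2)_\infty}{(q^{2\alpha+1}x^2/t^2;q^2)_\infty}f(t)t^{2\alpha}d_qt$ for $x\in\widetilde{\mathbb{R}}_{q,+}$, extended evenly; $\mathcal{F}_{\alpha,q}=\mathcal{F}_q\circ W_{\alpha,q}$ on $\mathcal{S}_{*q}(\mathbb{R}_q)$, and $W_{\alpha,q}$ is an isomorphism of $\mathcal{S}_{*q,\alpha}(\mathbb{R}_q)$ onto $\mathcal{S}_{*q,-1/2}(\mathbb{R}_q)$. A $q$-wavelet associated with the $q$-Bessel operator is an even $g$, square integrable on $\mathbb{R}_{q,+}$ for $x^{2\alpha+1}d_qx$, with $0<C_g=\int_0^\infty|\mathcal{F}_{\alpha,q}(g)(a)|^2\frac{d_qa}{a}<\infty$. For $a\in\mathbb{R}_{q,+}$, $b\in\widetilde{\mathbb{R}}_{q,+}$: $g_a(x)=a^{-2\alpha-2}g(x/a)$, $g_{a,b}=\sqrt a\,T_{q,b}^\alpha(g_a)$, $\Psi^{\alpha}_{q,g}(f)(a,b)=c_{\alpha,q}\int_0^\infty f(x)\overline{g_{a,b}(x)}\,x^{2\alpha+1}d_qx$. A $q$-wavelet is an even $h$, square integrable on $\mathbb{R}_{q,+}$ for $d_qx$, with $0<C_h^c=\int_0^\infty|\mathcal{F}_q(h)(a)|^2\frac{d_qa}{a}<\infty$.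 With $H_a(h)(x)=\frac1{\sqrt a}h(x/a)$ and $h^c_{a,b}=T_{q,b}(H_a(h))$, the continuous $q$-wavelet transform is $\Phi_{q,h}(f)(a,b)=c_{-1/2,q}\int_0^\infty f(x)\overline{h^c_{a,b}(x)}\,d_qx$, $a\in\mathbb{R}_{q,+}$, $b\in\widetilde{\mathbb{R}}_{q,+}$. *)

theory Defs
  imports "HOL-Analysis.Analysis"
begin

definition qpoch :: "real \<Rightarrow> real \<Rightarrow> nat \<Rightarrow> real" where
  "qpoch a q n = (\<Prod>k<n. 1 - a * q ^ k)"

definition qpoch_inf :: "real \<Rightarrow> real \<Rightarrow> real" where
  "qpoch_inf a q = prodinf (\<lambda>k. 1 - a * q ^ k)"

definition qGamma :: "real \<Rightarrow> real \<Rightarrow> real" where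
  "qGamma q x = qpoch_inf q q / qpoch_inf (q powr x) q * (1 - q) powr (1 - x)"

definition Rq_pos :: "real \<Rightarrow> real set" where
  "Rq_pos q = range (\<lambda>n::int. q powi n)"

definition Rq :: "real \<Rightarrow> real set" where
  "Rq q = Rq_pos q \<union> uminus ` Rq_pos q \<union> {0}"

text \<open>
  Functions on the \<open>q\<close>-lattice \<open>Rq q\<close> are represented extensionally (by \<^const>\<open>restrict\<close>), so that
  equality of such functions is HOL equality. The next definition turns a function given on the
  nonnegative part of the lattice into an even function on the lattice.
\<close>

definition even_ext :: "real \<Rightarrow> (real \<Rightarrow> complex) \<Rightarrow> real \<Rightarrow> complex" where
  "even_ext q u = (\<lambda>x\<in>Rq q. u \<bar>x\<bar>)"

text \<open>
  Jackson integrals, from \<open>0\<close> to \<open>a\<close>, from \<open>0\<close> to infinity, and from \<open>a\<close> to infinity. The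
  doubly infinite series is understood as an unconditionally convergent one.
\<close>

definition jackson_to :: "real \<Rightarrow> real \<Rightarrow> (real \<Rightarrow> 'a::real_normed_vector) \<Rightarrow> 'a" where
  "jackson_to q a f = ((1 - q) * a) *\<^sub>R (\<Sum>\<^sub>\<infinity>n::nat. q ^ n *\<^sub>R f (a * q ^ n))"

definition jackson :: "real \<Rightarrow> (real \<Rightarrow> 'a::real_normed_vector) \<Rightarrow> 'a" where
  "jackson q f = (1 - q) *\<^sub>R (\<Sum>\<^sub>\<infinity>n::int. (q powi n) *\<^sub>R f (q powi n))"

definition jackson_from :: "real \<Rightarrow> real \<Rightarrow> (real \<Rightarrow> 'a::real_normed_vector) \<Rightarrow> 'a" where
  "jackson_from q a f = jackson q f - jackson_to q a f"

definition jackson_integrable :: "real \<Rightarrow> (real \<Rightarrow> 'a::real_normed_vector) \<Rightarrow> bool" where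
  "jackson_integrable q f \<longleftrightarrow> (\<lambda>n::int. (q powi n) *\<^sub>R f (q powi n)) summable_on UNIV"

definition q_deriv :: "real \<Rightarrow> (real \<Rightarrow> complex) \<Rightarrow> real \<Rightarrow> complex" where
  "q_deriv q f x =
     (if x = 0 then vector_derivative f (at 0) else (f x - f (q * x)) / of_real ((1 - q) * x))"

text \<open>
  Infinite \<open>q\<close>-differentiability on the real line only has content at \<open>0\<close>, where the \<open>q\<close>-derivative
  is the ordinary derivative.
\<close>

definition q_smooth :: "real \<Rightarrow> (real \<Rightarrow> complex) \<Rightarrow> bool" where
  "q_smooth q f \<longleftrightarrow> (\<forall>k. (q_deriv q ^^ k) f differentiable (at 0))"

definition q_schwartz_line :: "real \<Rightarrow> (real \<Rightarrow> complex) set" where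
  "q_schwartz_line q =
     {f. (\<forall>x. f (- x) = f x) \<and> q_smooth q f \<and>
         (\<forall>n m. bdd_above {cmod (of_real ((1 + x\<^sup>2) ^ m) * (q_deriv q ^^ k) f x) | x k. k \<le> n})}"

definition q_schwartz :: "real \<Rightarrow> (real \<Rightarrow> complex) set" where
  "q_schwartz q = (\<lambda>f. restrict f (Rq q)) ` q_schwartz_line q"

definition q_schwartz0 :: "real \<Rightarrow> real \<Rightarrow> (real \<Rightarrow> complex) set" where
  "q_schwartz0 q \<beta> =
     {f \<in> q_schwartz q.
        \<forall>k::nat. jackson q (\<lambda>x. (x powr (2 * real k + 2 * \<beta> + 1)) *\<^sub>R f x) = 0}"

text \<open>
  The normalized third Jackson \<open>q\<close>-Bessel function of base \<open>q\<^sup>2\<close> (the argument \<open>q\<close> is the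
  unsquared one).
\<close>

definition q_bessel3 :: "real \<Rightarrow> real \<Rightarrow> real \<Rightarrow> real" where
  "q_bessel3 q \<beta> z =
     (\<Sum>n. (- 1) ^ n * q ^ (n * (n - 1)) * (1 - q) ^ (2 * n) * z ^ (2 * n) /
           (qpoch (q\<^sup>2) (q\<^sup>2) n * qpoch (q powr (2 * \<beta> + 2)) (q\<^sup>2) n))"

definition c_bessel :: "real \<Rightarrow> real \<Rightarrow> real" where
  "c_bessel q \<beta> = (1 + inverse q) powr (- \<beta>) / qGamma (q\<^sup>2) (\<beta> + 1)"

definition q_fourier :: "real \<Rightarrow> real \<Rightarrow> (real \<Rightarrow> complex) \<Rightarrow> real \<Rightarrow> complex" where
  "q_fourier q \<beta> f l =
     c_bessel q \<beta> *\<^sub>R jackson q (\<lambda>x. (q_bessel3 q \<beta> (l * x) * x powr (2 * \<beta> + 1)) *\<^sub>R f x)"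

definition q_square_integrable :: "real \<Rightarrow> real \<Rightarrow> (real \<Rightarrow> complex) \<Rightarrow> bool" where
  "q_square_integrable q \<beta> f \<longleftrightarrow>
     jackson_integrable q (\<lambda>x. (cmod (f x))\<^sup>2 * x powr (2 * \<beta> + 1))"

text \<open>
  The translate of \<open>f\<close> is the even square integrable function with the prescribed transform. The
  transform does not see the value at \<open>0\<close> (or off the lattice), and these values do not enter any
  \<open>q\<close>-integral below, so they are left to the choice operator.
\<close>

definition q_translate :: "real \<Rightarrow> real \<Rightarrow> real \<Rightarrow> (real \<Rightarrow> complex) \<Rightarrow> real \<Rightarrow> complex" where
  "q_translate q \<beta> x f =
     (SOME h. (\<forall>y\<in>Rq q. h (- y) = h y) \<and> q_square_integrable q \<beta> h \<and>
        (\<forall>l\<in>Rq_pos q. q_fourier q \<beta> h l = q_bessel3 q \<beta> (l * x) *\<^sub>R q_fourier q \<beta> f l))"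

definition q_weyl :: "real \<Rightarrow> real \<Rightarrow> (real \<Rightarrow> complex) \<Rightarrow> real \<Rightarrow> complex" where
  "q_weyl q \<alpha> f = even_ext q (\<lambda>x.
     (q * (1 + inverse q) powr (- \<alpha> + 1/2) / qGamma (q\<^sup>2) (\<alpha> + 1/2)) *\<^sub>R
     jackson_from q (q * x) (\<lambda>t.
       (qpoch_inf (q\<^sup>2 * x\<^sup>2 / t\<^sup>2) (q\<^sup>2) /
        qpoch_inf (q powr (2 * \<alpha> + 1) * x\<^sup>2 / t\<^sup>2) (q\<^sup>2) * t powr (2 * \<alpha>)) *\<^sub>R f t))"

text \<open>
  Admissibility for the transform of index \<open>\<beta>\<close>; \<open>\<beta> = -1/2\<close> gives the ordinary (cosine) \<open>q\<close>-wavelets,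
  the weight \<open>x powr (2 * \<beta> + 1)\<close> then being \<open>1\<close> on the positive lattice.
\<close>

definition q_wavelet :: "real \<Rightarrow> real \<Rightarrow> (real \<Rightarrow> complex) \<Rightarrow> bool" where
  "q_wavelet q \<beta> g \<longleftrightarrow>
     (\<forall>x\<in>Rq q. g (- x) = g x) \<and> q_square_integrable q \<beta> g \<and>
     jackson_integrable q (\<lambda>a. (cmod (q_fourier q \<beta> g a))\<^sup>2 / a) \<and>
     0 < jackson q (\<lambda>a. (cmod (q_fourier q \<beta> g a))\<^sup>2 / a)"

definition bessel_atom ::
  "real \<Rightarrow> real \<Rightarrow> (real \<Rightarrow> complex) \<Rightarrow> real \<Rightarrow> real \<Rightarrow> real \<Rightarrow> complex" where
  "bessel_atom q \<alpha> g a b x =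
     sqrt a *\<^sub>R q_translate q \<alpha> b (\<lambda>y. (a powr (- 2 * \<alpha> - 2)) *\<^sub>R g (y / a)) x"

definition bessel_wavelet_transform ::
  "real \<Rightarrow> real \<Rightarrow> (real \<Rightarrow> complex) \<Rightarrow> (real \<Rightarrow> complex) \<Rightarrow> real \<Rightarrow> real \<Rightarrow> complex" where
  "bessel_wavelet_transform q \<alpha> g f a b =
     c_bessel q \<alpha> *\<^sub>R
     jackson q (\<lambda>x. (x powr (2 * \<alpha> + 1)) *\<^sub>R (f x * cnj (bessel_atom q \<alpha> g a b x)))"

definition cosine_atom :: "real \<Rightarrow> (real \<Rightarrow> complex) \<Rightarrow> real \<Rightarrow> real \<Rightarrow> real \<Rightarrow> complex" where
  "cosine_atom q h a b = q_translate q (- 1/2) b (\<lambda>y. (1 / sqrt a) *\<^sub>R h (y / a))"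

definition cosine_wavelet_transform ::
  "real \<Rightarrow> (real \<Rightarrow> complex) \<Rightarrow> (real \<Rightarrow> complex) \<Rightarrow> real \<Rightarrow> real \<Rightarrow> complex" where
  "cosine_wavelet_transform q h f a b =
     c_bessel q (- 1/2) *\<^sub>R jackson q (\<lambda>x. f x * cnj (cosine_atom q h a b x))"

text \<open>
  The inverse of the Weyl transform, as a map from \<open>q_schwartz0 q (-1/2)\<close> to \<open>q_schwartz0 q \<alpha>\<close>.
\<close>

definition q_weyl_inv :: "real \<Rightarrow> real \<Rightarrow> (real \<Rightarrow> complex) \<Rightarrow> real \<Rightarrow> complex" where
  "q_weyl_inv q \<alpha> = the_inv_into (q_schwartz0 q \<alpha>) (q_weyl q \<alpha>)"

end

theory Submission
  imports Defs
begin

text \<open>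
  Why the identity holds. Both wavelet transforms are Fourier multipliers in the variable \<open>b\<close>.
  The translate of the dilated wavelet has, as transform, a dilated \<open>q\<close>-Bessel function times
  the transform of the wavelet at \<open>a l\<close>. By Parseval's formula and inversion, the \<open>q\<close>-Bessel wavelet transform
  therefore has the \<open>q\<close>-Bessel transform
  \<open>G l = sqrt a * F f l * cnj (F g (a * l))\<close>, and the \<open>q\<close>-cosine wavelet transform of the Weyl transforms
  has the \<open>q\<close>-cosine transform built in the same way from the \<open>q\<close>-cosine transforms of \<open>W f\<close> and \<open>W g\<close>. As
  the \<open>q\<close>-Bessel transform is the \<open>q\<close>-cosine transform after \<open>W\<close>, the latter is again \<open>G\<close>. Hence \<open>W\<close>
  maps the first wavelet transform to the second, and \<open>W\<close> is injective.

  Three things carry this argument.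

  Inversion (\<open>F_inversion\<close>). Since \<open>1 - q\<close> is a power of \<open>q\<close>, the transform is a matrix indexed by the
  lattice whose entries depend only on the product \<open>l x\<close>. Its square is a multiple of the identity
  because distinct dilations of the \<open>q\<close>-Bessel function are orthogonal (\<open>J_dilations_orthogonal\<close>), which
  is a Wronskian argument for its second-order \<open>q\<close>-difference equation. All convergence questions rest on the
  rapid decay of the \<open>q\<close>-Bessel function on the lattice (\<open>J_decay\<close>); this follows from a symmetric double
  series (\<open>bessel_series_symmetric\<close>).

  Factorization (\<open>cosine_transform_weyl\<close>). The \<open>q\<close>-Bessel function is an average of dilated \<open>q\<close>-cosines
  (\<open>q_sonine\<close>), term by term an instance of the \<open>q\<close>-binomial theorem, and the Weyl transform is the
  transpose of that average.

  Range. The inverse Weyl transform is defined on the image of the Schwartz functions with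
  vanishing moments, so the \<open>q\<close>-Bessel wavelet transform must be shown to be such a function. The
  transform of a function with vanishing moments is flat at the origin (\<open>F_flat\<close>), smoothness at the origin becomes
  decay (\<open>F_rapid\<close>), so \<open>G\<close> is flat and rapidly decreasing; its transform back then has an
  expansion at the origin, rapid decay and vanishing moments. Finally a function on the lattice with these
  properties extends to the real line (\<open>even_ext_in_schwartz\<close>).
\<close>

section \<open>Euler's series and the infinite product\<close>

lemma qpoch_0 [simp]: "qpoch a q 0 = 1"
  by (simp add: qpoch_def)

lemma qpoch_Suc: "qpoch a q (Suc n) = (1 - a * q ^ n) * qpoch a q n"
  by (simp add: qpoch_def mult.commute)

lemma qpoch_pos:
  assumes "0 \<le> q" "q \<le> 1" "a < 1"
  shows "0 < qpoch a q n"
  unfolding qpoch_def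
proof (rule prod_pos)
  fix k
  show "0 < 1 - a * q ^ k"
  proof (cases "0 \<le> a")
    case True
    have "a * q ^ k \<le> a * 1"
      using True assms by (intro mult_left_mono power_le_one) auto
    then show ?thesis using assms by simp
  next
    case False
    then have "a * q ^ k \<le> 0"
      using assms by (intro mult_nonpos_nonneg) auto
    then show ?thesis by simp
  qed
qed

lemma summable_ratio_limit:
  fixes u :: "nat \<Rightarrow> real"
  assumes "\<And>n. u (Suc n) = r n * u n" and "r \<longlonglongrightarrow> l" and "\<bar>l\<bar> < 1"
  shows "summable (\<lambda>n. \<bar>u n\<bar>)"
proof -
  obtain c where c: "\<bar>l\<bar> < c" "c < 1"
    using assms(3) dense by blast
  have "(\<lambda>n. \<bar>r n\<bar>) \<longlonglongrightarrow> \<bar>l\<bar>"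
    using assms(2) by (rule tendsto_rabs)
  then have "eventually (\<lambda>n. \<bar>r n\<bar> < c) sequentially"
    using c(1) order_tendstoD(2) by blast
  then obtain N where N: "\<And>n. n \<ge> N \<Longrightarrow> \<bar>r n\<bar> < c"
    unfolding eventually_sequentially by blast
  show ?thesis
  proof (rule summable_ratio_test[OF c(2)])
    fix n assume "N \<le> n"
    then have "\<bar>r n\<bar> * \<bar>u n\<bar> \<le> c * \<bar>u n\<bar>"
      using N[of n] by (intro mult_right_mono) auto
    then show "norm \<bar>u (Suc n)\<bar> \<le> c * norm \<bar>u n\<bar>"
      using assms(1)[of n] by (simp add: abs_mult)
  qed
qed

text \<open>
  All series are taken in base \<open>q\<^sup>2\<close>. Euler's series is the one of \<open>(z; q\<^sup>2)\<^sub>\<infinity>\<close>, and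
  \<open>bessel_series q b\<close> is the basic hypergeometric series of type \<open>(1,1)\<close> with parameters \<open>0; b\<close>;
  the third Jackson \<open>q\<close>-Bessel function is its value for \<open>b = q powr (2 \<beta> + 2)\<close> at \<open>((1 - q) x)\<^sup>2\<close>.
\<close>

definition euler_coeff :: "real \<Rightarrow> nat \<Rightarrow> real" where
  "euler_coeff q n = (- 1) ^ n * q ^ (n * (n - 1)) / qpoch (q\<^sup>2) (q\<^sup>2) n"

definition euler_series :: "real \<Rightarrow> real \<Rightarrow> real" where
  "euler_series q z = (\<Sum>n. euler_coeff q n * z ^ n)"

definition bessel_coeff :: "real \<Rightarrow> real \<Rightarrow> nat \<Rightarrow> real" where
  "bessel_coeff q b n = euler_coeff q n / qpoch b (q\<^sup>2) n"

definition bessel_series :: "real \<Rightarrow> real \<Rightarrow> real \<Rightarrow> real" where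
  "bessel_series q b z = (\<Sum>n. bessel_coeff q b n * z ^ n)"

locale q_base =
  fixes q :: real
  assumes q_pos: "0 < q" and q_less_1: "q < 1"
begin

abbreviation p :: real where "p \<equiv> q\<^sup>2"

lemma qq_pos: "0 < p" and qq_less_1: "p < 1"
  using q_pos q_less_1 by (simp_all add: abs_square_less_1)

lemma one_minus_qq_power: "0 < 1 - p ^ Suc n"
  using qq_pos qq_less_1 by (simp add: power_Suc_less_one del: power_Suc)

lemma qq_poch_pos: "0 < qpoch p p n"
  using qq_pos qq_less_1 by (intro qpoch_pos) auto

lemma qq_tendsto: "(\<lambda>n. p ^ n) \<longlonglongrightarrow> 0"
  using qq_pos qq_less_1 by (intro LIMSEQ_realpow_zero) auto

lemma euler_coeff_0: "euler_coeff q 0 = 1"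
  by (simp add: euler_coeff_def)

lemma euler_coeff_Suc: "(1 - p ^ Suc n) * euler_coeff q (Suc n) = - (p ^ n * euler_coeff q n)"
proof -
  have "Suc n * (Suc n - 1) = 2 * n + n * (n - 1)"
    by (cases n) simp_all
  then have e: "q ^ (Suc n * (Suc n - 1)) = p ^ n * q ^ (n * (n - 1))"
    by (simp only: power_add power_mult)
  have Q: "qpoch p p (Suc n) = (1 - p ^ Suc n) * qpoch p p n"
    by (simp add: qpoch_Suc)
  have "x * ((- 1) ^ Suc n * (u * v) / (x * y)) = - (u * ((- 1) ^ n * v / y))" if "x \<noteq> 0" for x y u v :: real
    using that by simp
  then show ?thesis
    unfolding euler_coeff_def e Q using one_minus_qq_power[of n] by (metis less_irrefl)
qed

lemma euler_coeff_ratio: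
  "euler_coeff q (Suc n) = - (p ^ n) / (1 - p ^ Suc n) * euler_coeff q n"
proof -
  have "x = - u / y * v" if "y * x = - (u * v)" "y \<noteq> 0" for x y u v :: real
    using that by (simp add: field_simps)
  then show ?thesis
    using euler_coeff_Suc[of n] one_minus_qq_power[of n] by (metis less_irrefl)
qed

lemma summable_euler: "summable (\<lambda>n. \<bar>euler_coeff q n * z ^ n\<bar>)"
proof (rule summable_ratio_limit)
  show "euler_coeff q (Suc n) * z ^ Suc n
      = (- (p ^ n) / (1 - p ^ Suc n) * z) * (euler_coeff q n * z ^ n)" for n
    unfolding euler_coeff_ratio by simp
  have "(\<lambda>n. - (p ^ n) / (1 - p ^ Suc n) * z) \<longlonglongrightarrow> - 0 / (1 - 0) * z"
    by (intro tendsto_intros qq_tendsto LIMSEQ_Suc[OF qq_tendsto]) auto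
  then show "(\<lambda>n. - (p ^ n) / (1 - p ^ Suc n) * z) \<longlonglongrightarrow> 0" by simp
qed simp

lemma euler_sums: "(\<lambda>n. euler_coeff q n * z ^ n) sums euler_series q z"
  unfolding euler_series_def by (rule summable_sums[OF summable_rabs_cancel[OF summable_euler]])

lemma euler_series_step: "euler_series q z = (1 - z) * euler_series q (p * z)"
proof -
  let ?c = "euler_coeff q"
  have "(\<lambda>n. ?c n * z ^ n - ?c n * (p * z) ^ n) sums (euler_series q z - euler_series q (p * z))"
    by (intro sums_diff euler_sums)
  moreover have "(\<lambda>n. ?c n * z ^ n - ?c n * (p * z) ^ n) = (\<lambda>n. (1 - p ^ n) * ?c n * z ^ n)"
    by (simp add: power_mult_distrib algebra_simps)
  ultimately have "(\<lambda>n. (1 - p ^ Suc n) * ?c (Suc n) * z ^ Suc n)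
      sums (euler_series q z - euler_series q (p * z))"
    using sums_Suc_iff[of "\<lambda>n. (1 - p ^ n) * ?c n * z ^ n"] by simp
  moreover have "(1 - p ^ Suc n) * ?c (Suc n) * z ^ Suc n = - z * (?c n * (p * z) ^ n)" for n
    unfolding euler_coeff_Suc by (simp add: power_mult_distrib)
  moreover have "(\<lambda>n. - z * (?c n * (p * z) ^ n)) sums (- z * euler_series q (p * z))"
    by (intro sums_mult euler_sums)
  ultimately have "euler_series q z - euler_series q (p * z) = - z * euler_series q (p * z)"
    by (simp add: sums_unique2)
  then show ?thesis by (simp add: algebra_simps)
qed

lemma euler_series_power: "euler_series q z = qpoch z p n * euler_series q (z * p ^ n)"
proof (induction n)
  case (Suc n)
  have "euler_series q (z * p ^ n) = (1 - z * p ^ n) * euler_series q (z * p ^ Suc n)"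
    using euler_series_step[of "z * p ^ n"] by (simp add: mult_ac)
  then show ?case unfolding Suc.IH qpoch_Suc by (simp only: mult_ac)
qed simp

text \<open>
  The zeros of the product at the nonpositive powers of \<open>q\<^sup>2\<close>. The decay of the \<open>q\<close>-Bessel function
  and the causality of the Weyl kernel both come from them.
\<close>

lemma euler_series_eq_0: "euler_series q (inverse (p ^ n)) = 0"
proof -
  have "euler_series q 1 = 0"
    using euler_series_step[of 1] by simp
  then show ?thesis
  proof (induction n)
    case (Suc n)
    have "p * inverse (p ^ Suc n) = inverse (p ^ n)"
      using q_pos by (simp add: field_simps)
    then show ?case
      unfolding euler_series_step[of "inverse (p ^ Suc n)"] using Suc by (simp only: mult_zero_right)
  qed simp
qed

lemma euler_series_bounded:
  assumes "\<bar>z\<bar> \<le> 1"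
  shows "\<bar>euler_series q z\<bar> \<le> (\<Sum>n. \<bar>euler_coeff q n\<bar>)"
proof -
  have s: "summable (\<lambda>n. \<bar>euler_coeff q n\<bar>)"
    using summable_euler[of 1] by simp
  have "\<bar>euler_series q z\<bar> \<le> (\<Sum>n. \<bar>euler_coeff q n * z ^ n\<bar>)"
    unfolding euler_series_def by (rule summable_rabs[OF summable_euler])
  also have "\<dots> \<le> (\<Sum>n. \<bar>euler_coeff q n\<bar>)"
  proof (rule suminf_le[OF _ summable_euler s])
    fix n
    have "\<bar>z\<bar> ^ n \<le> 1" using assms by (simp add: power_le_one)
    then show "\<bar>euler_coeff q n * z ^ n\<bar> \<le> \<bar>euler_coeff q n\<bar>"
      by (simp add: abs_mult power_abs mult_left_le)
  qed
  finally show ?thesis .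
qed

lemma euler_series_tendsto: "(\<lambda>n. euler_series q (z * p ^ n)) \<longlonglongrightarrow> 1"
proof -
  have "isCont (euler_series q) 0"
    unfolding euler_series_def
    by (rule isCont_powser[where K = 1]) (use summable_euler[of 1] summable_rabs_cancel in auto)
  moreover have "(\<lambda>n. z * p ^ n) \<longlonglongrightarrow> 0"
    using tendsto_mult_right_zero[OF qq_tendsto] by simp
  ultimately have "(\<lambda>n. euler_series q (z * p ^ n)) \<longlonglongrightarrow> euler_series q 0"
    using isCont_tendsto_compose by blast
  moreover have "euler_series q 0 = 1"
    using powser_zero[of "euler_coeff q"] by (simp add: euler_series_def euler_coeff_0)
  ultimately show ?thesis by simp
qed

lemma qpoch_tendsto_euler: "qpoch z p \<longlonglongrightarrow> euler_series q z"
proof -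
  have "eventually (\<lambda>n. euler_series q (z * p ^ n) \<noteq> 0) sequentially"
    using tendsto_imp_eventually_ne[OF euler_series_tendsto, of 0] by simp
  then have "eventually (\<lambda>n. euler_series q z / euler_series q (z * p ^ n) = qpoch z p n) sequentially"
  proof eventually_elim
    case (elim n)
    then show ?case using euler_series_power[of z n] by simp
  qed
  moreover have "(\<lambda>n. euler_series q z / euler_series q (z * p ^ n)) \<longlonglongrightarrow> euler_series q z / 1"
    by (intro tendsto_intros euler_series_tendsto) auto
  ultimately show ?thesis
    using tendsto_cong by fastforce
qed

lemma euler_series_pos:
  assumes "z < 1"
  shows "0 < euler_series q z"
proof -
  have "eventually (\<lambda>n. 0 < euler_series q (z * p ^ n)) sequentially"
    using order_tendstoD(1)[OF euler_series_tendsto] by (metis zero_less_one)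
  then obtain n where "0 < euler_series q (z * p ^ n)"
    unfolding eventually_sequentially by blast
  moreover have "0 < qpoch z p n"
    using assms qq_pos qq_less_1 by (intro qpoch_pos) auto
  ultimately show ?thesis
    using euler_series_power[of z n] by simp
qed

text \<open>
  Euler's series is the infinite product \<open>(z; q\<^sup>2)\<^sub>\<infinity>\<close>, also when one of the factors vanishes.
\<close>

lemma qpoch_inf_eq_euler: "qpoch_inf z p = euler_series q z"
proof -
  have "summable (\<lambda>k. norm (z * p ^ k))"
    using qq_pos qq_less_1 by (simp add: abs_mult power_abs summable_geometric)
  then have "convergent_prod (\<lambda>k. 1 - z * p ^ k)"
    using summable_imp_abs_convergent_prod[of "\<lambda>k. 1 - z * p ^ k"]
      abs_convergent_prod_imp_convergent_prod[of "\<lambda>k. 1 - z * p ^ k"] by simp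
  then have "(\<lambda>n. \<Prod>k\<le>n. 1 - z * p ^ k) \<longlonglongrightarrow> qpoch_inf z p"
    unfolding qpoch_inf_def by (rule convergent_prod_LIMSEQ)
  moreover have "(\<lambda>n. \<Prod>k\<le>n. 1 - z * p ^ k) = (\<lambda>n. qpoch z p (Suc n))"
    by (simp add: qpoch_def lessThan_Suc_atMost)
  ultimately show ?thesis
    using LIMSEQ_Suc[OF qpoch_tendsto_euler[of z]] LIMSEQ_unique by metis
qed

end

section \<open>The Hahn-Exton series and its decay\<close>

lemma summable_on_Times_nonneg:
  fixes f :: "'a \<Rightarrow> real" and g :: "'b \<Rightarrow> real"
  assumes "f summable_on A" "g summable_on B"
    and "\<And>x. x \<in> A \<Longrightarrow> 0 \<le> f x" "\<And>y. y \<in> B \<Longrightarrow> 0 \<le> g y"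
  shows "(\<lambda>(x, y). f x * g y) summable_on A \<times> B"
proof -
  have f: "(\<lambda>x. norm (f x)) summable_on A" and g: "(\<lambda>y. norm (g y)) summable_on B"
    using assms by (auto cong: summable_on_cong)
  have "(\<lambda>z. norm (case z of (x, y) \<Rightarrow> f x * g y)) summable_on A \<times> B"
    unfolding Infinite_Sum.abs_summable_on_Sigma_iff
    using f g by (auto simp: norm_mult infsum_cmult_right' abs_mult infsum_nonneg
        intro: summable_on_cmult_right summable_on_cmult_left)
  then show ?thesis by (rule abs_summable_summable)
qed

locale bessel_base = q_base +
  fixes b :: real
  assumes b_pos: "0 < b" and b_less_1: "b < 1"
begin

lemma b_poch_pos: "0 < qpoch b p n"
  using qq_pos qq_less_1 b_less_1 by (intro qpoch_pos) auto

lemma b_factor_pos: "0 < 1 - b * p ^ n"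
proof -
  have "b * p ^ n \<le> b * 1"
    using b_pos q_pos q_less_1 qq_less_1 by (intro mult_left_mono power_le_one) auto
  then show ?thesis using b_less_1 by simp
qed

lemma bessel_coeff_0: "bessel_coeff q b 0 = 1"
  by (simp add: bessel_coeff_def euler_coeff_0)

lemma bessel_coeff_ratio:
  "bessel_coeff q b (Suc n)
    = - (p ^ n) / ((1 - p ^ Suc n) * (1 - b * p ^ n)) * bessel_coeff q b n"
  unfolding bessel_coeff_def qpoch_Suc euler_coeff_ratio by (simp add: mult_ac del: power_Suc)

lemma bessel_coeff_Suc:
  "(1 - p ^ Suc n) * (1 - b * p ^ n) * bessel_coeff q b (Suc n)
    = - (p ^ n * bessel_coeff q b n)"
proof -
  have "y * w * (- u / (y * w) * x) = - (u * x)" if "y \<noteq> 0" "w \<noteq> 0" for x y u w :: real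
    using that by simp
  then show ?thesis
    unfolding bessel_coeff_ratio using one_minus_qq_power[of n] b_factor_pos[of n]
    by (metis less_irrefl)
qed

lemma summable_bessel: "summable (\<lambda>n. \<bar>bessel_coeff q b n * z ^ n\<bar>)"
proof (rule summable_ratio_limit)
  let ?r = "\<lambda>n. - (p ^ n) / ((1 - p ^ Suc n) * (1 - b * p ^ n)) * z"
  show "bessel_coeff q b (Suc n) * z ^ Suc n = ?r n * (bessel_coeff q b n * z ^ n)" for n
    unfolding bessel_coeff_ratio by simp
  have "?r \<longlonglongrightarrow> - 0 / ((1 - 0) * (1 - b * 0)) * z"
    by (intro tendsto_intros qq_tendsto LIMSEQ_Suc[OF qq_tendsto]) auto
  then show "?r \<longlonglongrightarrow> 0" by simp
qed simp

lemma bessel_sums: "(\<lambda>n. bessel_coeff q b n * z ^ n) sums bessel_series q b z"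
  unfolding bessel_series_def by (rule summable_sums[OF summable_rabs_cancel[OF summable_bessel]])

lemma bessel_series_recurrence:
  "bessel_series q b z - (1 + b / p) * bessel_series q b (p * z)
      + b / p * bessel_series q b (p\<^sup>2 * z) = - z * bessel_series q b (p * z)"
  (is "?D = _")
proof -
  let ?c = "bessel_coeff q b"
  have "(\<lambda>n. ?c n * z ^ n - (1 + b / p) * (?c n * (p * z) ^ n)
      + b / p * (?c n * (p\<^sup>2 * z) ^ n)) sums ?D"
    by (intro sums_add sums_diff sums_mult bessel_sums)
  moreover have "?c n * z ^ n - (1 + b / p) * (?c n * (p * z) ^ n) + b / p * (?c n * (p\<^sup>2 * z) ^ n)
      = (1 - p ^ n) * (1 - b / p * p ^ n) * ?c n * z ^ n" for n
  proof -
    have "(p\<^sup>2) ^ n = p ^ n * p ^ n"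
      by (simp add: power2_eq_square power_mult_distrib)
    then show ?thesis by (simp only: power_mult_distrib) (simp only: algebra_simps)
  qed
  ultimately have "(\<lambda>n. (1 - p ^ n) * (1 - b / p * p ^ n) * ?c n * z ^ n) sums ?D"
    by simp
  then have "(\<lambda>n. (1 - p ^ Suc n) * (1 - b / p * p ^ Suc n) * ?c (Suc n) * z ^ Suc n) sums ?D"
    using sums_Suc_iff[of "\<lambda>n. (1 - p ^ n) * (1 - b / p * p ^ n) * ?c n * z ^ n"] by simp
  moreover have "(1 - p ^ Suc n) * (1 - b / p * p ^ Suc n) * ?c (Suc n) * z ^ Suc n
      = - z * (?c n * (p * z) ^ n)" for n
  proof -
    have "b / p * p ^ Suc n = b * p ^ n" using q_pos by simp
    then show ?thesis
      by (simp only: bessel_coeff_Suc) (simp add: power_mult_distrib)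
  qed
  moreover have "(\<lambda>n. - z * (?c n * (p * z) ^ n)) sums (- z * bessel_series q b (p * z))"
    by (intro sums_mult bessel_sums)
  ultimately show ?thesis by (simp add: sums_unique2)
qed

lemma bessel_series_remainder:
  assumes "0 \<le> z" "z \<le> 1"
  shows "\<bar>bessel_series q b z - (\<Sum>n<N. bessel_coeff q b n * z ^ n)\<bar>
    \<le> (\<Sum>n. \<bar>bessel_coeff q b (n + N)\<bar>) * z ^ N"
proof -
  let ?c = "bessel_coeff q b"
  have s: "summable (\<lambda>n. ?c n * z ^ n)"
    by (rule summable_rabs_cancel[OF summable_bessel])
  have s1: "summable (\<lambda>n. \<bar>?c (n + N)\<bar>)"
    using summable_bessel[of 1] by (subst summable_iff_shift) simp
  have s2: "summable (\<lambda>n. \<bar>?c (n + N) * z ^ (n + N)\<bar>)"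
    using summable_bessel[of z] summable_iff_shift[of "\<lambda>n. \<bar>?c n * z ^ n\<bar>" N] by simp
  have "bessel_series q b z - (\<Sum>n<N. ?c n * z ^ n) = (\<Sum>n. ?c (n + N) * z ^ (n + N))"
    unfolding bessel_series_def using suminf_split_initial_segment[OF s, of N] by simp
  also have "\<bar>\<dots>\<bar> \<le> (\<Sum>n. \<bar>?c (n + N) * z ^ (n + N)\<bar>)"
    by (rule summable_rabs[OF s2])
  also have "\<dots> \<le> (\<Sum>n. \<bar>?c (n + N)\<bar> * z ^ N)"
  proof (rule suminf_le[OF _ s2 summable_mult2[OF s1]])
    fix n
    have "z ^ n \<le> 1" using assms by (simp add: power_le_one)
    then have "\<bar>?c (n + N)\<bar> * z ^ N * z ^ n \<le> \<bar>?c (n + N)\<bar> * z ^ N"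
      using assms by (intro mult_left_le) auto
    then show "\<bar>?c (n + N) * z ^ (n + N)\<bar> \<le> \<bar>?c (n + N)\<bar> * z ^ N"
      using assms by (simp add: abs_mult power_add mult_ac)
  qed
  also have "\<dots> = (\<Sum>n. \<bar>?c (n + N)\<bar>) * z ^ N"
    by (rule suminf_mult2[OF s1, symmetric])
  finally show ?thesis .
qed

text \<open>
  The series is alternating with huge terms when \<open>z\<close> is large, and its decay is invisible in the
  definition. Multiplied by \<open>(b; q\<^sup>2)\<^sub>\<infinity>\<close> and expanded by Euler's formula it becomes a double series
  that is symmetric in \<open>z\<close> and \<open>b\<close>; summing over the other index first puts the factor
  \<open>(z q\<^sup>2\<^sup>k; q\<^sup>2)\<^sub>\<infinity>\<close> into each term, and this factor vanishes for \<open>k \<le> M\<close> when \<open>z = q\<^sup>-\<^sup>2\<^sup>M\<close>.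
\<close>

lemma bessel_series_symmetric:
  "euler_series q b * bessel_series q b z
    = (\<Sum>k. euler_coeff q k * b ^ k * euler_series q (z * p ^ k))"
proof -
  let ?e = "euler_coeff q"
  define t where "t n k = ?e n * z ^ n * (?e k * b ^ k) * p ^ (n * k)" for n k
  have sn: "(\<lambda>n. \<bar>?e n * x ^ n\<bar>) summable_on UNIV" for x
    by (rule summable_nonneg_imp_summable_on[OF summable_euler]) simp
  have "(\<lambda>(n, k). \<bar>?e n * z ^ n\<bar> * \<bar>?e k * b ^ k\<bar>) summable_on UNIV \<times> UNIV"
    by (intro summable_on_Times_nonneg sn) auto
  then have "(\<lambda>x. norm (case x of (n, k) \<Rightarrow> t n k)) summable_on UNIV \<times> UNIV"
  proof (rule Infinite_Sum.abs_summable_on_comparison_test')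
    fix x :: "nat \<times> nat"
    obtain n k where x: "x = (n, k)" by fastforce
    have "p ^ (n * k) \<le> 1"
      using q_pos q_less_1 qq_less_1 by (intro power_le_one) auto
    then show "norm (case x of (n, k) \<Rightarrow> t n k) \<le> (case x of (n, k) \<Rightarrow> \<bar>?e n * z ^ n\<bar> * \<bar>?e k * b ^ k\<bar>)"
      unfolding x t_def by (simp add: abs_mult mult_left_le)
  qed
  then have "(\<lambda>(n, k). t n k) summable_on UNIV \<times> UNIV"
    by (rule abs_summable_summable)
  then have swap: "(\<Sum>\<^sub>\<infinity>n. \<Sum>\<^sub>\<infinity>k. t n k) = (\<Sum>\<^sub>\<infinity>k. \<Sum>\<^sub>\<infinity>n. t n k)"
    by (rule infsum_swap_banach)
  have inf_e: "(\<Sum>\<^sub>\<infinity>n. ?e n * x ^ n) = euler_series q x" for x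
    using norm_summable_imp_has_sum[OF _ euler_sums, of x] summable_euler[of x]
    by (simp add: infsumI)
  have "(\<Sum>\<^sub>\<infinity>k. t n k) = euler_series q b * (bessel_coeff q b n * z ^ n)" for n
  proof -
    have "t n k = ?e n * z ^ n * (?e k * (b * p ^ n) ^ k)" for k
      unfolding t_def by (simp add: power_mult[symmetric] power_mult_distrib mult_ac)
    then have "(\<Sum>\<^sub>\<infinity>k. t n k) = ?e n * z ^ n * euler_series q (b * p ^ n)"
      by (simp only: infsum_cmult_right' inf_e)
    then show ?thesis
      unfolding euler_series_power[of b n] bessel_coeff_def using b_poch_pos[of n] by simp
  qed
  moreover have "(\<Sum>\<^sub>\<infinity>n. t n k) = ?e k * b ^ k * euler_series q (z * p ^ k)" for k
  proof -
    have "t n k = ?e k * b ^ k * (?e n * (z * p ^ k) ^ n)" for n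
      unfolding t_def mult.commute[of n k] by (simp add: power_mult[symmetric] power_mult_distrib mult_ac)
    then show ?thesis by (simp only: infsum_cmult_right' inf_e)
  qed
  moreover have "(\<Sum>\<^sub>\<infinity>n. bessel_coeff q b n * z ^ n) = bessel_series q b z"
    using norm_summable_imp_has_sum[OF _ bessel_sums, of z] summable_bessel[of z]
    by (simp add: infsumI)
  ultimately have eq: "euler_series q b * bessel_series q b z
      = (\<Sum>\<^sub>\<infinity>k. ?e k * b ^ k * euler_series q (z * p ^ k))"
    using swap by (simp only: infsum_cmult_right')
  obtain K where K: "\<And>k. \<bar>euler_series q (z * p ^ k)\<bar> \<le> K"
    using convergent_imp_Bseq[OF convergentI[OF euler_series_tendsto[of z]]]
    unfolding Bseq_def by auto
  have "summable (\<lambda>k. norm (?e k * b ^ k * euler_series q (z * p ^ k)))"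
  proof (rule summable_comparison_test'[OF summable_mult2[OF summable_euler[of b], of K]])
    fix k
    show "norm (norm (?e k * b ^ k * euler_series q (z * p ^ k))) \<le> \<bar>?e k * b ^ k\<bar> * K"
      using K[of k] by (simp add: abs_mult mult_left_mono)
  qed
  note norms = this
  show ?thesis
    unfolding eq
    by (rule infsumI[OF norm_summable_imp_has_sum[OF norms summable_sums[OF summable_norm_cancel[OF norms]]]])
qed

text \<open>
  For \<open>z = q\<^sup>-\<^sup>2\<^sup>M\<close> only the terms with \<open>k > M\<close> of the symmetric expansion survive, and each of
  these carries the factor \<open>q ^ (k (k - 1))\<close>.
\<close>

lemma bessel_series_decay:
  "\<exists>C. \<forall>M. \<bar>bessel_series q b (inverse (p ^ M))\<bar> \<le> C * q ^ (M * M)"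
proof -
  let ?e = "euler_coeff q"
  define A where "A = (\<Sum>n. \<bar>?e n\<bar>)"
  have A: "0 \<le> A"
    unfolding A_def using summable_euler[of 1] by (intro suminf_nonneg) simp_all
  have s: "summable (\<lambda>k. \<bar>b ^ k / qpoch p p k\<bar>)"
  proof (rule summable_ratio_limit)
    show "b ^ Suc n / qpoch p p (Suc n)
        = b / (1 - p ^ Suc n) * (b ^ n / qpoch p p n)" for n
      by (simp add: qpoch_Suc)
    have "(\<lambda>n. b / (1 - p ^ Suc n)) \<longlonglongrightarrow> b / (1 - 0)"
      by (intro tendsto_intros LIMSEQ_Suc[OF qq_tendsto]) auto
    then show "(\<lambda>n. b / (1 - p ^ Suc n)) \<longlonglongrightarrow> b" by simp
  qed (use b_pos b_less_1 in simp)
  define D where "D = (\<Sum>k. \<bar>b ^ k / qpoch p p k\<bar>)"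
  have "\<bar>euler_series q b * bessel_series q b (inverse (p ^ M))\<bar> \<le> D * (A * q ^ (M * M))" for M
  proof -
    let ?z = "inverse (p ^ M)"
    let ?t = "\<lambda>k. ?e k * b ^ k * euler_series q (?z * p ^ k)"
    have t: "\<bar>?t k\<bar> \<le> \<bar>b ^ k / qpoch p p k\<bar> * (A * q ^ (M * M))" for k
    proof (cases "k \<le> M")
      case True
      then have "?z * p ^ k = inverse (p ^ (M - k))"
        using q_pos by (simp add: power_diff field_simps)
      then show ?thesis using euler_series_eq_0 A q_pos by simp
    next
      case False
      then have "?z * p ^ k = p ^ (k - M)"
        using q_pos by (simp add: power_diff field_simps)
      then have "\<bar>?z * p ^ k\<bar> \<le> 1"
        using qq_pos qq_less_1 by (simp add: power_le_one)
      then have 1: "\<bar>euler_series q (?z * p ^ k)\<bar> \<le> A"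
        unfolding A_def by (rule euler_series_bounded)
      have "M * M \<le> k * (k - 1)" using False by (intro mult_le_mono) auto
      then have 2: "q ^ (k * (k - 1)) \<le> q ^ (M * M)"
        using q_pos q_less_1 by (intro power_decreasing) auto
      have "\<bar>?t k\<bar> = \<bar>b ^ k / qpoch p p k\<bar> * (\<bar>euler_series q (?z * p ^ k)\<bar> * q ^ (k * (k - 1)))"
        unfolding euler_coeff_def using q_pos by (simp add: abs_mult)
      also have "\<dots> \<le> \<bar>b ^ k / qpoch p p k\<bar> * (A * q ^ (M * M))"
        using 1 2 A q_pos by (intro mult_left_mono mult_mono) auto
      finally show ?thesis .
    qed
    have s1: "summable (\<lambda>k. \<bar>?t k\<bar>)"
      by (rule summable_comparison_test'[OF summable_mult2[OF s, of "A * q ^ (M * M)"]])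
        (use t in auto)
    have "\<bar>euler_series q b * bessel_series q b ?z\<bar> \<le> (\<Sum>k. \<bar>?t k\<bar>)"
      unfolding bessel_series_symmetric by (rule summable_rabs[OF s1])
    also have "\<dots> \<le> (\<Sum>k. \<bar>b ^ k / qpoch p p k\<bar> * (A * q ^ (M * M)))"
      by (rule suminf_le[OF t s1 summable_mult2[OF s]])
    also have "\<dots> = D * (A * q ^ (M * M))"
      unfolding D_def by (rule suminf_mult2[OF s, symmetric])
    finally show ?thesis .
  qed
  then have "\<bar>bessel_series q b (inverse (p ^ M))\<bar> \<le> D * A / euler_series q b * q ^ (M * M)" for M
    using euler_series_pos[OF b_less_1] by (simp add: abs_mult field_simps)
  then show ?thesis by blast
qed

end

section \<open>Sums over the lattice\<close>

lemma infsum_diff: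
  fixes f g :: "'a \<Rightarrow> 'b::{topological_ab_group_add, t2_space}"
  assumes "f summable_on A" "g summable_on A"
  shows "(\<Sum>\<^sub>\<infinity>x\<in>A. f x - g x) = infsum f A - infsum g A"
  using infsum_add[OF assms(1) summable_on_uminus[THEN iffD2, OF assms(2)]]
  by (simp add: infsum_uminus)

lemma summable_on_diff:
  fixes f g :: "'a \<Rightarrow> 'b::{topological_ab_group_add, t2_space}"
  assumes "f summable_on A" "g summable_on A"
  shows "(\<lambda>x. f x - g x) summable_on A"
  using summable_on_add[OF assms(1) summable_on_uminus[THEN iffD2, OF assms(2)]] by simp

lemma infsum_dominated:
  fixes f :: "'a \<Rightarrow> 'b::banach"
  assumes "g summable_on A" and "\<And>x. x \<in> A \<Longrightarrow> norm (f x) \<le> g x"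
  shows "f summable_on A" and "norm (infsum f A) \<le> infsum g A"
proof -
  have n: "(\<lambda>x. norm (f x)) summable_on A"
    by (rule Infinite_Sum.abs_summable_on_comparison_test'[OF assms])
  then show "f summable_on A" by (rule abs_summable_summable)
  show "norm (infsum f A) \<le> infsum g A"
    using norm_infsum_bound[OF n] infsum_mono[OF n assms] by linarith
qed

context q_base
begin

abbreviation L :: "real set" where "L \<equiv> Rq_pos q"

lemma L_pos: "x \<in> L \<Longrightarrow> 0 < x"
  using q_pos by (auto simp: Rq_pos_def)

lemma L_not_0: "x \<in> L \<Longrightarrow> x \<noteq> 0"
  using L_pos by force

lemma L_mult: "x \<in> L \<Longrightarrow> y \<in> L \<Longrightarrow> x * y \<in> L"
  using q_pos by (auto simp: Rq_pos_def power_int_add[symmetric])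

lemma L_inverse: "x \<in> L \<Longrightarrow> inverse x \<in> L"
  by (auto simp: Rq_pos_def power_int_minus[symmetric])

lemma L_divide: "x \<in> L \<Longrightarrow> y \<in> L \<Longrightarrow> x / y \<in> L"
  unfolding divide_inverse by (intro L_mult L_inverse)

lemma L_power: "q ^ n \<in> L"
  unfolding Rq_pos_def by (rule image_eqI[of _ _ "int n"]) auto

lemma L_1: "1 \<in> L" and L_q: "q \<in> L"
  using L_power[of 0] L_power[of 1] by simp_all

lemma L_cases:
  assumes "x \<in> L"
  obtains (small) n where "x = q ^ n" | (large) n where "x = inverse (q ^ n)"
proof -
  obtain m where m: "x = q powi m"
    using assms by (auto simp: Rq_pos_def)
  show thesis
  proof (cases "m \<ge> 0")
    case True
    then show thesis using m small by (auto simp: power_int_def)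
  next
    case False
    then show thesis using m large[of "nat (- m)"] by (simp add: power_int_def power_inverse)
  qed
qed

lemma L_scale: "a \<in> L \<Longrightarrow> bij_betw (\<lambda>x. a * x) L L"
  by (rule bij_betwI[of _ _ _ "\<lambda>x. x / a"]) (auto simp: L_mult L_divide dest: L_not_0)

lemma L_infsum_scale: "a \<in> L \<Longrightarrow> (\<Sum>\<^sub>\<infinity>x\<in>L. f (a * x)) = (\<Sum>\<^sub>\<infinity>x\<in>L. f x)"
  by (rule infsum_reindex_bij_betw[OF L_scale])

lemma L_summable_scale: "a \<in> L \<Longrightarrow> (\<lambda>x. f (a * x)) summable_on L \<longleftrightarrow> f summable_on L"
  by (rule summable_on_reindex_bij_betw[OF L_scale])

lemma bij_powi: "bij_betw (\<lambda>n::int. q powi n) UNIV L"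
proof -
  have "inj (\<lambda>n::int. q powi n)"
    using power_int_strict_decreasing[OF _ q_pos q_less_1]
    by (intro injI) (metis less_irrefl linorder_neqE)
  then show ?thesis by (simp add: bij_betw_def Rq_pos_def)
qed

lemma jackson_eq: "jackson q f = (1 - q) *\<^sub>R (\<Sum>\<^sub>\<infinity>x\<in>L. x *\<^sub>R f x)"
  unfolding jackson_def using infsum_reindex_bij_betw[OF bij_powi, of "\<lambda>x. x *\<^sub>R f x"] by simp

lemma jackson_integrable_iff: "jackson_integrable q f \<longleftrightarrow> (\<lambda>x. x *\<^sub>R f x) summable_on L"
  unfolding jackson_integrable_def
  using summable_on_reindex_bij_betw[OF bij_powi, of "\<lambda>x. x *\<^sub>R f x"] by simp

lemma L_scale_power:
  fixes g :: "real \<Rightarrow> real"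
  assumes a: "a \<in> L"
  shows "(\<lambda>x. g x * x powr s) summable_on L \<Longrightarrow> (\<lambda>x. g (a * x) * x powr s) summable_on L"
    and "(\<Sum>\<^sub>\<infinity>x\<in>L. g (a * x) * x powr s) = a powr (- s) * (\<Sum>\<^sub>\<infinity>x\<in>L. g x * x powr s)"
proof -
  let ?g = "\<lambda>x. g x * x powr s"
  have e: "g (a * x) * x powr s = a powr (- s) * ?g (a * x)" if "x \<in> L" for x
    using L_pos[OF a] L_pos[OF that] by (simp add: powr_mult powr_minus)
  show "(\<lambda>x. g (a * x) * x powr s) summable_on L" if "?g summable_on L"
  proof -
    have "(\<lambda>x. a powr (- s) * ?g (a * x)) summable_on L"
      using that unfolding L_summable_scale[OF a, of ?g, symmetric] by (rule summable_on_cmult_right)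
    then show ?thesis by (rule iffD2[OF summable_on_cong, rotated]) (rule e)
  qed
  have "(\<Sum>\<^sub>\<infinity>x\<in>L. g (a * x) * x powr s) = (\<Sum>\<^sub>\<infinity>x\<in>L. a powr (- s) * ?g (a * x))"
    by (rule infsum_cong[OF e])
  then show "(\<Sum>\<^sub>\<infinity>x\<in>L. g (a * x) * x powr s) = a powr (- s) * (\<Sum>\<^sub>\<infinity>x\<in>L. g x * x powr s)"
    by (simp only: infsum_cmult_right' L_infsum_scale[OF a, of ?g])
qed

text \<open>
  The bound is required on the whole lattice, so that it speaks of the origin and of infinity at
  once; a function that is small at the origin and at infinity satisfies two such bounds. A series
  converges if it is dominated by a positive and by a negative power of \<open>x\<close>.
\<close>

definition power_bound :: "(real \<Rightarrow> 'a::real_normed_vector) \<Rightarrow> real \<Rightarrow> bool" where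
  "power_bound f s \<longleftrightarrow> (\<exists>C. \<forall>x\<in>L. norm (f x) \<le> C * x powr s)"

lemma power_boundI: "(\<And>x. x \<in> L \<Longrightarrow> norm (f x) \<le> C * x powr s) \<Longrightarrow> power_bound f s"
  unfolding power_bound_def by blast

lemma power_boundE:
  assumes "power_bound f s"
  obtains C where "0 \<le> C" "\<And>x. x \<in> L \<Longrightarrow> norm (f x) \<le> C * x powr s"
proof -
  obtain C where C: "\<And>x. x \<in> L \<Longrightarrow> norm (f x) \<le> C * x powr s"
    using assms unfolding power_bound_def by blast
  moreover have "0 \<le> C" using order_trans[OF norm_ge_zero C[OF L_1]] by simp
  ultimately show thesis using that by blast
qed

lemma power_bound_0E:
  assumes "power_bound f 0"
  obtains C where "0 \<le> C" "\<And>x. x \<in> L \<Longrightarrow> norm (f x) \<le> C"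
proof -
  obtain C where "0 \<le> C" and C: "\<And>x. x \<in> L \<Longrightarrow> norm (f x) \<le> C * x powr 0"
    using assms by (rule power_boundE) blast
  moreover have "norm (f x) \<le> C" if "x \<in> L" for x
    using C[OF that] L_pos[OF that] by simp
  ultimately show thesis using that by blast
qed

lemma power_bound_powr: "power_bound (\<lambda>x. x powr s) s"
  by (rule power_boundI[of _ 1]) simp

lemma power_bound_add:
  assumes "power_bound f s" "power_bound g s"
  shows "power_bound (\<lambda>x. f x + g x) s"
proof -
  obtain C where C: "\<And>x. x \<in> L \<Longrightarrow> norm (f x) \<le> C * x powr s" using assms(1) by (rule power_boundE) blast
  obtain D where D: "\<And>x. x \<in> L \<Longrightarrow> norm (g x) \<le> D * x powr s" using assms(2) by (rule power_boundE) blast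
  show ?thesis
  proof (rule power_boundI)
    fix x assume "x \<in> L"
    then show "norm (f x + g x) \<le> (C + D) * x powr s"
      unfolding distrib_right by (intro order_trans[OF norm_triangle_ineq] add_mono C D)
  qed
qed

lemma power_bound_minus: "power_bound f s \<Longrightarrow> power_bound (\<lambda>x. - f x) s"
  by (simp add: power_bound_def)

lemma power_bound_diff: "power_bound f s \<Longrightarrow> power_bound g s \<Longrightarrow> power_bound (\<lambda>x. f x - g x) s"
  using power_bound_add[OF _ power_bound_minus] by fastforce

lemma power_bound_mult:
  fixes f g :: "real \<Rightarrow> 'a::real_normed_div_algebra"
  assumes "power_bound f s" "power_bound g t"
  shows "power_bound (\<lambda>x. f x * g x) (s + t)"
proof -
  obtain C where C0: "0 \<le> C" and C: "\<And>x. x \<in> L \<Longrightarrow> norm (f x) \<le> C * x powr s"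
    using assms(1) by (rule power_boundE) blast
  obtain D where D: "\<And>x. x \<in> L \<Longrightarrow> norm (g x) \<le> D * x powr t"
    using assms(2) by (rule power_boundE) blast
  show ?thesis
  proof (rule power_boundI)
    fix x assume x: "x \<in> L"
    have "norm (f x * g x) \<le> (C * x powr s) * (D * x powr t)"
      unfolding norm_mult using C0 by (intro mult_mono C D x) auto
    then show "norm (f x * g x) \<le> C * D * x powr (s + t)"
      by (simp only: powr_add mult_ac)
  qed
qed

lemma power_bound_dilate:
  assumes "a \<in> L" "power_bound f s"
  shows "power_bound (\<lambda>x. f (a * x)) s"
proof -
  obtain C where C: "\<And>x. x \<in> L \<Longrightarrow> norm (f x) \<le> C * x powr s" using assms(2) by (rule power_boundE) blast
  show ?thesis
  proof (rule power_boundI)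
    fix x assume x: "x \<in> L"
    have "(a * x) powr s = a powr s * x powr s"
      using L_pos[OF assms(1)] L_pos[OF x] by (simp add: powr_mult)
    then show "norm (f (a * x)) \<le> C * a powr s * x powr s"
      using C[OF L_mult[OF assms(1) x]] by (simp only: mult.assoc)
  qed
qed

lemma power_bound_interpolate:
  assumes "power_bound f r" "power_bound f t" "r \<le> s" "s \<le> t"
  shows "power_bound f s"
proof -
  obtain C where C0: "0 \<le> C" and C: "\<And>x. x \<in> L \<Longrightarrow> norm (f x) \<le> C * x powr r"
    using assms(1) by (rule power_boundE) blast
  obtain D where D0: "0 \<le> D" and D: "\<And>x. x \<in> L \<Longrightarrow> norm (f x) \<le> D * x powr t"
    using assms(2) by (rule power_boundE) blast
  show ?thesis
  proof (rule power_boundI)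
    fix x assume x: "x \<in> L"
    have "x powr t \<le> x powr s \<or> x powr r \<le> x powr s"
      using L_pos[OF x] assms(3,4) by (cases "x \<le> 1") (auto intro: powr_mono' powr_mono)
    then have "norm (f x) \<le> D * x powr s \<or> norm (f x) \<le> C * x powr s"
      using order_trans[OF D[OF x] mult_left_mono[OF _ D0]] order_trans[OF C[OF x] mult_left_mono[OF _ C0]] by blast
    moreover have "0 \<le> C * x powr s" "0 \<le> D * x powr s" using C0 D0 by auto
    ultimately show "norm (f x) \<le> (C + D) * x powr s"
      unfolding distrib_right by linarith
  qed
qed

lemma inj_q_power: "inj (\<lambda>n::nat. q ^ n)"
  using q_pos q_less_1 by (auto intro!: injI simp: power_inject_exp')

lemma L_power_summable:
  assumes "0 < s"
  shows "(\<lambda>x. x powr s) summable_on range (\<lambda>n::nat. q ^ n)"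
    and "(\<lambda>x. x powr (- s)) summable_on range (\<lambda>n::nat. inverse (q ^ n))"
proof -
  have "(\<lambda>n. (q powr s) ^ n) summable_on UNIV"
    using assms q_pos q_less_1
    by (intro norm_summable_imp_summable_on) (simp add: summable_geometric powr01_less_one)
  moreover have "(q ^ n) powr s = (q powr s) ^ n" "inverse (q ^ n) powr (- s) = (q powr s) ^ n" for n
  proof -
    show *: "(q ^ n) powr s = (q powr s) ^ n"
      using q_pos by (simp add: powr_realpow[symmetric] powr_powr mult.commute)
    have "inverse (q ^ n) powr (- s) = (q ^ n) powr s"
      using q_pos by (simp add: powr_minus inverse_powr)
    then show "inverse (q ^ n) powr (- s) = (q powr s) ^ n" using * by simp
  qed
  moreover have "inj (\<lambda>n::nat. inverse (q ^ n))"
    using inj_q_power by (auto simp: inj_def)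
  ultimately show "(\<lambda>x. x powr s) summable_on range (\<lambda>n::nat. q ^ n)"
    and "(\<lambda>x. x powr (- s)) summable_on range (\<lambda>n::nat. inverse (q ^ n))"
    by (simp_all add: inj_q_power summable_on_reindex o_def)
qed

lemma power_bound_summable:
  assumes "power_bound f r" "power_bound f t" "r + s < 0" "0 < t + s"
  shows "(\<lambda>x. x powr s * norm (f x)) summable_on L"
proof -
  have bound: "\<exists>C. \<forall>x\<in>L. norm (x powr s * norm (f x)) \<le> C * x powr (v + s)" if "power_bound f v" for v
  proof -
    obtain C where C: "\<And>x. x \<in> L \<Longrightarrow> norm (f x) \<le> C * x powr v" using \<open>power_bound f v\<close> by (rule power_boundE) blast
    have "norm (x powr s * norm (f x)) \<le> C * x powr (v + s)" if "x \<in> L" for x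
      using mult_left_mono[OF C[OF that], of "x powr s"] by (simp add: powr_add mult_ac)
    then show ?thesis by blast
  qed
  let ?w = "\<lambda>x. x powr s * norm (f x)"
  obtain C where C: "\<And>x. x \<in> L \<Longrightarrow> norm (?w x) \<le> C * x powr (t + s)"
    using bound[OF assms(2)] by blast
  obtain D where D: "\<And>x. x \<in> L \<Longrightarrow> norm (?w x) \<le> D * x powr (- (- r - s))"
    using bound[OF assms(1)] by (auto simp: add.commute)
  have "?w summable_on range (\<lambda>n::nat. q ^ n)"
    by (rule infsum_dominated(1)[OF summable_on_cmult_right[OF L_power_summable(1)[OF assms(4)], of C]])
      (use C L_power in blast)
  moreover have "?w summable_on range (\<lambda>n::nat. inverse (q ^ n))"
  proof (rule infsum_dominated(1)[OF summable_on_cmult_right[OF L_power_summable(2)[of "- r - s"], of D]])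
    show "0 < - r - s" using assms(3) by simp
    fix x assume "x \<in> range (\<lambda>n::nat. inverse (q ^ n))"
    then have "x \<in> L" using L_power L_inverse by auto
    then show "norm (?w x) \<le> D * x powr (- (- r - s))" by (rule D)
  qed
  ultimately have "?w summable_on
      (range (\<lambda>n::nat. q ^ n) \<union> (range (\<lambda>n::nat. inverse (q ^ n)) - range (\<lambda>n::nat. q ^ n)))"
    by (intro summable_on_Un_disjoint) (auto intro: summable_on_subset_banach)
  then show ?thesis
    by (rule summable_on_subset_banach) (auto elim: L_cases)
qed

lemma power_bound_tendsto:
  assumes "0 < s" "power_bound (\<lambda>x. f x - c) s"
  shows "(\<lambda>n. f (q ^ n)) \<longlonglongrightarrow> c"
proof -
  obtain C where C: "\<And>x. x \<in> L \<Longrightarrow> norm (f x - c) \<le> C * x powr s"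
    using assms(2) by (rule power_boundE) blast
  have le: "norm (f (q ^ n) - c) \<le> C * (q powr s) ^ n" for n
    using C[OF L_power, of n] q_pos by (simp add: powr_realpow[symmetric] powr_powr mult.commute)
  have "(\<lambda>n. C * (q powr s) ^ n) \<longlonglongrightarrow> 0"
    using q_pos q_less_1 assms(1)
    by (intro tendsto_mult_right_zero LIMSEQ_realpow_zero) (auto simp: powr01_less_one)
  then have "(\<lambda>n. f (q ^ n) - c) \<longlonglongrightarrow> 0"
    by (rule Lim_null_comparison[OF always_eventually[OF allI[OF le]]])
  then show ?thesis by (rule iffD2[OF Lim_null])
qed

end

section \<open>The q-Bessel function on the lattice\<close>

locale q_bessel_fn = q_base +
  fixes \<beta> :: real
  assumes beta: "- 1 < \<beta>" and one_minus_q: "1 - q \<in> Rq_pos q"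
begin

sublocale bessel_base q "q powr (2 * \<beta> + 2)"
  by unfold_locales (use q_pos q_less_1 beta in \<open>simp_all add: powr01_less_one\<close>)

abbreviation J :: "real \<Rightarrow> real" where "J \<equiv> q_bessel3 q \<beta>"

definition J_coeff :: "nat \<Rightarrow> real" where
  "J_coeff k = bessel_coeff q (q powr (2 * \<beta> + 2)) k * (1 - q) ^ (2 * k)"

lemma J_eq: "J x = bessel_series q (q powr (2 * \<beta> + 2)) (((1 - q) * x)\<^sup>2)"
  unfolding q_bessel3_def bessel_series_def bessel_coeff_def euler_coeff_def
  by (simp add: power_mult_distrib power_mult[symmetric] mult_ac)

lemma J_0: "J 0 = 1"
  using J_eq[of 0] bessel_sums[of 0] powser_sums_zero_iff[of "bessel_coeff q (q powr (2 * \<beta> + 2))"]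
  by (simp add: bessel_coeff_0 sums_unique2)

lemma J_coeff_0: "J_coeff 0 = 1"
  by (simp add: J_coeff_def bessel_coeff_0)

lemma J_recurrence:
  "J x - (1 + q powr (2 * \<beta>)) * J (q * x) + q powr (2 * \<beta>) * J (p * x)
    = - (((1 - q) * x)\<^sup>2 * J (q * x))"
proof -
  have "q powr (2 * \<beta> + 2) / p = q powr (2 * \<beta>)"
    using q_pos by (simp add: powr_add)
  moreover have "((1 - q) * (q * x))\<^sup>2 = p * ((1 - q) * x)\<^sup>2"
    "((1 - q) * (p * x))\<^sup>2 = p\<^sup>2 * ((1 - q) * x)\<^sup>2"
    by (simp_all add: power_mult_distrib mult_ac)
  ultimately show ?thesis
    unfolding J_eq using bessel_series_recurrence[of "((1 - q) * x)\<^sup>2"] by simp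
qed

text \<open>
  The hypothesis that \<open>1 - q\<close> is a power of \<open>q\<close> enters here: it keeps \<open>(1 - q) x\<close> on the lattice,
  so that its square is a power of \<open>q\<^sup>2\<close>, as the decay estimate for the series demands.
\<close>

lemma J_decay:
  assumes "0 \<le> s"
  shows "power_bound J (- s)"
proof -
  let ?B = "bessel_series q (q powr (2 * \<beta> + 2))"
  obtain C where C: "\<And>M. \<bar>?B (inverse (p ^ M))\<bar> \<le> C * q ^ (M * M)"
    using bessel_series_decay by blast
  define A where "A = (\<Sum>n. \<bar>bessel_coeff q (q powr (2 * \<beta> + 2)) n\<bar>)"
  define D where "D = max A (C * q powr (- (s * s)))"
  have C0: "0 \<le> C" using C[of 0] by simp
  have "\<bar>?B (y\<^sup>2)\<bar> \<le> D * y powr (- s)" if "y \<in> L" for y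
    using that
  proof (cases rule: L_cases)
    case (small n)
    have y: "0 \<le> y" "y \<le> 1"
      using small q_pos q_less_1 by (auto simp: power_le_one)
    then have "\<bar>?B (y\<^sup>2)\<bar> \<le> A"
      using bessel_series_remainder[of "y\<^sup>2" 0] by (simp add: A_def power_le_one)
    moreover have "1 \<le> y powr (- s)"
      using y assms L_pos[OF that] by (simp add: powr_minus powr_le1 one_le_inverse)
    moreover have "0 \<le> A" using calculation(1) by linarith
    ultimately have "\<bar>?B (y\<^sup>2)\<bar> \<le> A * y powr (- s)"
      by (meson mult_le_cancel_left1 order_trans linorder_not_le)
    also have "\<dots> \<le> D * y powr (- s)"
      by (intro mult_right_mono) (auto simp: D_def)
    finally show ?thesis .
  next
    case (large M)
    have "y\<^sup>2 = inverse (p ^ M)"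
      unfolding large by (simp add: power_inverse power_mult[symmetric] mult.commute)
    then have "\<bar>?B (y\<^sup>2)\<bar> \<le> C * q ^ (M * M)" using C by simp
    also have "q ^ (M * M) = q powr (real M * real M)"
      using q_pos by (simp add: powr_realpow[symmetric])
    \<comment> \<open>A Gaussian beats every power: complete the square in \<open>M\<close>.\<close>
    also have "\<dots> \<le> q powr (- (s * s) + real M * s)"
    proof (intro powr_mono')
      have "0 \<le> (real M - s)\<^sup>2 + real M * s"
        using assms by simp
      then show "- (s * s) + real M * s \<le> real M * real M"
        by (simp add: power2_eq_square algebra_simps)
    qed (use q_pos q_less_1 in auto)
    also have "\<dots> = q powr (- (s * s)) * y powr (- s)"
    proof -
      have "y powr (- s) = q powr (real M * s)"
        unfolding large using q_pos by (simp add: powr_minus inverse_powr powr_realpow[symmetric] powr_powr)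
      then show ?thesis by (simp only: powr_add)
    qed
    finally have "\<bar>?B (y\<^sup>2)\<bar> \<le> C * (q powr (- (s * s)) * y powr (- s))"
      using C0 by (simp add: mult_left_mono)
    also have "\<dots> \<le> D * y powr (- s)"
      unfolding D_def mult.assoc[symmetric] by (intro mult_right_mono) auto
    finally show ?thesis .
  qed
  note bound = this
  have "\<bar>J x\<bar> \<le> D * (1 - q) powr (- s) * x powr (- s)" if "x \<in> L" for x
  proof -
    have "((1 - q) * x) powr (- s) = (1 - q) powr (- s) * x powr (- s)"
      using L_pos[OF that] q_less_1 by (simp add: powr_mult)
    then show ?thesis
      unfolding J_eq using bound[OF L_mult[OF one_minus_q that]] by (simp only: mult.assoc)
  qed
  then show ?thesis by (intro power_boundI) auto
qed

lemma J_bounded: "power_bound J 0"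
  using J_decay[of 0] by simp

lemma J_remainder:
  "power_bound (\<lambda>x. J x - (\<Sum>k<N. J_coeff k * x ^ (2 * k))) (2 * real N)"
proof -
  let ?b = "q powr (2 * \<beta> + 2)"
  obtain B where B: "0 \<le> B" "\<And>x. x \<in> L \<Longrightarrow> \<bar>J x\<bar> \<le> B"
    using J_bounded unfolding real_norm_def[symmetric] by (rule power_bound_0E) blast
  define A where "A = (\<Sum>n. \<bar>bessel_coeff q ?b (n + N)\<bar>) * (1 - q) ^ (2 * N)"
  define D where "D = max A (B + (\<Sum>k<N. \<bar>J_coeff k\<bar>))"
  have "\<bar>J x - (\<Sum>k<N. J_coeff k * x ^ (2 * k))\<bar> \<le> D * x ^ (2 * N)" if x: "x \<in> L" for x
  proof (cases "x \<le> 1")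
    case True
    have "((1 - q) * x)\<^sup>2 \<le> 1"
      using True L_pos[OF x] q_pos q_less_1 by (intro power_le_one mult_le_one) auto
    then have "\<bar>J x - (\<Sum>k<N. bessel_coeff q ?b k * (((1 - q) * x)\<^sup>2) ^ k)\<bar>
        \<le> (\<Sum>n. \<bar>bessel_coeff q ?b (n + N)\<bar>) * (((1 - q) * x)\<^sup>2) ^ N"
      unfolding J_eq by (intro bessel_series_remainder) auto
    then have "\<bar>J x - (\<Sum>k<N. J_coeff k * x ^ (2 * k))\<bar> \<le> A * x ^ (2 * N)"
      unfolding J_coeff_def A_def by (simp add: power_mult_distrib power_mult[symmetric] mult_ac)
    also have "\<dots> \<le> D * x ^ (2 * N)"
      using L_pos[OF x] by (intro mult_right_mono) (auto simp: D_def)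
    finally show ?thesis .
  next
    case False
    have "\<bar>J x - (\<Sum>k<N. J_coeff k * x ^ (2 * k))\<bar> \<le> \<bar>J x\<bar> + (\<Sum>k<N. \<bar>J_coeff k\<bar> * x ^ (2 * k))"
      using abs_triangle_ineq4[of "J x" "\<Sum>k<N. J_coeff k * x ^ (2 * k)"]
        sum_abs[of "\<lambda>k. J_coeff k * x ^ (2 * k)" "{..<N}"] by (simp add: abs_mult)
    also have "\<dots> \<le> B * x ^ (2 * N) + (\<Sum>k<N. \<bar>J_coeff k\<bar> * x ^ (2 * N))"
    proof (intro add_mono sum_mono mult_left_mono)
      have "B * 1 \<le> B * x ^ (2 * N)"
        using False B by (intro mult_left_mono one_le_power) auto
      then show "\<bar>J x\<bar> \<le> B * x ^ (2 * N)" using B(2)[OF x] by simp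
      show "x ^ (2 * k) \<le> x ^ (2 * N)" if "k \<in> {..<N}" for k
        using False that by (intro power_increasing) auto
    qed auto
    also have "\<dots> = (B + (\<Sum>k<N. \<bar>J_coeff k\<bar>)) * x ^ (2 * N)"
      by (simp add: sum_distrib_right distrib_right)
    also have "\<dots> \<le> D * x ^ (2 * N)"
      using L_pos[OF x] by (intro mult_right_mono) (auto simp: D_def)
    finally show ?thesis .
  qed
  moreover have "x ^ (2 * N) = x powr (2 * real N)" if "x \<in> L" for x
    using powr_realpow[OF L_pos[OF that], of "2 * N"] by simp
  ultimately show ?thesis by (intro power_boundI) auto
qed

lemma J_near_1: "power_bound (\<lambda>x. J x - 1) 2"
  using J_remainder[of 1] by (simp add: J_coeff_0)

lemma J_abs_power_summable: "0 < s \<Longrightarrow> (\<lambda>x. x powr s * \<bar>J x\<bar>) summable_on L"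
  using power_bound_summable[OF J_decay[of "s + 1"] J_bounded, of s] by simp

lemma J_power_summable: "0 < s \<Longrightarrow> (\<lambda>x. J x * x powr s) summable_on L"
  by (rule infsum_dominated(1)[OF J_abs_power_summable[of s]]) (simp_all add: abs_mult)

text \<open>
  The recurrence is a second-order \<open>q\<close>-difference equation in Sturm-Liouville form. The Wronskian of
  \<open>J\<close> with a solution for another eigenvalue is summable, so its differences sum to zero, which is
  orthogonality. The constant function, a solution for the eigenvalue \<open>0\<close>, gives the vanishing of
  the lowest moment of \<open>J\<close>.
\<close>

lemma J_orthogonal:
  assumes K: "\<And>x. x \<in> L \<Longrightarrow>
      K x - (1 + q powr (2 * \<beta>)) * K (q * x) + q powr (2 * \<beta>) * K (p * x) = - (e * x\<^sup>2 * K (q * x))"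
    and e: "e \<noteq> (1 - q)\<^sup>2"
    and B: "power_bound K 0"
    and D: "power_bound (\<lambda>x. K x - 1) 2"
  shows "(\<Sum>\<^sub>\<infinity>x\<in>L. J x * K x * x powr (2 * \<beta> + 2)) = 0"
proof -
  let ?v = "\<lambda>x. J x * K (q * x) - J (q * x) * K x"
  define w where "w x = x powr (2 * \<beta>) * ?v x" for x
  note dil = power_bound_dilate[OF L_q] and pm = power_bound_mult[where s = 2 and t = 0, simplified]
  have "?v = (\<lambda>x. (J x - 1) * K (q * x) + (K (q * x) - 1) - (J (q * x) - 1) * K x - (K x - 1))"
    by (simp add: fun_eq_iff algebra_simps)
  then have "power_bound ?v 2"
    using power_bound_diff[OF power_bound_diff[OF power_bound_add[OF pm[OF J_near_1 dil[OF B]] dil[OF D]]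
          pm[OF dil[OF J_near_1] B]] D] by simp
  then have w0: "power_bound w (2 * \<beta> + 2)"
    unfolding w_def by (rule power_bound_mult[OF power_bound_powr])
  define s where "s = 2 * \<beta> + 3"
  have s: "0 \<le> s" using beta by (simp add: s_def)
  have "power_bound ?v (- s)"
    using power_bound_diff[OF power_bound_mult[OF J_decay[OF s] dil[OF B]]
        power_bound_mult[OF dil[OF J_decay[OF s]] B]] by simp
  then have "power_bound w (2 * \<beta> + - s)"
    unfolding w_def by (rule power_bound_mult[OF power_bound_powr])
  then have "(\<lambda>x. x powr 0 * norm (w x)) summable_on L"
    using beta by (intro power_bound_summable[OF _ w0]) (auto simp: s_def)
  then have w: "w summable_on L"
    by (rule infsum_dominated(1)) (use L_not_0 in auto)
  then have wq: "(\<lambda>x. w (q * x)) summable_on L"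
    using L_summable_scale[OF L_q] by blast
  have "(\<Sum>\<^sub>\<infinity>x\<in>L. w x - w (q * x)) = 0"
    using infsum_diff[OF w wq] L_infsum_scale[OF L_q, of w] by simp
  moreover have "w x - w (q * x)
      = (e - (1 - q)\<^sup>2) * inverse (q powr (2 * \<beta> + 2)) * (J (q * x) * K (q * x) * (q * x) powr (2 * \<beta> + 2))"
    if x: "x \<in> L" for x
  proof -
    have x0: "0 < x" using L_pos[OF x] .
    define r where "r = q powr (2 * \<beta>)"
    have J': "J x + r * J (p * x) = (1 + r) * J (q * x) - ((1 - q) * x)\<^sup>2 * J (q * x)"
      using J_recurrence[of x] unfolding r_def by linarith
    have K': "K x + r * K (p * x) = (1 + r) * K (q * x) - e * x\<^sup>2 * K (q * x)"
      using K[OF x] unfolding r_def by linarith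
    have "(q * x) powr (2 * \<beta>) = r * x powr (2 * \<beta>)"
      unfolding r_def using q_pos x0 by (simp add: powr_mult)
    moreover have "q * (q * x) = p * x" by (simp add: power2_eq_square)
    ultimately have "w (q * x) = r * x powr (2 * \<beta>) * (J (q * x) * K (p * x) - J (p * x) * K (q * x))"
      by (simp only: w_def)
    then have "w x - w (q * x) = x powr (2 * \<beta>) *
        (K (q * x) * (J x + r * J (p * x)) - J (q * x) * (K x + r * K (p * x)))"
      unfolding w_def[of x] by (simp add: algebra_simps)
    also have "\<dots> = (e - (1 - q)\<^sup>2) * (J (q * x) * K (q * x) * (x powr (2 * \<beta>) * x\<^sup>2))"
      unfolding J' K' power_mult_distrib by (simp add: algebra_simps)
    also have "x powr (2 * \<beta>) * x\<^sup>2 = inverse (q powr (2 * \<beta> + 2)) * (q * x) powr (2 * \<beta> + 2)"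
    proof -
      have "x powr (2 * \<beta>) * x\<^sup>2 = x powr (2 * \<beta> + 2)"
        using x0 by (simp add: powr_add)
      moreover have "(q * x) powr (2 * \<beta> + 2) = q powr (2 * \<beta> + 2) * x powr (2 * \<beta> + 2)"
        using x0 q_pos by (simp add: powr_mult)
      moreover have "q powr (2 * \<beta> + 2) \<noteq> 0" using q_pos by simp
      ultimately show ?thesis by simp
    qed
    finally show ?thesis by (simp only: mult_ac)
  qed
  ultimately have "(\<Sum>\<^sub>\<infinity>x\<in>L. (e - (1 - q)\<^sup>2) * inverse (q powr (2 * \<beta> + 2)) *
      (J (q * x) * K (q * x) * (q * x) powr (2 * \<beta> + 2))) = 0"
    by (simp cong: infsum_cong)
  then have "(e - (1 - q)\<^sup>2) * inverse (q powr (2 * \<beta> + 2)) *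
      (\<Sum>\<^sub>\<infinity>x\<in>L. J (q * x) * K (q * x) * (q * x) powr (2 * \<beta> + 2)) = 0"
    by (simp only: infsum_cmult_right')
  then have "(\<Sum>\<^sub>\<infinity>x\<in>L. J (q * x) * K (q * x) * (q * x) powr (2 * \<beta> + 2)) = 0"
    using e q_pos by simp
  then show ?thesis
    using L_infsum_scale[OF L_q, of "\<lambda>x. J x * K x * x powr (2 * \<beta> + 2)"] by simp
qed

lemma J_dilations_orthogonal:
  assumes d: "d \<in> L" "d \<noteq> 1"
  shows "(\<Sum>\<^sub>\<infinity>x\<in>L. J x * J (d * x) * x powr (2 * \<beta> + 2)) = 0"
proof -
  have "d\<^sup>2 \<noteq> 1"
    using d L_pos[OF d(1)] by (simp add: power2_eq_1_iff)
  then have "(1 - q)\<^sup>2 * d\<^sup>2 \<noteq> (1 - q)\<^sup>2"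
    using q_less_1 by simp
  then show ?thesis
  proof (rule J_orthogonal[rotated])
    show "power_bound (\<lambda>x. J (d * x)) 0" by (rule power_bound_dilate[OF d(1) J_bounded])
    show "power_bound (\<lambda>x. J (d * x) - 1) 2" by (rule power_bound_dilate[OF d(1) J_near_1])
    fix x
    show "J (d * x) - (1 + q powr (2 * \<beta>)) * J (d * (q * x)) + q powr (2 * \<beta>) * J (d * (p * x))
        = - ((1 - q)\<^sup>2 * d\<^sup>2 * x\<^sup>2 * J (d * (q * x)))"
      using J_recurrence[of "d * x"] by (simp add: power_mult_distrib mult_ac)
  qed
qed

lemma J_moment_0: "(\<Sum>\<^sub>\<infinity>x\<in>L. J x * x powr (2 * \<beta> + 2)) = 0"
proof -
  have "power_bound (\<lambda>_. 1 :: real) 0" "power_bound (\<lambda>_. 1 - 1 :: real) 2"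
    by (rule power_boundI[of _ 1], use L_not_0 in simp)+
  then show ?thesis using J_orthogonal[of "\<lambda>_. 1" 0] q_less_1 by simp
qed

text \<open>
  Summed against a power of \<open>x\<close>, the recurrence expresses each moment as a multiple of the one before.
\<close>

lemma J_moments: "(\<Sum>\<^sub>\<infinity>x\<in>L. J x * x powr (2 * \<beta> + 2 + 2 * real k)) = 0"
proof (induction k)
  case 0
  then show ?case using J_moment_0 by simp
next
  case (Suc k)
  define s where "s = 2 * \<beta> + 2 + 2 * real k"
  define r where "r = q powr (2 * \<beta>)"
  define S where "S = (\<Sum>\<^sub>\<infinity>x\<in>L. J x * x powr s)"
  define S' where "S' = (\<Sum>\<^sub>\<infinity>x\<in>L. J x * x powr (s + 2))"
  have S: "S = 0" using Suc.IH by (simp add: S_def s_def)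
  have s0: "0 < s" using beta by (simp add: s_def)
  have sm: "(\<lambda>x. J x * x powr s) summable_on L"
    by (rule J_power_summable[OF s0])
  note d = L_scale_power[of _ J]
  have q2: "p \<in> L" using L_power[of 2] .
  have "(\<Sum>\<^sub>\<infinity>x\<in>L. J x * x powr s - (1 + r) * (J (q * x) * x powr s) + r * (J (p * x) * x powr s))
      = S - (1 + r) * (q powr (- s) * S) + r * (p powr (- s) * S)"
    unfolding S_def d(2)[OF L_q, symmetric] d(2)[OF q2, symmetric]
    by (simp add: infsum_add infsum_diff infsum_cmult_right' summable_on_diff summable_on_cmult_right
        sm d(1)[OF L_q sm] d(1)[OF q2 sm])
  moreover have "J x * x powr s - (1 + r) * (J (q * x) * x powr s) + r * (J (p * x) * x powr s)
      = - ((1 - q)\<^sup>2) * (J (q * x) * x powr (s + 2))" if "x \<in> L" for x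
  proof -
    have "J x * x powr s - (1 + r) * (J (q * x) * x powr s) + r * (J (p * x) * x powr s)
        = (J x - (1 + r) * J (q * x) + r * J (p * x)) * x powr s"
      by (simp add: algebra_simps)
    also have "\<dots> = - ((1 - q)\<^sup>2) * (J (q * x) * (x powr s * x\<^sup>2))"
      unfolding r_def J_recurrence by (simp add: power_mult_distrib mult_ac)
    finally show ?thesis using L_pos[OF that] by (simp add: powr_add)
  qed
  ultimately have "(\<Sum>\<^sub>\<infinity>x\<in>L. - ((1 - q)\<^sup>2) * (J (q * x) * x powr (s + 2))) = 0"
    using S by (simp cong: infsum_cong)
  then have "- ((1 - q)\<^sup>2) * (q powr (- (s + 2)) * S') = 0"
    unfolding S'_def by (simp only: infsum_cmult_right' d(2)[OF L_q])
  then have "S' = 0" using q_pos q_less_1 by simp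
  then show ?case by (simp add: S'_def s_def add_ac)
qed

definition J_norm :: real where
  "J_norm = (\<Sum>\<^sub>\<infinity>x\<in>L. J x * J x * x powr (2 * \<beta> + 2))"

lemma J_dilation_product_summable:
  assumes x: "x \<in> L" and y: "y \<in> L"
  shows "(\<lambda>l. J (y * l) * J (x * l) * l powr (2 * \<beta> + 2)) summable_on L"
proof -
  obtain B where B: "\<And>x. x \<in> L \<Longrightarrow> norm (J x) \<le> B"
    using J_bounded by (rule power_bound_0E) blast
  have "(\<lambda>l. \<bar>J l\<bar> * l powr (2 * \<beta> + 2)) summable_on L"
    using J_abs_power_summable[of "2 * \<beta> + 2"] beta by (simp add: mult.commute)
  from summable_on_cmult_right[OF L_scale_power(1)[OF y this], of B]
  show ?thesis
  proof (rule infsum_dominated(1))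
    fix l assume l: "l \<in> L"
    have "\<bar>J (x * l)\<bar> * (\<bar>J (y * l)\<bar> * l powr (2 * \<beta> + 2)) \<le> B * (\<bar>J (y * l)\<bar> * l powr (2 * \<beta> + 2))"
      using B[OF L_mult[OF x l]] by (intro mult_right_mono) auto
    then show "norm (J (y * l) * J (x * l) * l powr (2 * \<beta> + 2)) \<le> B * (\<bar>J (y * l)\<bar> * l powr (2 * \<beta> + 2))"
      by (simp add: abs_mult mult_ac)
  qed
qed

lemma J_norm_pos: "0 < J_norm"
proof -
  obtain D where D: "\<And>x. x \<in> L \<Longrightarrow> norm (J x - 1) \<le> D * x powr 2"
    using J_near_1 by (rule power_boundE) blast
  have "(\<lambda>n. D * p ^ n) \<longlonglongrightarrow> D * 0"
    by (intro tendsto_intros qq_tendsto)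
  then have "eventually (\<lambda>n. D * p ^ n < 1) sequentially"
    by (intro order_tendstoD(2)[of _ "D * 0"]) auto
  then obtain n where "D * p ^ n < 1"
    unfolding eventually_sequentially by blast
  then have "\<bar>J (q ^ n) - 1\<bar> < 1"
    using D[OF L_power, of n] q_pos by (simp add: power_mult[symmetric] mult.commute)
  then have "J (q ^ n) \<noteq> 0" by auto
  then have "0 < J (q ^ n) * J (q ^ n) * (q ^ n) powr (2 * \<beta> + 2)"
    using q_pos by (simp add: zero_less_mult_iff) (metis linorder_neqE_linordered_idom)
  also have "\<dots> = (\<Sum>\<^sub>\<infinity>x\<in>{q ^ n}. J x * J x * x powr (2 * \<beta> + 2))"
    by simp
  also have "\<dots> \<le> J_norm"
    unfolding J_norm_def using L_power
    using J_dilation_product_summable[OF L_1 L_1] by (intro infsum_mono_neutral) auto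
  finally show ?thesis .
qed

end

section \<open>Inversion of the q-Bessel Fourier transform\<close>

lemma norm_case_prod: "(\<lambda>z. norm (case z of (x, y) \<Rightarrow> t x y)) = (\<lambda>(x, y). norm (t x y))"
  by auto

text \<open>
  The lattice is a multiplicative group, so a kernel in \<open>l * \<phi> x\<close> is a convolution kernel in disguise.
  The case \<open>\<phi> x = x\<close> serves the Fourier kernel, the case \<open>\<phi> x = inverse x\<close> the Weyl kernel.
\<close>

lemma (in q_base) L_twisted_convolution_summable:
  fixes u k :: "real \<Rightarrow> real"
  assumes "u summable_on L" "k summable_on L"
    and "\<And>x. x \<in> L \<Longrightarrow> 0 \<le> u x" "\<And>x. x \<in> L \<Longrightarrow> 0 \<le> k x"
    and \<phi>: "\<And>x. x \<in> L \<Longrightarrow> \<phi> x \<in> L"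
  shows "(\<lambda>(x, l). u x * k (l * \<phi> x)) summable_on L \<times> L"
proof -
  have k: "(\<lambda>l. k (l * \<phi> x)) summable_on L" "(\<Sum>\<^sub>\<infinity>l\<in>L. k (l * \<phi> x)) = (\<Sum>\<^sub>\<infinity>l\<in>L. k l)" if "x \<in> L" for x
    using L_summable_scale[OF \<phi>[OF that], of k] L_infsum_scale[OF \<phi>[OF that], of k] assms(2)
    by (simp_all add: mult.commute)
  have e: "norm (u x * k (l * \<phi> x)) = u x * k (l * \<phi> x)" if "x \<in> L" "l \<in> L" for x l
    using assms(3,4) that L_mult \<phi> by simp
  have "(\<lambda>z. norm (case z of (x, l) \<Rightarrow> u x * k (l * \<phi> x))) summable_on L \<times> L"
    unfolding Infinite_Sum.abs_summable_on_Sigma_iff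
  proof (intro conjI ballI)
    fix x assume x: "x \<in> L"
    show "(\<lambda>y. norm (case (x, y) of (x, l) \<Rightarrow> u x * k (l * \<phi> x))) summable_on L"
      using summable_on_cmult_right[OF k(1)[OF x], of "u x"] e[OF x] by (simp cong: summable_on_cong)
  next
    have i: "(\<Sum>\<^sub>\<infinity>y\<in>L. norm (case (x, y) of (x, l) \<Rightarrow> u x * k (l * \<phi> x))) = u x * (\<Sum>\<^sub>\<infinity>l\<in>L. k l)"
      if "x \<in> L" for x
      using that e[OF that] k[OF that] by (simp add: infsum_cmult_right' cong: infsum_cong)
    have "(\<lambda>x. norm (u x * (\<Sum>\<^sub>\<infinity>l\<in>L. k l))) summable_on L"
      using summable_on_cmult_left[OF assms(1), of "\<Sum>\<^sub>\<infinity>l\<in>L. k l"] assms(3,4)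
      by (simp add: infsum_nonneg cong: summable_on_cong)
    then show "(\<lambda>x. norm (\<Sum>\<^sub>\<infinity>y\<in>L. norm (case (x, y) of (x, l) \<Rightarrow> u x * k (l * \<phi> x)))) summable_on L"
      using i by (simp cong: summable_on_cong)
  qed
  then show ?thesis by (rule abs_summable_summable)
qed

lemma (in q_base) L_fubini:
  fixes t :: "real \<Rightarrow> real \<Rightarrow> 'a::banach"
  assumes c: "u summable_on L" "k summable_on L"
    "\<And>x. x \<in> L \<Longrightarrow> 0 \<le> u x" "\<And>x. x \<in> L \<Longrightarrow> 0 \<le> k x" "\<And>x. x \<in> L \<Longrightarrow> \<phi> x \<in> L"
    and t: "\<And>x l. x \<in> L \<Longrightarrow> l \<in> L \<Longrightarrow> norm (t x l) \<le> u x * k (l * \<phi> x)"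
  shows "(\<Sum>\<^sub>\<infinity>x\<in>L. \<Sum>\<^sub>\<infinity>l\<in>L. t x l) = (\<Sum>\<^sub>\<infinity>l\<in>L. \<Sum>\<^sub>\<infinity>x\<in>L. t x l)"
    and "(\<lambda>l. \<Sum>\<^sub>\<infinity>x\<in>L. norm (t x l)) summable_on L"
    and "\<And>l. l \<in> L \<Longrightarrow> (\<lambda>x. norm (t x l)) summable_on L"
proof -
  have n: "(\<lambda>z. norm (case z of (x, l) \<Rightarrow> t x l)) summable_on L \<times> L"
    by (rule Infinite_Sum.abs_summable_on_comparison_test'[OF L_twisted_convolution_summable[OF c]])
      (auto intro: t)
  show "(\<Sum>\<^sub>\<infinity>x\<in>L. \<Sum>\<^sub>\<infinity>l\<in>L. t x l) = (\<Sum>\<^sub>\<infinity>l\<in>L. \<Sum>\<^sub>\<infinity>x\<in>L. t x l)"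
    by (rule infsum_swap_banach[OF abs_summable_summable[OF n]])
  have "(\<lambda>z. norm (case z of (l, x) \<Rightarrow> t x l)) summable_on L \<times> L"
    using n summable_on_swap[of "\<lambda>(x, l). norm (t x l)" L L] unfolding norm_case_prod
    by (simp add: case_prod_beta prod.swap_def)
  then show "(\<lambda>l. \<Sum>\<^sub>\<infinity>x\<in>L. norm (t x l)) summable_on L"
    and "\<And>l. l \<in> L \<Longrightarrow> (\<lambda>x. norm (t x l)) summable_on L"
    unfolding Infinite_Sum.abs_summable_on_Sigma_iff by (simp_all add: infsum_nonneg)
qed

context q_bessel_fn
begin

abbreviation F :: "(real \<Rightarrow> complex) \<Rightarrow> real \<Rightarrow> complex" where "F \<equiv> q_fourier q \<beta>"

definition cF :: real where "cF = c_bessel q \<beta> * (1 - q)"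

text \<open>
  With \<open>u x = x powr (\<beta> + 1) f x\<close> the transform becomes the action of the matrix
  \<open>J (l x) (l x) powr (\<beta> + 1)\<close>, whose rows are translates of one absolutely summable sequence. The
  two classes below are \<open>u \<in> \<ell>\<^sup>1\<close> and \<open>u \<in> \<ell>\<^sup>\<infinity>\<close>; the matrix preserves both.
\<close>

definition l1 :: "(real \<Rightarrow> complex) \<Rightarrow> bool" where
  "l1 f \<longleftrightarrow> (\<lambda>x. x powr (\<beta> + 1) * norm (f x)) summable_on L"

abbreviation linf :: "(real \<Rightarrow> complex) \<Rightarrow> bool" where
  "linf f \<equiv> power_bound f (- (\<beta> + 1))"

lemma cF_pos: "0 < cF"
proof -
  have "(q\<^sup>2) powr (\<beta> + 1) = q powr (2 * \<beta> + 2)"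
    using q_pos by (simp add: powr_powr powr_realpow[symmetric] algebra_simps flip: powr_numeral)
  then have "0 < qGamma (q\<^sup>2) (\<beta> + 1)"
    unfolding qGamma_def qpoch_inf_eq_euler
    using euler_series_pos[OF qq_less_1] euler_series_pos[OF b_less_1] qq_less_1 by simp
  moreover have "0 < 1 + inverse q"
    using q_pos by (simp add: add_pos_pos)
  ultimately show ?thesis
    unfolding cF_def c_bessel_def using q_less_1 by simp
qed

lemma F_eq: "F f l = cF *\<^sub>R (\<Sum>\<^sub>\<infinity>x\<in>L. (J (l * x) * x powr (2 * \<beta> + 2)) *\<^sub>R f x)"
proof -
  have "x *\<^sub>R ((J (l * x) * x powr (2 * \<beta> + 1)) *\<^sub>R f x) = (J (l * x) * x powr (2 * \<beta> + 2)) *\<^sub>R f x"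
    if "x \<in> L" for x
  proof -
    have "x powr (2 * \<beta> + 2) = x * x powr (2 * \<beta> + 1)"
      using L_pos[OF that] powr_add[of x 1 "2 * \<beta> + 1"] by (simp add: add_ac)
    then show ?thesis by (simp add: mult_ac)
  qed
  then have "(\<Sum>\<^sub>\<infinity>x\<in>L. x *\<^sub>R ((J (l * x) * x powr (2 * \<beta> + 1)) *\<^sub>R f x))
      = (\<Sum>\<^sub>\<infinity>x\<in>L. (J (l * x) * x powr (2 * \<beta> + 2)) *\<^sub>R f x)"
    by (rule infsum_cong)
  then show ?thesis
    unfolding q_fourier_def jackson_eq cF_def by (simp only: scaleR_scaleR)
qed

lemma F_cong: "(\<And>x. x \<in> L \<Longrightarrow> f x = g x) \<Longrightarrow> F f l = F g l"
  unfolding F_eq by (simp cong: infsum_cong)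

lemma F_scaleR: "F (\<lambda>x. r *\<^sub>R f x) l = r *\<^sub>R F f l"
proof -
  have "(\<Sum>\<^sub>\<infinity>x\<in>L. (J (l * x) * x powr (2 * \<beta> + 2)) *\<^sub>R r *\<^sub>R f x)
      = (\<Sum>\<^sub>\<infinity>x\<in>L. r *\<^sub>R ((J (l * x) * x powr (2 * \<beta> + 2)) *\<^sub>R f x))"
    by (simp add: mult_ac)
  then show ?thesis
    unfolding F_eq infsum_scaleR_right by (simp add: mult_ac)
qed

lemma F_cnj: "F (\<lambda>x. cnj (f x)) l = cnj (F f l)"
proof -
  have "cnj (\<Sum>\<^sub>\<infinity>x\<in>L. (J (l * x) * x powr (2 * \<beta> + 2)) *\<^sub>R f x)
      = (\<Sum>\<^sub>\<infinity>x\<in>L. cnj ((J (l * x) * x powr (2 * \<beta> + 2)) *\<^sub>R f x))"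
    by (rule infsum_cnj[symmetric])
  then show ?thesis unfolding F_eq by (simp add: complex_cnj_scaleR)
qed

lemma F_dilate:
  assumes "a \<in> L"
  shows "F (\<lambda>x. f (x / a)) l = a powr (2 * \<beta> + 2) *\<^sub>R F f (a * l)"
proof -
  have a0: "0 < a" using L_pos[OF assms] .
  have "(\<Sum>\<^sub>\<infinity>x\<in>L. (J (l * x) * x powr (2 * \<beta> + 2)) *\<^sub>R f (x / a))
      = (\<Sum>\<^sub>\<infinity>x\<in>L. (J (l * (a * x)) * (a * x) powr (2 * \<beta> + 2)) *\<^sub>R f (a * x / a))"
    by (rule L_infsum_scale[OF assms, symmetric])
  also have "\<dots> = (\<Sum>\<^sub>\<infinity>x\<in>L. a powr (2 * \<beta> + 2) *\<^sub>R ((J (a * l * x) * x powr (2 * \<beta> + 2)) *\<^sub>R f x))"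
  proof (rule infsum_cong)
    fix x assume "x \<in> L"
    then have "(a * x) powr (2 * \<beta> + 2) = a powr (2 * \<beta> + 2) * x powr (2 * \<beta> + 2)"
      using a0 L_pos by (simp add: powr_mult)
    then show "(J (l * (a * x)) * (a * x) powr (2 * \<beta> + 2)) *\<^sub>R f (a * x / a)
        = a powr (2 * \<beta> + 2) *\<^sub>R ((J (a * l * x) * x powr (2 * \<beta> + 2)) *\<^sub>R f x)"
      using a0 by (simp add: mult_ac)
  qed
  finally have "(\<Sum>\<^sub>\<infinity>x\<in>L. (J (l * x) * x powr (2 * \<beta> + 2)) *\<^sub>R f (x / a))
      = a powr (2 * \<beta> + 2) *\<^sub>R (\<Sum>\<^sub>\<infinity>x\<in>L. (J (a * l * x) * x powr (2 * \<beta> + 2)) *\<^sub>R f x)"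
    unfolding infsum_scaleR_right .
  then show ?thesis
    unfolding F_eq by (simp only: scaleR_scaleR mult.commute)
qed

lemma l1_dilate:
  assumes "a \<in> L" "l1 f"
  shows "l1 (\<lambda>x. f (x / a))"
  using L_scale_power(1)[OF L_inverse[OF assms(1)], of "\<lambda>x. norm (f x)" "\<beta> + 1"] assms(2)
  unfolding l1_def by (simp add: divide_inverse mult.commute)

lemma l1_scaleR:
  assumes "l1 f"
  shows "l1 (\<lambda>x. r *\<^sub>R f x)"
  using summable_on_cmult_right[OF assms[unfolded l1_def], of "\<bar>r\<bar>"]
  unfolding l1_def by (simp add: mult_ac)

lemma weight_split: "x powr (2 * \<beta> + 2) = x powr (\<beta> + 1) * x powr (\<beta> + 1)" if "x \<in> L"
  by (simp add: powr_add[symmetric])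

lemma weight_Suc: "x * x powr (2 * \<beta> + 1) = x powr (2 * \<beta> + 2)" if "x \<in> L"
  using L_pos[OF that] powr_add[of x 1 "2 * \<beta> + 1"] by (simp add: add_ac)

lemma linf_iff: "linf f \<longleftrightarrow> (\<exists>B. \<forall>x\<in>L. x powr (\<beta> + 1) * norm (f x) \<le> B)"
proof -
  have "norm (f x) \<le> B * x powr (- (\<beta> + 1)) \<longleftrightarrow> x powr (\<beta> + 1) * norm (f x) \<le> B" if "x \<in> L" for x B
    using L_pos[OF that] unfolding powr_minus divide_inverse[symmetric]
    by (subst pos_le_divide_eq) (auto simp: mult.commute)
  then show ?thesis unfolding power_bound_def by simp
qed

lemma linfE:
  assumes "linf f"
  obtains B where "0 \<le> B" "\<And>x. x \<in> L \<Longrightarrow> x powr (\<beta> + 1) * norm (f x) \<le> B"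
proof -
  obtain B where B: "\<And>x. x \<in> L \<Longrightarrow> x powr (\<beta> + 1) * norm (f x) \<le> B"
    using assms unfolding linf_iff by blast
  have "0 \<le> B" by (rule order_trans[OF _ B[OF L_1]]) simp
  then show thesis using that B by blast
qed

lemma summable_member_le:
  fixes u :: "real \<Rightarrow> real"
  assumes "u summable_on L" "\<And>y. y \<in> L \<Longrightarrow> 0 \<le> u y" "x \<in> L"
  shows "u x \<le> (\<Sum>\<^sub>\<infinity>y\<in>L. u y)"
proof -
  have "(\<Sum>\<^sub>\<infinity>y\<in>{x}. u y) \<le> (\<Sum>\<^sub>\<infinity>y\<in>L. u y)"
    using assms by (intro infsum_mono_neutral) auto
  then show ?thesis by simp
qed

lemma l1_imp_linf: "l1 f \<Longrightarrow> linf f"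
  unfolding linf_iff l1_def using summable_member_le[of "\<lambda>x. x powr (\<beta> + 1) * norm (f x)"] by force

lemma square_weight:
  assumes "x \<in> L"
  shows "x *\<^sub>R ((cmod (f x))\<^sup>2 * x powr (2 * \<beta> + 1)) = (x powr (\<beta> + 1) * norm (f x))\<^sup>2"
  using weight_Suc[OF assms] weight_split[OF assms] by (simp add: power2_eq_square mult_ac)

lemma l1_square_integrable:
  assumes "l1 f"
  shows "q_square_integrable q \<beta> f"
proof -
  obtain B where B: "\<And>x. x \<in> L \<Longrightarrow> x powr (\<beta> + 1) * norm (f x) \<le> B"
    using l1_imp_linf[OF assms] by (rule linfE) blast
  show ?thesis
    unfolding q_square_integrable_def jackson_integrable_iff
  proof (rule infsum_dominated(1)[OF summable_on_cmult_right[OF assms[unfolded l1_def], of B]])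
    fix x assume x: "x \<in> L"
    show "norm (x *\<^sub>R ((cmod (f x))\<^sup>2 * x powr (2 * \<beta> + 1))) \<le> B * (x powr (\<beta> + 1) * norm (f x))"
      unfolding square_weight[OF x] using B[OF x] by (simp add: power2_eq_square mult_right_mono)
  qed
qed

lemma square_integrable_imp_linf:
  assumes "q_square_integrable q \<beta> f"
  shows "linf f"
proof -
  let ?u = "\<lambda>x. x *\<^sub>R ((cmod (f x))\<^sup>2 * x powr (2 * \<beta> + 1))"
  have "?u x \<le> infsum ?u L" if "x \<in> L" for x
    using assms that unfolding q_square_integrable_def jackson_integrable_iff
    by (intro summable_member_le) (simp_all only: square_weight zero_le_power2)
  then have "x powr (\<beta> + 1) * norm (f x) \<le> sqrt (infsum ?u L)" if "x \<in> L" for x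
    using that by (intro real_le_rsqrt) (simp only: square_weight)
  then show ?thesis unfolding linf_iff by blast
qed

abbreviation kernel :: "real \<Rightarrow> real" where "kernel x \<equiv> x powr (\<beta> + 1) * \<bar>J x\<bar>"

lemma kernel_summable: "kernel summable_on L"
  by (rule J_abs_power_summable) (use beta in simp)

lemma kernel_dilate_summable: "l \<in> L \<Longrightarrow> (\<lambda>x. kernel (l * x)) summable_on L"
  using iffD2[OF L_summable_scale[of l kernel] kernel_summable] .

text \<open>The summand of the transform is the matrix entry times the value of \<open>u\<close> at \<open>x\<close>.\<close>

abbreviation entry :: "(real \<Rightarrow> complex) \<Rightarrow> real \<Rightarrow> real \<Rightarrow> complex" where
  "entry f x l \<equiv> l powr (\<beta> + 1) *\<^sub>R ((J (l * x) * x powr (2 * \<beta> + 2)) *\<^sub>R f x)"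

lemma norm_entry:
  assumes "x \<in> L" "l \<in> L"
  shows "norm (entry f x l) = x powr (\<beta> + 1) * norm (f x) * kernel (l * x)"
  unfolding weight_split[OF assms(1)] using L_pos[OF assms(1)] L_pos[OF assms(2)]
  by (simp add: abs_mult powr_mult mult_ac)

lemma F_entry: "l powr (\<beta> + 1) *\<^sub>R F f l = cF *\<^sub>R (\<Sum>\<^sub>\<infinity>x\<in>L. entry f x l)"
  unfolding F_eq infsum_scaleR_right by simp

lemma F_linf:
  assumes "linf h"
  shows "linf (F h)"
proof -
  obtain B where B: "\<And>x. x \<in> L \<Longrightarrow> x powr (\<beta> + 1) * norm (h x) \<le> B"
    using assms by (rule linfE) blast
  have "l powr (\<beta> + 1) * norm (F h l) \<le> cF * (B * infsum kernel L)" if l: "l \<in> L" for l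
  proof -
    have le: "norm (entry h x l) \<le> B * kernel (l * x)" if x: "x \<in> L" for x
      unfolding norm_entry[OF x l] using B[OF x] by (rule mult_right_mono) simp
    have "norm (\<Sum>\<^sub>\<infinity>x\<in>L. entry h x l) \<le> (\<Sum>\<^sub>\<infinity>x\<in>L. B * kernel (l * x))"
      by (rule infsum_dominated(2)[OF summable_on_cmult_right[OF kernel_dilate_summable[OF l]] le])
    also have "\<dots> = B * infsum kernel L"
      by (simp only: infsum_cmult_right' L_infsum_scale[OF l, of kernel])
    finally have "norm (cF *\<^sub>R (\<Sum>\<^sub>\<infinity>x\<in>L. entry h x l)) \<le> cF * (B * infsum kernel L)"
      using cF_pos by simp
    then show ?thesis unfolding F_entry[symmetric] by simp
  qed
  then show ?thesis unfolding linf_iff by blast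
qed

lemma F_l1:
  assumes "l1 f"
  shows "l1 (F f)"
proof -
  have t: "norm (entry f x l) \<le> x powr (\<beta> + 1) * norm (f x) * kernel (l * x)" if "x \<in> L" "l \<in> L" for x l
    by (rule eq_refl[OF norm_entry[OF that]])
  note fub = L_fubini[where \<phi> = "\<lambda>x. x" and t = "entry f", OF assms[unfolded l1_def] kernel_summable]
  have s: "(\<lambda>l. \<Sum>\<^sub>\<infinity>x\<in>L. norm (entry f x l)) summable_on L" by (rule fub(2), simp, simp, assumption, erule (1) t)
  show ?thesis
    unfolding l1_def
  proof (rule infsum_dominated(1)[OF summable_on_cmult_right[OF s, of cF]])
    fix l assume l: "l \<in> L"
    have "(\<lambda>x. norm (entry f x l)) summable_on L" by (rule fub(3)[OF _ _ _ _ l], simp, simp, assumption, erule (1) t)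
    from mult_left_mono[OF norm_infsum_bound[OF this] less_imp_le[OF cF_pos]]
    have "norm (cF *\<^sub>R (\<Sum>\<^sub>\<infinity>x\<in>L. entry f x l)) \<le> cF * (\<Sum>\<^sub>\<infinity>x\<in>L. norm (entry f x l))"
      using cF_pos by (simp only: norm_scaleR abs_of_pos)
    then show "norm (l powr (\<beta> + 1) * norm (F f l)) \<le> cF * (\<Sum>\<^sub>\<infinity>x\<in>L. norm (entry f x l))"
      unfolding F_entry[symmetric] by simp
  qed
qed

lemma multiplication_formula:
  assumes "l1 f" "linf h"
  shows "(\<Sum>\<^sub>\<infinity>l\<in>L. l powr (2 * \<beta> + 2) *\<^sub>R (F f l * h l)) = (\<Sum>\<^sub>\<infinity>x\<in>L. x powr (2 * \<beta> + 2) *\<^sub>R (f x * F h x))"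
proof -
  let ?t = "\<lambda>x l. (J (l * x) * x powr (2 * \<beta> + 2) * l powr (2 * \<beta> + 2)) *\<^sub>R (f x * h l)"
  obtain B where B: "0 \<le> B" "\<And>x. x \<in> L \<Longrightarrow> x powr (\<beta> + 1) * norm (h x) \<le> B"
    using assms(2) by (rule linfE) blast
  have t: "norm (?t x l) \<le> (x powr (\<beta> + 1) * norm (f x) * B) * kernel (l * x)" if x: "x \<in> L" and l: "l \<in> L" for x l
  proof -
    have "norm (?t x l) = norm (entry f x l) * (l powr (\<beta> + 1) * norm (h l))"
      unfolding weight_split[OF l] by (simp add: norm_mult abs_mult mult_ac)
    also have "\<dots> \<le> norm (entry f x l) * B"
      by (intro mult_left_mono B(2) l) simp
    finally show ?thesis unfolding norm_entry[OF x l] by (simp only: mult_ac)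
  qed
  have swap: "(\<Sum>\<^sub>\<infinity>x\<in>L. \<Sum>\<^sub>\<infinity>l\<in>L. ?t x l) = (\<Sum>\<^sub>\<infinity>l\<in>L. \<Sum>\<^sub>\<infinity>x\<in>L. ?t x l)"
    by (rule L_fubini(1)[where \<phi> = "\<lambda>x. x", OF summable_on_cmult_left[OF assms(1)[unfolded l1_def], of B] kernel_summable],
        simp add: B(1), simp, assumption, erule (1) t)
  have 1: "x powr (2 * \<beta> + 2) *\<^sub>R (f x * F h x) = cF *\<^sub>R (\<Sum>\<^sub>\<infinity>l\<in>L. ?t x l)" for x
  proof -
    have "?t x l = (x powr (2 * \<beta> + 2) *\<^sub>R f x) * ((J (x * l) * l powr (2 * \<beta> + 2)) *\<^sub>R h l)" for l
      by (simp add: mult_ac)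
    then show ?thesis
      unfolding F_eq by (simp only: infsum_cmult_right') simp
  qed
  have 2: "l powr (2 * \<beta> + 2) *\<^sub>R (F f l * h l) = cF *\<^sub>R (\<Sum>\<^sub>\<infinity>x\<in>L. ?t x l)" for l
  proof -
    have "?t x l = ((J (l * x) * x powr (2 * \<beta> + 2)) *\<^sub>R f x) * (l powr (2 * \<beta> + 2) *\<^sub>R h l)" for x
      by (simp add: mult_ac)
    then show ?thesis
      unfolding F_eq by (simp only: infsum_cmult_left') simp
  qed
  show ?thesis
    unfolding 1 2 infsum_scaleR_right swap ..
qed

definition F_norm :: real where "F_norm = cF * cF * J_norm"

lemma F_norm_pos: "0 < F_norm"
  unfolding F_norm_def using cF_pos J_norm_pos by simp

lemma J_dilation_inner_product:
  assumes x: "x \<in> L" and y: "y \<in> L"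
  shows "(\<Sum>\<^sub>\<infinity>l\<in>L. J (y * l) * J (x * l) * l powr (2 * \<beta> + 2))
    = (if x = y then y powr (- (2 * \<beta> + 2)) * J_norm else 0)"
proof -
  have xy: "x / y \<in> L" using L_divide[OF x y] .
  have "J (x * l) = J (x / y * (y * l))" for l using L_pos[OF y] by simp
  then have "(\<Sum>\<^sub>\<infinity>l\<in>L. J (y * l) * J (x * l) * l powr (2 * \<beta> + 2))
      = y powr (- (2 * \<beta> + 2)) * (\<Sum>\<^sub>\<infinity>l\<in>L. J l * J (x / y * l) * l powr (2 * \<beta> + 2))"
    using L_scale_power(2)[OF y, of "\<lambda>l. J l * J (x / y * l)"] by (simp only:)
  also have "(\<Sum>\<^sub>\<infinity>l\<in>L. J l * J (x / y * l) * l powr (2 * \<beta> + 2)) = (if x = y then J_norm else 0)"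
    using J_dilations_orthogonal[OF xy] L_pos[OF y] by (auto simp: J_norm_def)
  finally show ?thesis by simp
qed

text \<open>
  On bounded sequences the square of the matrix may be computed entry by entry, because its rows are
  absolutely summable; orthogonality of the dilations of \<open>J\<close> makes it a multiple of the identity.
\<close>

theorem F_inversion:
  assumes h: "linf h" and y: "y \<in> L"
  shows "F (F h) y = F_norm *\<^sub>R h y"
proof -
  let ?w = "\<lambda>x. x powr (2 * \<beta> + 2)"
  let ?f = "\<lambda>l. complex_of_real (J (y * l))"
  have "l1 ?f"
    using L_scale_power(1)[OF y, of "\<lambda>x. \<bar>J x\<bar>" "\<beta> + 1"] kernel_summable
    unfolding l1_def by (simp add: mult.commute)
  note mult = multiplication_formula[OF this h]
  have Ff: "F ?f x = (if x = y then (cF * J_norm / ?w y) *\<^sub>R 1 else 0)" if x: "x \<in> L" for x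
  proof -
    have "(J (x * l) * ?w l) *\<^sub>R ?f l = (J (y * l) * J (x * l) * ?w l) *\<^sub>R 1" for l
      by (simp add: scaleR_conv_of_real mult_ac)
    then have "F ?f x = cF *\<^sub>R ((\<Sum>\<^sub>\<infinity>l\<in>L. J (y * l) * J (x * l) * ?w l) *\<^sub>R 1)"
      unfolding F_eq by (simp only: infsum_scaleR_left[OF J_dilation_product_summable[OF x y]])
    then show ?thesis
      unfolding J_dilation_inner_product[OF x y] powr_minus by (simp add: divide_inverse)
  qed
  have "(J (y * l) * ?w l) *\<^sub>R F h l = ?w l *\<^sub>R (?f l * F h l)" for l
    by (simp add: scaleR_conv_of_real mult_ac)
  then have "F (F h) y = cF *\<^sub>R (\<Sum>\<^sub>\<infinity>x\<in>L. ?w x *\<^sub>R (F ?f x * h x))"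
    unfolding F_eq[of "F h"] mult by simp
  also have "(\<Sum>\<^sub>\<infinity>x\<in>L. ?w x *\<^sub>R (F ?f x * h x)) = (\<Sum>\<^sub>\<infinity>x\<in>{y}. (cF * J_norm) *\<^sub>R h y)"
    using y L_pos[OF y] by (intro infsum_cong_neutral) (auto simp: Ff)
  finally show ?thesis by (simp add: F_norm_def)
qed

lemma F_injective:
  assumes "linf f" "linf h" and "\<And>l. l \<in> L \<Longrightarrow> F f l = F h l" and "x \<in> L"
  shows "f x = h x"
proof -
  have "F (F f) x = F (F h) x" by (rule F_cong[OF assms(3)])
  then show ?thesis
    using F_inversion assms F_norm_pos by simp
qed

end

section \<open>Decay, flatness and moments under the transform\<close>

lemma summable_on_sum:
  fixes f :: "'i \<Rightarrow> 'a \<Rightarrow> 'b::{topological_comm_monoid_add, t2_space}"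
  assumes "finite I" "\<And>i. i \<in> I \<Longrightarrow> f i summable_on A"
  shows "(\<lambda>x. \<Sum>i\<in>I. f i x) summable_on A"
  using assms by (induction I rule: finite_induct) (auto intro: summable_on_add)

lemma infsum_sum:
  fixes f :: "'i \<Rightarrow> 'a \<Rightarrow> 'b::{topological_comm_monoid_add, t2_space}"
  assumes "finite I" "\<And>i. i \<in> I \<Longrightarrow> f i summable_on A"
  shows "(\<Sum>\<^sub>\<infinity>x\<in>A. \<Sum>i\<in>I. f i x) = (\<Sum>i\<in>I. infsum (f i) A)"
  using assms by (induction I rule: finite_induct) (auto simp: infsum_add summable_on_sum)

context q_base
begin

text \<open>
  \<open>rapid\<close> means bounded near the origin and smaller than every power at infinity, and \<open>flat\<close>
  means bounded at infinity and vanishing to infinite order at the origin. An even expansion is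
  controlled at infinity only by the growth of its remainder term.
\<close>

definition rapid :: "(real \<Rightarrow> complex) \<Rightarrow> bool" where
  "rapid f \<longleftrightarrow> (\<forall>s\<ge>0. power_bound f (- s))"

definition flat :: "(real \<Rightarrow> complex) \<Rightarrow> bool" where
  "flat f \<longleftrightarrow> (\<forall>s\<ge>0. power_bound f s)"

definition even_expansion :: "(real \<Rightarrow> complex) \<Rightarrow> (nat \<Rightarrow> complex) \<Rightarrow> nat \<Rightarrow> bool" where
  "even_expansion f a N \<longleftrightarrow> power_bound (\<lambda>x. f x - (\<Sum>k<N. x ^ (2 * k) *\<^sub>R a k)) (2 * real N)"

lemma L_even_power: "x \<in> L \<Longrightarrow> x powr (2 * real N) = x ^ (2 * N)"
  using powr_realpow[OF L_pos, of x "2 * N"] by simp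

lemma L_powr_add_even: "x \<in> L \<Longrightarrow> x powr (s + 2 * real k) = x ^ (2 * k) * x powr s"
  using L_even_power[of x k] by (simp add: powr_add)

lemma rapidD: "rapid f \<Longrightarrow> 0 \<le> s \<Longrightarrow> power_bound f (- s)"
  by (simp add: rapid_def)

lemma flatD: "flat f \<Longrightarrow> 0 \<le> s \<Longrightarrow> power_bound f s"
  by (simp add: flat_def)

lemma rapid_bounded: "rapid f \<Longrightarrow> power_bound f 0"
  using rapidD[of f 0] by simp

lemma rapid_mult_bounded: "rapid f \<Longrightarrow> power_bound g 0 \<Longrightarrow> rapid (\<lambda>x. f x * g x)"
  unfolding rapid_def using power_bound_mult[of f _ g 0] by force

lemma flat_mult_bounded: "flat f \<Longrightarrow> power_bound g 0 \<Longrightarrow> flat (\<lambda>x. f x * g x)"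
  unfolding flat_def using power_bound_mult[of f _ g 0] by force

lemma flat_if_even_powers:
  assumes "\<And>N::nat. power_bound f (2 * real N)"
  shows "flat f"
  unfolding flat_def
proof (intro allI impI)
  fix s :: real assume "0 \<le> s"
  moreover have "s \<le> 2 * real (nat \<lceil>s\<rceil>)" using \<open>0 \<le> s\<close> by linarith
  ultimately show "power_bound f s"
    using power_bound_interpolate[of f 0] assms[of 0] assms[of "nat \<lceil>s\<rceil>"] by simp
qed

lemma rapid_if_even_powers:
  assumes "0 \<le> r" and "\<And>N::nat. power_bound f (- (2 * real N + r))" and "power_bound f 0"
  shows "rapid f"
  unfolding rapid_def
proof (intro allI impI)
  fix s :: real assume "0 \<le> s"
  moreover have "- (2 * real (nat \<lceil>s\<rceil>) + r) \<le> - s" using \<open>0 \<le> s\<close> assms(1) by linarith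
  ultimately show "power_bound f (- s)"
    using power_bound_interpolate[OF assms(2)[of "nat \<lceil>s\<rceil>"] assms(3)] by simp
qed

lemma rapid_summable: "rapid f \<Longrightarrow> 0 < s \<Longrightarrow> (\<lambda>x. x powr s * norm (f x)) summable_on L"
  using power_bound_summable[OF rapidD[of f "s + 1"] rapid_bounded[of f], of s] by simp

lemma flat_rapid_summable:
  assumes "flat f" "rapid f"
  shows "(\<lambda>x. x powr s * norm (f x)) summable_on L"
  by (rule power_bound_summable[OF rapidD[OF assms(2), of "\<bar>s\<bar> + 1"] flatD[OF assms(1), of "\<bar>s\<bar> + 1"]]) auto

lemma flat_even_expansion: "flat f \<Longrightarrow> even_expansion f (\<lambda>_. 0) N"
  by (simp add: even_expansion_def flatD)

end

context q_bessel_fn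
begin

lemma rapid_imp_l1: "rapid f \<Longrightarrow> l1 f"
  unfolding l1_def using rapid_summable beta by auto

definition taylor_coeff :: "(real \<Rightarrow> complex) \<Rightarrow> nat \<Rightarrow> complex" where
  "taylor_coeff f k = (cF * J_coeff k) *\<^sub>R (\<Sum>\<^sub>\<infinity>x\<in>L. x powr (2 * \<beta> + 2 + 2 * real k) *\<^sub>R f x)"

lemma F_at_0: "F f 0 = taylor_coeff f 0"
  unfolding F_eq taylor_coeff_def by (simp add: J_0 J_coeff_0)

text \<open>
  The Taylor coefficients of the transform are constant multiples of the moments of the function,
  so that a function with vanishing moments has a flat transform.
\<close>

lemma F_even_expansion:
  assumes f: "rapid f"
  shows "even_expansion (F f) (taylor_coeff f) N"
proof -
  let ?s = "\<lambda>k. 2 * \<beta> + 2 + 2 * real k"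
  let ?c = "\<lambda>k. \<Sum>\<^sub>\<infinity>x\<in>L. x powr ?s k *\<^sub>R f x"
  let ?R = "\<lambda>y. J y - (\<Sum>k<N. J_coeff k * y ^ (2 * k))"
  obtain C where C: "\<And>x. x \<in> L \<Longrightarrow> norm (?R x) \<le> C * x powr (2 * real N)"
    using J_remainder by (rule power_boundE) blast
  have sf: "(\<lambda>x. x powr ?s k * norm (f x)) summable_on L" for k
    using f beta by (intro rapid_summable) auto
  define M where "M = (\<Sum>\<^sub>\<infinity>x\<in>L. x powr ?s N * norm (f x))"
  have "norm (F f l - (\<Sum>k<N. l ^ (2 * k) *\<^sub>R taylor_coeff f k)) \<le> cF * C * M * l powr (2 * real N)"
    if l: "l \<in> L" for l
  proof -
    let ?t = "\<lambda>x. (?R (l * x) * x powr (2 * \<beta> + 2)) *\<^sub>R f x"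
    let ?p = "\<lambda>x. \<Sum>k<N. (J_coeff k * l ^ (2 * k)) *\<^sub>R (x powr ?s k *\<^sub>R f x)"
    have le: "norm (?t x) \<le> C * l powr (2 * real N) * (x powr ?s N * norm (f x))" if x: "x \<in> L" for x
    proof -
      have "norm (?t x) = norm (?R (l * x)) * (x powr (2 * \<beta> + 2) * norm (f x))"
        by (simp add: abs_mult)
      also have "\<dots> \<le> (C * (l * x) powr (2 * real N)) * (x powr (2 * \<beta> + 2) * norm (f x))"
        using C[OF L_mult[OF l x]] by (intro mult_right_mono) auto
      finally show ?thesis
        using L_pos[OF l] L_pos[OF x] by (simp add: powr_mult powr_add mult_ac)
    qed
    note t = infsum_dominated[OF summable_on_cmult_right[OF sf] le]
    have sp: "(\<lambda>x. (J_coeff k * l ^ (2 * k)) *\<^sub>R (x powr ?s k *\<^sub>R f x)) summable_on L" for k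
      by (intro summable_on_scaleR_right infsum_dominated(1)[OF sf[of k]]) simp
    have "(\<Sum>k<N. l ^ (2 * k) *\<^sub>R taylor_coeff f k) = cF *\<^sub>R (\<Sum>k<N. (J_coeff k * l ^ (2 * k)) *\<^sub>R ?c k)"
      unfolding taylor_coeff_def by (simp add: scaleR_sum_right mult_ac)
    also have "(\<Sum>k<N. (J_coeff k * l ^ (2 * k)) *\<^sub>R ?c k) = infsum ?p L"
      unfolding infsum_scaleR_right[symmetric] by (rule infsum_sum[symmetric, OF finite_lessThan sp])
    finally have p: "(\<Sum>k<N. l ^ (2 * k) *\<^sub>R taylor_coeff f k) = cF *\<^sub>R infsum ?p L" .
    have "(\<Sum>\<^sub>\<infinity>x\<in>L. (J (l * x) * x powr (2 * \<beta> + 2)) *\<^sub>R f x) = (\<Sum>\<^sub>\<infinity>x\<in>L. ?t x + ?p x)"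
    proof (rule infsum_cong)
      fix x assume x: "x \<in> L"
      have "?p x = ((\<Sum>k<N. J_coeff k * (l * x) ^ (2 * k)) * x powr (2 * \<beta> + 2)) *\<^sub>R f x"
        unfolding L_powr_add_even[OF x] sum_distrib_right scaleR_sum_left
        by (simp add: power_mult_distrib mult_ac)
      then show "(J (l * x) * x powr (2 * \<beta> + 2)) *\<^sub>R f x = ?t x + ?p x"
        by (simp add: algebra_simps)
    qed
    also have "\<dots> = infsum ?t L + infsum ?p L"
      by (rule infsum_add[OF t(1) summable_on_sum[OF finite_lessThan sp]])
    finally have "F f l - (\<Sum>k<N. l ^ (2 * k) *\<^sub>R taylor_coeff f k) = cF *\<^sub>R infsum ?t L"
      unfolding p F_eq by (simp add: scaleR_add_right)
    then have "norm (F f l - (\<Sum>k<N. l ^ (2 * k) *\<^sub>R taylor_coeff f k)) = cF * norm (infsum ?t L)"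
      using cF_pos by simp
    also have "\<dots> \<le> cF * (C * l powr (2 * real N) * M)"
      using t(2) cF_pos unfolding M_def infsum_cmult_right' by (intro mult_left_mono) auto
    finally show ?thesis by (simp only: mult_ac)
  qed
  then show ?thesis unfolding even_expansion_def by (rule power_boundI)
qed

lemma F_flat:
  assumes "rapid f" and "\<And>k. (\<Sum>\<^sub>\<infinity>x\<in>L. x powr (2 * \<beta> + 2 + 2 * real k) *\<^sub>R f x) = 0"
  shows "flat (F f)"
  using F_even_expansion[OF assms(1)] assms(2)
  by (intro flat_if_even_powers) (simp add: even_expansion_def taylor_coeff_def)

text \<open>
  Since all moments of \<open>J\<close> vanish, the transform does not change when an even polynomial is
  subtracted from \<open>f\<close>; the remainder of an expansion at the origin then yields decay at infinity.
\<close>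

lemma F_rapid:
  assumes f: "rapid f" and e: "\<And>N. \<exists>a. even_expansion f a N"
  shows "rapid (F f)"
proof (rule rapid_if_even_powers)
  show "0 \<le> 2 * \<beta> + 2" using beta by simp
  show "power_bound (F f) 0"
    using F_even_expansion[OF f, of 0] by (simp add: even_expansion_def)
next
  fix N :: nat
  let ?s = "\<lambda>k. 2 * \<beta> + 2 + 2 * real k"
  obtain a where "even_expansion f a N" using e by blast
  then obtain C where C: "\<And>x. x \<in> L \<Longrightarrow> norm (f x - (\<Sum>k<N. x ^ (2 * k) *\<^sub>R a k)) \<le> C * x powr (2 * real N)"
    unfolding even_expansion_def by (rule power_boundE) blast
  have s: "0 < ?s k" for k using beta by simp
  have k: "(\<lambda>x. \<bar>J x\<bar> * x powr ?s N) summable_on L"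
    using J_abs_power_summable[OF s] by (simp add: mult.commute)
  define M where "M = (\<Sum>\<^sub>\<infinity>x\<in>L. \<bar>J x\<bar> * x powr ?s N)"
  have "norm (F f l) \<le> cF * C * M * l powr (- (2 * real N + (2 * \<beta> + 2)))" if l: "l \<in> L" for l
  proof -
    let ?t = "\<lambda>x. (J (l * x) * x powr (2 * \<beta> + 2)) *\<^sub>R (f x - (\<Sum>k<N. x ^ (2 * k) *\<^sub>R a k))"
    let ?p = "\<lambda>x. \<Sum>k<N. (J (l * x) * x powr ?s k) *\<^sub>R a k"
    have J0: "(\<Sum>\<^sub>\<infinity>x\<in>L. J (l * x) * x powr ?s k) = 0" for k
      unfolding L_scale_power(2)[OF l] J_moments by simp
    have Js: "(\<lambda>x. J (l * x) * x powr ?s k) summable_on L" for k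
      by (rule L_scale_power(1)[OF l J_power_summable[OF s]])
    have sp: "(\<lambda>x. (J (l * x) * x powr ?s k) *\<^sub>R a k) summable_on L" for k
      by (intro summable_on_scaleR_left Js)
    have p0: "infsum ?p L = 0"
      unfolding infsum_sum[OF finite_lessThan sp] infsum_scaleR_left[OF Js] J0 by simp
    have le: "norm (?t x) \<le> C * (\<bar>J (l * x)\<bar> * x powr ?s N)" if x: "x \<in> L" for x
    proof -
      have "norm (?t x) \<le> \<bar>J (l * x)\<bar> * x powr (2 * \<beta> + 2) * (C * x powr (2 * real N))"
        using C[OF x] by (simp add: abs_mult mult_left_mono)
      then show ?thesis by (simp only: powr_add mult_ac)
    qed
    note t = infsum_dominated[OF summable_on_cmult_right[OF L_scale_power(1)[OF l k]] le]
    have "(\<Sum>\<^sub>\<infinity>x\<in>L. (J (l * x) * x powr (2 * \<beta> + 2)) *\<^sub>R f x) = (\<Sum>\<^sub>\<infinity>x\<in>L. ?t x + ?p x)"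
    proof (rule infsum_cong)
      fix x assume x: "x \<in> L"
      have "?p x = (J (l * x) * x powr (2 * \<beta> + 2)) *\<^sub>R (\<Sum>k<N. x ^ (2 * k) *\<^sub>R a k)"
        unfolding L_powr_add_even[OF x] scaleR_sum_right by (simp add: mult_ac)
      then show "(J (l * x) * x powr (2 * \<beta> + 2)) *\<^sub>R f x = ?t x + ?p x"
        by (simp add: algebra_simps)
    qed
    also have "\<dots> = infsum ?t L"
      using infsum_add[OF t(1) summable_on_sum[OF finite_lessThan sp]] p0 by simp
    finally have "norm (F f l) = cF * norm (infsum ?t L)"
      unfolding F_eq using cF_pos by simp
    also have "\<dots> \<le> cF * (C * (l powr (- ?s N) * M))"
      using t(2) cF_pos unfolding M_def infsum_cmult_right' L_scale_power(2)[OF l, of "\<lambda>x. \<bar>J x\<bar>"]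
      by (intro mult_left_mono) auto
    also have "- ?s N = - (2 * real N + (2 * \<beta> + 2))" by simp
    finally show ?thesis by (simp only: mult_ac)
  qed
  then show "power_bound (F f) (- (2 * real N + (2 * \<beta> + 2)))" by (rule power_boundI)
qed

text \<open>
  Interchanging the two sums leaves the moments of \<open>J\<close>, which vanish. Flatness pays for the negative
  powers of \<open>l\<close> that the scaling of the inner sum produces.
\<close>

lemma F_moments:
  assumes f: "flat f" "rapid f"
  shows "(\<Sum>\<^sub>\<infinity>x\<in>L. x powr (2 * \<beta> + 2 + 2 * real k) *\<^sub>R F f x) = 0"
proof -
  define s where "s = 2 * \<beta> + 2 + 2 * real k"
  have s: "0 < s" using beta by (simp add: s_def)
  let ?t = "\<lambda>l x. x powr s *\<^sub>R ((J (x * l) * l powr (2 * \<beta> + 2)) *\<^sub>R f l)"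
  have t: "norm (?t l x) \<le> l powr (2 * \<beta> + 2 - s) * norm (f l) * ((x * l) powr s * \<bar>J (x * l)\<bar>)"
    if l: "l \<in> L" and x: "x \<in> L" for l x
  proof -
    have "l powr (2 * \<beta> + 2) = l powr (2 * \<beta> + 2 - s) * l powr s"
      by (simp only: powr_add[symmetric]) simp
    then show ?thesis
      using L_pos[OF l] L_pos[OF x] by (simp add: abs_mult powr_mult mult_ac)
  qed
  have swap: "(\<Sum>\<^sub>\<infinity>l\<in>L. \<Sum>\<^sub>\<infinity>x\<in>L. ?t l x) = (\<Sum>\<^sub>\<infinity>x\<in>L. \<Sum>\<^sub>\<infinity>l\<in>L. ?t l x)"
    by (rule L_fubini(1)[where \<phi> = "\<lambda>x. x", OF flat_rapid_summable[OF f] J_abs_power_summable[OF s]],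
        simp, simp, assumption, erule (1) t)
  have "(\<Sum>\<^sub>\<infinity>x\<in>L. ?t l x) = 0" if l: "l \<in> L" for l
  proof -
    have "?t l x = (J (l * x) * x powr s) *\<^sub>R (l powr (2 * \<beta> + 2) *\<^sub>R f l)" for x
      by (simp add: mult_ac)
    then have "(\<Sum>\<^sub>\<infinity>x\<in>L. ?t l x) = (\<Sum>\<^sub>\<infinity>x\<in>L. J (l * x) * x powr s) *\<^sub>R (l powr (2 * \<beta> + 2) *\<^sub>R f l)"
      by (simp only: infsum_scaleR_left[OF L_scale_power(1)[OF l J_power_summable[OF s]]])
    also have "(\<Sum>\<^sub>\<infinity>x\<in>L. J (l * x) * x powr s) = 0"
      unfolding L_scale_power(2)[OF l] unfolding s_def J_moments by simp
    finally show ?thesis by simp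
  qed
  then have "(\<Sum>\<^sub>\<infinity>x\<in>L. \<Sum>\<^sub>\<infinity>l\<in>L. ?t l x) = 0"
    unfolding swap[symmetric] by (simp cong: infsum_cong)
  moreover have "x powr s *\<^sub>R F f x = cF *\<^sub>R (\<Sum>\<^sub>\<infinity>l\<in>L. ?t l x)" for x
    unfolding F_eq infsum_scaleR_right by simp
  ultimately have "(\<Sum>\<^sub>\<infinity>x\<in>L. x powr s *\<^sub>R F f x) = 0"
    by (simp only: infsum_scaleR_right) simp
  then show ?thesis by (simp only: s_def)
qed

lemma F_continuous_at_0:
  assumes "rapid f"
  shows "(\<lambda>n. F f (q ^ n)) \<longlonglongrightarrow> F f 0"
proof (rule power_bound_tendsto[of 2])
  show "power_bound (\<lambda>x. F f x - F f 0) 2"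
    using F_even_expansion[OF assms, of 1] by (simp add: even_expansion_def F_at_0)
qed simp

section \<open>Translations\<close>

lemma J_translate_bounded:
  assumes "b \<in> insert 0 L"
  shows "power_bound (\<lambda>l. J (l * b)) 0"
proof (cases "b = 0")
  case True
  then show ?thesis using L_pos by (intro power_boundI[of _ 1]) (force simp: J_0)
next
  case False
  then show ?thesis using power_bound_dilate[OF _ J_bounded, of b] assms by (simp add: mult.commute)
qed

lemma l1_mult_bounded:
  assumes "l1 f" "power_bound r 0"
  shows "l1 (\<lambda>x. r x *\<^sub>R f x)"
proof -
  obtain B where B: "\<And>x. x \<in> L \<Longrightarrow> norm (r x) \<le> B"
    using assms(2) by (rule power_bound_0E) blast
  show ?thesis
    unfolding l1_def
  proof (rule infsum_dominated(1)[OF summable_on_cmult_right[OF assms(1)[unfolded l1_def], of B]])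
    fix x assume "x \<in> L"
    then have "norm (r x) * (x powr (\<beta> + 1) * norm (f x)) \<le> B * (x powr (\<beta> + 1) * norm (f x))"
      using B by (intro mult_right_mono) auto
    then show "norm (x powr (\<beta> + 1) * norm (r x *\<^sub>R f x)) \<le> B * (x powr (\<beta> + 1) * norm (f x))"
      by (simp add: abs_mult mult_ac)
  qed
qed

text \<open>
  The inversion formula supplies the function that the choice operator in the definition of the
  translate needs.
\<close>

lemma q_translate_transform:
  assumes h: "l1 h" and b: "b \<in> insert 0 L"
  shows "linf (q_translate q \<beta> b h)"
    and "\<And>l. l \<in> L \<Longrightarrow> F (q_translate q \<beta> b h) l = J (l * b) *\<^sub>R F h l"
proof -
  let ?P = "\<lambda>u. (\<forall>y\<in>Rq q. u (- y) = u y) \<and> q_square_integrable q \<beta> u \<and>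
        (\<forall>l\<in>Rq_pos q. q_fourier q \<beta> u l = q_bessel3 q \<beta> (l * b) *\<^sub>R q_fourier q \<beta> h l)"
  let ?G = "\<lambda>l. J (l * b) *\<^sub>R F h l"
  have G: "l1 ?G" by (rule l1_mult_bounded[OF F_l1[OF h] J_translate_bounded[OF b]])
  define u where "u y = (1 / F_norm) *\<^sub>R F ?G \<bar>y\<bar>" for y
  have u: "u y = (1 / F_norm) *\<^sub>R F ?G y" if "y \<in> L" for y
    using L_pos[OF that] by (simp add: u_def)
  have "l1 (\<lambda>y. (1 / F_norm) *\<^sub>R F ?G y)"
    by (intro l1_scaleR F_l1 G)
  then have "l1 u"
    unfolding l1_def using u by (simp cong: summable_on_cong)
  moreover have "F u l = ?G l" if "l \<in> L" for l
  proof -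
    have "F u l = F (\<lambda>y. (1 / F_norm) *\<^sub>R F ?G y) l" by (rule F_cong[OF u])
    also have "\<dots> = ?G l"
      unfolding F_scaleR F_inversion[OF l1_imp_linf[OF G] that] using F_norm_pos by simp
    finally show ?thesis .
  qed
  ultimately have "?P u"
    using l1_square_integrable by (auto simp: u_def)
  then have "?P (q_translate q \<beta> b h)"
    unfolding q_translate_def by (rule someI[of ?P])
  then show "linf (q_translate q \<beta> b h)"
    and "\<And>l. l \<in> L \<Longrightarrow> F (q_translate q \<beta> b h) l = J (l * b) *\<^sub>R F h l"
    using square_integrable_imp_linf by blast+
qed

text \<open>
  Parseval's formula turns the pairing with a translate into an inverse transform: a wavelet
  transform is, in the variable \<open>b\<close>, a Fourier multiplier.
\<close>

lemma pairing_with_translate: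
  assumes f: "l1 f" and h: "l1 h" and b: "b \<in> insert 0 L"
  shows "cF *\<^sub>R (\<Sum>\<^sub>\<infinity>x\<in>L. x powr (2 * \<beta> + 2) *\<^sub>R (f x * cnj (q_translate q \<beta> b h x)))
    = (1 / F_norm) *\<^sub>R F (\<lambda>l. F f l * cnj (F h l)) b"
proof -
  let ?T = "q_translate q \<beta> b h"
  let ?H = "F (\<lambda>x. cnj (?T x))"
  note T = q_translate_transform[OF h b]
  have lT: "linf (\<lambda>x. cnj (?T x))" using T(1) by (simp add: power_bound_def)
  have "cnj (?T x) = (1 / F_norm) *\<^sub>R F ?H x" if "x \<in> L" for x
    using F_inversion[OF lT that] F_norm_pos by simp
  then have "(\<Sum>\<^sub>\<infinity>x\<in>L. x powr (2 * \<beta> + 2) *\<^sub>R (f x * cnj (?T x)))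
      = (\<Sum>\<^sub>\<infinity>x\<in>L. (1 / F_norm) *\<^sub>R (x powr (2 * \<beta> + 2) *\<^sub>R (f x * F ?H x)))"
    by (intro infsum_cong) (simp add: mult_ac)
  also have "\<dots> = (1 / F_norm) *\<^sub>R (\<Sum>\<^sub>\<infinity>l\<in>L. l powr (2 * \<beta> + 2) *\<^sub>R (F f l * ?H l))"
    unfolding multiplication_formula[OF f F_linf[OF lT]] infsum_scaleR_right ..
  also have "(\<Sum>\<^sub>\<infinity>l\<in>L. l powr (2 * \<beta> + 2) *\<^sub>R (F f l * ?H l))
      = (\<Sum>\<^sub>\<infinity>l\<in>L. (J (b * l) * l powr (2 * \<beta> + 2)) *\<^sub>R (F f l * cnj (F h l)))"
  proof (rule infsum_cong)
    fix l assume l: "l \<in> L"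
    have "?H l = J (b * l) *\<^sub>R cnj (F h l)"
      unfolding F_cnj T(2)[OF l] by (simp add: mult.commute)
    then show "l powr (2 * \<beta> + 2) *\<^sub>R (F f l * ?H l)
        = (J (b * l) * l powr (2 * \<beta> + 2)) *\<^sub>R (F f l * cnj (F h l))"
      by (simp add: mult_ac)
  qed
  finally show ?thesis
    unfolding F_eq[of "\<lambda>l. F f l * cnj (F h l)"] by (simp add: mult_ac)
qed

end

section \<open>The q-Schwartz space in terms of the lattice\<close>

lemma sum_even_odd:
  fixes h :: "nat \<Rightarrow> 'a::comm_monoid_add"
  shows "(\<Sum>k<2 * N. h k) = (\<Sum>j<N. h (2 * j) + h (2 * j + 1))"
  by (induction N) (simp_all add: add_ac)

lemma q_deriv_funpow_Suc: "(q_deriv q ^^ Suc k) f = (q_deriv q ^^ k) (q_deriv q f)"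
  by (simp only: funpow_Suc_right o_def)

context q_base
begin

lemma q_deriv_nonzero:
  assumes "x \<noteq> 0"
  shows "f x - f (q * x) = ((1 - q) * x) *\<^sub>R q_deriv q f x"
  using assms q_less_1 by (simp add: q_deriv_def scaleR_conv_of_real)

text \<open>
  Taylor's formula by \<open>q\<close>-integration: the expansion of the \<open>q\<close>-derivative is divided by the \<open>q\<close>-integers,
  and the remainder at \<open>x\<close> telescopes along \<open>q\<^sup>n x\<close> down to the origin, where \<open>f\<close> is continuous.
\<close>

lemma q_taylor:
  assumes "\<And>k. k < N \<Longrightarrow> (q_deriv q ^^ k) f differentiable (at 0)"
    and "\<exists>B. \<forall>x. norm ((q_deriv q ^^ N) f x) \<le> B"
  shows "\<exists>a C. \<forall>x. norm (f x - (\<Sum>k<N. x ^ k *\<^sub>R a k)) \<le> C * \<bar>x\<bar> ^ N"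
  using assms
proof (induction N arbitrary: f)
  case 0
  then show ?case by simp
next
  case (Suc N)
  have "(q_deriv q ^^ k) (q_deriv q f) differentiable (at 0)" if "k < N" for k
    using Suc.prems(1)[of "Suc k"] that unfolding q_deriv_funpow_Suc by simp
  moreover have "\<exists>B. \<forall>x. norm ((q_deriv q ^^ N) (q_deriv q f) x) \<le> B"
    using Suc.prems(2) unfolding q_deriv_funpow_Suc .
  ultimately obtain b C where C: "\<And>x. norm (q_deriv q f x - (\<Sum>k<N. x ^ k *\<^sub>R b k)) \<le> C * \<bar>x\<bar> ^ N"
    using Suc.IH[of "q_deriv q f"] by blast
  have C0: "0 \<le> C" using order_trans[OF norm_ge_zero C[of 1]] by simp
  define c where "c k = ((1 - q) / (1 - q ^ Suc k)) *\<^sub>R b k" for k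
  define r where "r x = f x - f 0 - (\<Sum>k<N. x ^ Suc k *\<^sub>R c k)" for x
  have step: "norm (r x - r (q * x)) \<le> (1 - q) * C * \<bar>x\<bar> ^ Suc N" for x
  proof (cases "x = 0")
    case False
    have "x ^ Suc k *\<^sub>R c k - (q * x) ^ Suc k *\<^sub>R c k = ((1 - q) * x) *\<^sub>R (x ^ k *\<^sub>R b k)" for k
    proof -
      have n: "1 - q ^ Suc k \<noteq> 0"
        using power_Suc_less_one[OF q_pos q_less_1, of k] by simp
      have "x ^ Suc k *\<^sub>R c k - (q * x) ^ Suc k *\<^sub>R c k = (x ^ Suc k * (1 - q ^ Suc k)) *\<^sub>R c k"
        by (simp only: power_mult_distrib scaleR_diff_left[symmetric]) (simp add: algebra_simps)
      also have "\<dots> = (x ^ Suc k * (1 - q)) *\<^sub>R b k"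
        unfolding c_def using n by (simp del: power_Suc)
      finally show ?thesis by (simp add: mult_ac)
    qed
    then have "(\<Sum>k<N. x ^ Suc k *\<^sub>R c k) - (\<Sum>k<N. (q * x) ^ Suc k *\<^sub>R c k)
        = ((1 - q) * x) *\<^sub>R (\<Sum>k<N. x ^ k *\<^sub>R b k)"
      by (simp only: sum_subtractf[symmetric] scaleR_sum_right)
    then have "r x - r (q * x) = ((1 - q) * x) *\<^sub>R (q_deriv q f x - (\<Sum>k<N. x ^ k *\<^sub>R b k))"
      unfolding r_def using q_deriv_nonzero[OF False, of f] by (simp add: algebra_simps)
    then have "norm (r x - r (q * x)) = (1 - q) * \<bar>x\<bar> * norm (q_deriv q f x - (\<Sum>k<N. x ^ k *\<^sub>R b k))"
      using q_less_1 by (simp add: abs_mult)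
    also have "\<dots> \<le> (1 - q) * \<bar>x\<bar> * (C * \<bar>x\<bar> ^ N)"
      using C q_less_1 by (intro mult_left_mono) auto
    finally show ?thesis by (simp add: mult_ac)
  qed simp
  have tele: "norm (r x - r (q ^ n * x)) \<le> C * \<bar>x\<bar> ^ Suc N * (1 - q ^ n)" for x n
  proof (induction n)
    case (Suc n)
    have "\<bar>q ^ n * x\<bar> ^ Suc N = (q ^ n) ^ Suc N * \<bar>x\<bar> ^ Suc N"
      using q_pos by (simp add: abs_mult power_mult_distrib del: power_Suc)
    also have "\<dots> \<le> q ^ n * \<bar>x\<bar> ^ Suc N"
    proof (intro mult_right_mono)
      have "q ^ n * (q ^ n) ^ N \<le> q ^ n * 1"
        using q_pos q_less_1 by (intro mult_left_mono power_le_one) auto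
      then show "(q ^ n) ^ Suc N \<le> q ^ n" by simp
    qed simp
    finally have "(1 - q) * C * \<bar>q ^ n * x\<bar> ^ Suc N \<le> (1 - q) * C * (q ^ n * \<bar>x\<bar> ^ Suc N)"
      using C0 q_less_1 by (intro mult_left_mono) auto
    then have "norm (r (q ^ n * x) - r (q * (q ^ n * x))) \<le> (1 - q) * C * (q ^ n * \<bar>x\<bar> ^ Suc N)"
      using step[of "q ^ n * x"] by linarith
    moreover have "norm (r x - r (q ^ Suc n * x))
        \<le> norm (r x - r (q ^ n * x)) + norm (r (q ^ n * x) - r (q * (q ^ n * x)))"
      using norm_triangle_ineq[of "r x - r (q ^ n * x)" "r (q ^ n * x) - r (q * (q ^ n * x))"]
      by (simp add: mult_ac)
    ultimately have "norm (r x - r (q ^ Suc n * x))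
        \<le> C * \<bar>x\<bar> ^ Suc N * (1 - q ^ n) + (1 - q) * C * (q ^ n * \<bar>x\<bar> ^ Suc N)"
      using Suc.IH by linarith
    also have "\<dots> = C * \<bar>x\<bar> ^ Suc N * (1 - q ^ Suc n)"
      by (simp add: algebra_simps)
    finally show ?case .
  qed simp
  have bound: "norm (r x) \<le> C * \<bar>x\<bar> ^ Suc N" for x
  proof -
    have "isCont f 0"
      using Suc.prems(1)[of 0] differentiable_imp_continuous_within by auto
    then have "isCont r 0"
      unfolding r_def by (intro continuous_intros) auto
    moreover have "(\<lambda>n. q ^ n * x) \<longlonglongrightarrow> 0"
      using q_pos q_less_1 by (intro tendsto_mult_left_zero LIMSEQ_realpow_zero) auto
    ultimately have "(\<lambda>n. r (q ^ n * x)) \<longlonglongrightarrow> r 0"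
      using isCont_tendsto_compose by blast
    then have "(\<lambda>n. norm (r x - r (q ^ n * x))) \<longlonglongrightarrow> norm (r x - 0)"
      by (intro tendsto_intros) (simp add: r_def)
    moreover have "norm (r x - r (q ^ n * x)) \<le> C * \<bar>x\<bar> ^ Suc N" for n
    proof -
      have "C * \<bar>x\<bar> ^ Suc N * (1 - q ^ n) \<le> C * \<bar>x\<bar> ^ Suc N * 1"
        using C0 q_pos by (intro mult_left_mono) auto
      then show ?thesis using tele[of x n] by linarith
    qed
    ultimately have "norm (r x - 0) \<le> C * \<bar>x\<bar> ^ Suc N"
      by (intro LIMSEQ_le_const2) blast+
    then show ?thesis by simp
  qed
  have "f x - (\<Sum>k<Suc N. x ^ k *\<^sub>R (case k of 0 \<Rightarrow> f 0 | Suc j \<Rightarrow> c j)) = r x" for x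
    unfolding sum.lessThan_Suc_shift r_def by simp
  then show ?case using bound by metis
qed

lemma schwartz_line_bounded:
  assumes "f \<in> q_schwartz_line q"
  shows "\<exists>B. \<forall>x. (1 + x\<^sup>2) ^ m * norm ((q_deriv q ^^ k) f x) \<le> B"
proof -
  have "bdd_above {cmod (of_real ((1 + x\<^sup>2) ^ m) * (q_deriv q ^^ j) f x) | x j. j \<le> k}"
    using assms by (auto simp: q_schwartz_line_def)
  then obtain B where B: "\<And>y. y \<in> {cmod (of_real ((1 + x\<^sup>2) ^ m) * (q_deriv q ^^ j) f x) | x j. j \<le> k} \<Longrightarrow> y \<le> B"
    unfolding bdd_above_def by blast
  have "(1 + x\<^sup>2) ^ m * norm ((q_deriv q ^^ k) f x) \<le> B" for x
  proof -
    have "cmod (of_real ((1 + x\<^sup>2) ^ m) * (q_deriv q ^^ k) f x) \<le> B"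
      by (rule B) blast
    moreover have "0 \<le> 1 + x\<^sup>2" by (simp add: add_nonneg_nonneg)
    ultimately show ?thesis
      unfolding norm_mult norm_of_real by (simp only: abs_of_nonneg zero_le_power)
  qed
  then show ?thesis by blast
qed

lemma schwartz_line_rapid:
  assumes "f \<in> q_schwartz_line q"
  shows "rapid f"
proof (rule rapid_if_even_powers[of 0])
  obtain B where "\<And>x. norm (f x) \<le> B"
    using schwartz_line_bounded[OF assms, of 0 0] by auto
  then show "power_bound f 0"
    using L_pos by (intro power_boundI[of _ B]) force
next
  fix N :: nat
  obtain B where B: "\<And>x. (1 + x\<^sup>2) ^ N * norm (f x) \<le> B"
    using schwartz_line_bounded[OF assms, of N 0] by auto
  have "norm (f x) \<le> B * x powr (- (2 * real N + 0))" if x: "x \<in> L" for x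
  proof -
    have x0: "0 < x" using L_pos[OF x] .
    have "(x\<^sup>2) ^ N \<le> (1 + x\<^sup>2) ^ N" by (intro power_mono) auto
    then have "x ^ (2 * N) * norm (f x) \<le> B"
      using B[of x] mult_right_mono[of "(x\<^sup>2) ^ N" _ "norm (f x)"] by (fastforce simp: power_mult)
    then have "norm (f x) \<le> B / x ^ (2 * N)"
      using x0 by (simp add: field_simps)
    also have "x ^ (2 * N) = x powr (2 * real N)"
      by (rule L_even_power[OF x, symmetric])
    finally show ?thesis by (simp add: powr_minus divide_inverse)
  qed
  then show "power_bound f (- (2 * real N + 0))" by (rule power_boundI)
qed simp

lemma schwartz_line_even_expansion:
  assumes f: "f \<in> q_schwartz_line q"
  shows "\<exists>a. even_expansion f a N"
proof -
  have "\<exists>B. \<forall>x. norm ((q_deriv q ^^ (2 * N)) f x) \<le> B"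
    using schwartz_line_bounded[OF f, of 0] by simp
  then obtain a C where C: "\<And>x. norm (f x - (\<Sum>k<2 * N. x ^ k *\<^sub>R a k)) \<le> C * \<bar>x\<bar> ^ (2 * N)"
    using q_taylor[of "2 * N" f] f by (auto simp: q_schwartz_line_def q_smooth_def)
  have "norm (f x - (\<Sum>j<N. x ^ (2 * j) *\<^sub>R a (2 * j))) \<le> C * x ^ (2 * N)" if "x \<in> L" for x
  proof -
    \<comment> \<open>Averaging over \<open>x\<close> and \<open>- x\<close> removes the odd powers.\<close>
    let ?p = "\<lambda>x. \<Sum>k<2 * N. x ^ k *\<^sub>R a k"
    have "f (- x) = f x" using f by (simp add: q_schwartz_line_def)
    moreover have "?p x + ?p (- x) = 2 *\<^sub>R (\<Sum>j<N. x ^ (2 * j) *\<^sub>R a (2 * j))"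
      unfolding sum_even_odd by (simp add: sum.distrib[symmetric] sum_distrib_left scaleR_conv_of_real algebra_simps)
    ultimately have "2 *\<^sub>R (f x - (\<Sum>j<N. x ^ (2 * j) *\<^sub>R a (2 * j))) = (f x - ?p x) + (f (- x) - ?p (- x))"
      by (simp add: scaleR_right_diff_distrib scaleR_2 algebra_simps)
    then have "norm (2 *\<^sub>R (f x - (\<Sum>j<N. x ^ (2 * j) *\<^sub>R a (2 * j))))
        \<le> norm (f x - ?p x) + norm (f (- x) - ?p (- x))"
      by (simp only: norm_triangle_ineq)
    then have "2 * norm (f x - (\<Sum>j<N. x ^ (2 * j) *\<^sub>R a (2 * j)))
        \<le> norm (f x - ?p x) + norm (f (- x) - ?p (- x))"
      by (simp only: norm_scaleR abs_numeral)
    then show ?thesis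
      using C[of x] C[of "- x"] L_pos[OF that] by (simp only: abs_minus_cancel abs_of_pos)
  qed
  then show ?thesis
    unfolding even_expansion_def
    by (intro exI[of _ "\<lambda>j. a (2 * j)"] power_boundI[of _ C]) (simp add: L_even_power)
qed

lemma L_subset_Rq: "x \<in> L \<Longrightarrow> x \<in> Rq q"
  by (simp add: Rq_def)

lemma Rq_abs: "x \<in> Rq q \<longleftrightarrow> \<bar>x\<bar> \<in> insert 0 L"
proof
  assume "x \<in> Rq q"
  then show "\<bar>x\<bar> \<in> insert 0 L"
    using L_pos by (auto simp: Rq_def abs_of_pos)
next
  assume "\<bar>x\<bar> \<in> insert 0 L"
  then show "x \<in> Rq q"
    by (cases "0 \<le> x") (auto simp: Rq_def image_iff intro: bexI[of _ "- x"])
qed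

lemma even_ext_on_L: "x \<in> L \<Longrightarrow> even_ext q u x = u x"
  using L_subset_Rq[of x] L_pos[of x] by (simp add: even_ext_def)

lemma jackson_moment:
  "jackson q (\<lambda>x. (x powr (2 * real k + 2 * \<beta> + 1)) *\<^sub>R f x)
    = (1 - q) *\<^sub>R (\<Sum>\<^sub>\<infinity>x\<in>L. x powr (2 * \<beta> + 2 + 2 * real k) *\<^sub>R f x)"
proof -
  have "x *\<^sub>R (x powr (2 * real k + 2 * \<beta> + 1) *\<^sub>R f x) = x powr (2 * \<beta> + 2 + 2 * real k) *\<^sub>R f x"
    if "x \<in> L" for x
  proof -
    have "2 * \<beta> + 2 + 2 * real k = 1 + (2 * real k + 2 * \<beta> + 1)" by simp
    then have "x powr (2 * \<beta> + 2 + 2 * real k) = x * x powr (2 * real k + 2 * \<beta> + 1)"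
      using L_pos[OF that] by (simp only: powr_add powr_one)
    then show ?thesis by simp
  qed
  then have "(\<Sum>\<^sub>\<infinity>x\<in>L. x *\<^sub>R (x powr (2 * real k + 2 * \<beta> + 1) *\<^sub>R f x))
      = (\<Sum>\<^sub>\<infinity>x\<in>L. x powr (2 * \<beta> + 2 + 2 * real k) *\<^sub>R f x)"
    by (rule infsum_cong)
  then show ?thesis unfolding jackson_eq by simp
qed

lemma schwartz0_properties:
  assumes "f \<in> q_schwartz0 q \<beta>"
  shows "rapid f" and "\<And>N. \<exists>a. even_expansion f a N"
    and "\<And>k. (\<Sum>\<^sub>\<infinity>x\<in>L. x powr (2 * \<beta> + 2 + 2 * real k) *\<^sub>R f x) = 0"
    and "f \<in> extensional (Rq q)"
    and "\<And>x. x \<in> Rq q \<Longrightarrow> f (- x) = f x"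
    and "(\<lambda>n. f (q ^ n)) \<longlonglongrightarrow> f 0"
proof -
  obtain h where h: "h \<in> q_schwartz_line q" and f: "f = restrict h (Rq q)"
    using assms by (auto simp: q_schwartz0_def q_schwartz_def)
  have fh: "f x = h x" if "x \<in> L" for x
    using L_subset_Rq[OF that] by (simp add: f)
  show "rapid f"
    using schwartz_line_rapid[OF h] fh by (simp add: rapid_def power_bound_def)
  show "\<exists>a. even_expansion f a N" for N
    using schwartz_line_even_expansion[OF h] fh by (simp add: even_expansion_def power_bound_def)
  show "(\<Sum>\<^sub>\<infinity>x\<in>L. x powr (2 * \<beta> + 2 + 2 * real k) *\<^sub>R f x) = 0" for k
    using assms q_less_1 by (auto simp: q_schwartz0_def jackson_moment)
  show "f \<in> extensional (Rq q)" by (simp add: f)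
  show "f (- x) = f x" if "x \<in> Rq q" for x
  proof -
    have "- x \<in> Rq q" using that unfolding Rq_abs by simp
    then show ?thesis using that h by (simp add: f q_schwartz_line_def)
  qed
  have "(q_deriv q ^^ 0) h differentiable (at 0)"
    using h unfolding q_schwartz_line_def q_smooth_def by blast
  then have "isCont h 0"
    using differentiable_imp_continuous_within by auto
  moreover have "(\<lambda>n. q ^ n) \<longlonglongrightarrow> 0"
    using q_pos q_less_1 by (intro LIMSEQ_realpow_zero) auto
  ultimately have "(\<lambda>n. h (q ^ n)) \<longlonglongrightarrow> h 0"
    using isCont_tendsto_compose by blast
  then show "(\<lambda>n. f (q ^ n)) \<longlonglongrightarrow> f 0"
    using fh[OF L_power] by (simp add: f Rq_def)
qed

section \<open>Extension from the lattice to the line\<close>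

text \<open>
  Conversely, a function on the lattice with an expansion at the origin has to be extended to the
  line. Smoothness is only demanded at the origin, in the weak form of an asymptotic expansion
  to all orders, and this form is visibly stable under the \<open>q\<close>-derivative.
\<close>

definition expansion :: "(real \<Rightarrow> complex) \<Rightarrow> (nat \<Rightarrow> complex) \<Rightarrow> bool" where
  "expansion h a \<longleftrightarrow> (\<forall>N. \<exists>C. \<forall>x. norm (h x - (\<Sum>k<N. x ^ k *\<^sub>R a k)) \<le> C * \<bar>x\<bar> ^ N)"

lemma expansionD: "expansion h a \<Longrightarrow> \<exists>C. \<forall>x. norm (h x - (\<Sum>k<N. x ^ k *\<^sub>R a k)) \<le> C * \<bar>x\<bar> ^ N"
  by (simp add: expansion_def)

lemma expansion_if_near_0:
  assumes B: "\<And>x. norm (h x) \<le> B"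
    and e: "\<And>N. \<exists>M\<ge>N. \<exists>C. \<forall>x. \<bar>x\<bar> \<le> 1 \<longrightarrow> norm (h x - (\<Sum>k<M. x ^ k *\<^sub>R a k)) \<le> C * \<bar>x\<bar> ^ N"
  shows "expansion h a"
  unfolding expansion_def
proof
  fix N
  obtain M C where M: "N \<le> M" and C: "\<And>x. \<bar>x\<bar> \<le> 1 \<Longrightarrow> norm (h x - (\<Sum>k<M. x ^ k *\<^sub>R a k)) \<le> C * \<bar>x\<bar> ^ N"
    using e[of N] by blast
  define A where "A = (\<Sum>k<M. norm (a k))"
  have B0: "0 \<le> B" using order_trans[OF norm_ge_zero B] .
  have C0: "0 \<le> C" using order_trans[OF norm_ge_zero C[of 1]] by simp
  have A0: "0 \<le> A" by (simp add: A_def sum_nonneg)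
  have "norm (h x - (\<Sum>k<N. x ^ k *\<^sub>R a k)) \<le> (A + B + C) * \<bar>x\<bar> ^ N" for x
  proof (cases "\<bar>x\<bar> \<le> 1")
    case True
    have "(\<Sum>k<M. x ^ k *\<^sub>R a k) - (\<Sum>k<N. x ^ k *\<^sub>R a k) = (\<Sum>k=N..<M. x ^ k *\<^sub>R a k)"
      using sum_diff_nat_ivl[of 0 N M "\<lambda>k. x ^ k *\<^sub>R a k"] M by (simp add: atLeast0LessThan)
    also have "norm \<dots> \<le> (\<Sum>k=N..<M. norm (a k) * \<bar>x\<bar> ^ N)"
    proof (rule sum_norm_le)
      fix k assume "k \<in> {N..<M}"
      then have "\<bar>x\<bar> ^ k \<le> \<bar>x\<bar> ^ N" using True by (intro power_decreasing) auto
      then show "norm (x ^ k *\<^sub>R a k) \<le> norm (a k) * \<bar>x\<bar> ^ N"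
        by (simp add: power_abs mult.commute mult_left_mono)
    qed
    also have "\<dots> \<le> A * \<bar>x\<bar> ^ N"
      unfolding A_def sum_distrib_right by (intro sum_mono2) auto
    finally have "norm ((\<Sum>k<M. x ^ k *\<^sub>R a k) - (\<Sum>k<N. x ^ k *\<^sub>R a k)) \<le> A * \<bar>x\<bar> ^ N" .
    moreover have "norm (h x - (\<Sum>k<N. x ^ k *\<^sub>R a k)) \<le> norm (h x - (\<Sum>k<M. x ^ k *\<^sub>R a k))
        + norm ((\<Sum>k<M. x ^ k *\<^sub>R a k) - (\<Sum>k<N. x ^ k *\<^sub>R a k))"
      using norm_triangle_ineq[of "h x - (\<Sum>k<M. x ^ k *\<^sub>R a k)"
          "(\<Sum>k<M. x ^ k *\<^sub>R a k) - (\<Sum>k<N. x ^ k *\<^sub>R a k)"] by simp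
    moreover have "0 \<le> B * \<bar>x\<bar> ^ N" using B0 by simp
    ultimately show ?thesis using C[OF True] unfolding distrib_right by linarith
  next
    case False
    have "norm (\<Sum>k<N. x ^ k *\<^sub>R a k) \<le> (\<Sum>k<N. norm (a k) * \<bar>x\<bar> ^ N)"
    proof (rule sum_norm_le)
      fix k assume "k \<in> {..<N}"
      then have "\<bar>x\<bar> ^ k \<le> \<bar>x\<bar> ^ N" using False by (intro power_increasing) auto
      then show "norm (x ^ k *\<^sub>R a k) \<le> norm (a k) * \<bar>x\<bar> ^ N"
        by (simp add: power_abs mult.commute mult_left_mono)
    qed
    also have "\<dots> \<le> A * \<bar>x\<bar> ^ N"
      unfolding A_def sum_distrib_right using M by (intro sum_mono2) auto
    finally have "norm (\<Sum>k<N. x ^ k *\<^sub>R a k) \<le> A * \<bar>x\<bar> ^ N" .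
    moreover have "B * 1 \<le> B * \<bar>x\<bar> ^ N"
      using False B0 by (intro mult_left_mono one_le_power) auto
    moreover have "0 \<le> C * \<bar>x\<bar> ^ N" using C0 by simp
    ultimately show ?thesis
      using B[of x] norm_triangle_ineq4[of "h x" "\<Sum>k<N. x ^ k *\<^sub>R a k"]
      unfolding distrib_right by linarith
  qed
  then show "\<exists>C. \<forall>x. norm (h x - (\<Sum>k<N. x ^ k *\<^sub>R a k)) \<le> C * \<bar>x\<bar> ^ N" by blast
qed

lemma expansion_at_0:
  assumes "expansion h a"
  shows "h 0 = a 0"
proof -
  obtain C where "\<And>x. norm (h x - (\<Sum>k<1. x ^ k *\<^sub>R a k)) \<le> C * \<bar>x\<bar> ^ 1"
    using expansionD[OF assms, of 1] by blast
  from this[of 0] show ?thesis by simp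
qed

lemma expansion_has_derivative:
  assumes "expansion h a"
  shows "(h has_vector_derivative a 1) (at 0)"
proof -
  obtain C where C: "\<And>x. norm (h x - (\<Sum>k<2. x ^ k *\<^sub>R a k)) \<le> C * \<bar>x\<bar> ^ 2"
    using expansionD[OF assms, of 2] by blast
  have "((\<lambda>x. norm (h x - h 0 - x *\<^sub>R a 1) / norm x) \<longlongrightarrow> 0) (at 0)"
  proof (rule Lim_null_comparison)
    show "eventually (\<lambda>x. norm (norm (h x - h 0 - x *\<^sub>R a 1) / norm x) \<le> C * \<bar>x\<bar>) (at 0)"
    proof (rule always_eventually, rule allI)
      fix x :: real
      have "h x - h 0 - x *\<^sub>R a 1 = h x - (\<Sum>k<2. x ^ k *\<^sub>R a k)"
        unfolding expansion_at_0[OF assms] by (simp add: numeral_2_eq_2)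
      then have "norm (h x - h 0 - x *\<^sub>R a 1) \<le> C * \<bar>x\<bar> ^ 2"
        using C[of x] by (simp only:)
      then have "norm (h x - h 0 - x *\<^sub>R a 1) \<le> C * \<bar>x\<bar> * \<bar>x\<bar>"
        by (simp only: power2_eq_square mult.assoc)
      then show "norm (norm (h x - h 0 - x *\<^sub>R a 1) / norm x) \<le> C * \<bar>x\<bar>"
        by (cases "x = 0") (simp_all add: divide_le_eq)
    qed
    have "((\<lambda>x. C * \<bar>x\<bar>) \<longlongrightarrow> C * \<bar>0\<bar>) (at (0::real))"
      by (intro tendsto_intros)
    then show "((\<lambda>x. C * \<bar>x\<bar>) \<longlongrightarrow> 0) (at (0::real))" by simp
  qed
  then show ?thesis
    unfolding has_vector_derivative_def has_derivative_at by (simp add: bounded_linear_scaleR_left diff_diff_eq add.commute)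
qed

lemma expansion_q_deriv:
  assumes "expansion h a"
  shows "expansion (q_deriv q h) (\<lambda>k. ((1 - q ^ Suc k) / (1 - q)) *\<^sub>R a (Suc k))"
  unfolding expansion_def
proof
  fix N
  let ?b = "\<lambda>k. ((1 - q ^ Suc k) / (1 - q)) *\<^sub>R a (Suc k)"
  let ?p = "\<lambda>x. \<Sum>k<Suc N. x ^ k *\<^sub>R a k"
  obtain C where C: "\<And>x. norm (h x - ?p x) \<le> C * \<bar>x\<bar> ^ Suc N"
    using expansionD[OF assms, of "Suc N"] by blast
  have C0: "0 \<le> C" using order_trans[OF norm_ge_zero C[of 1]] by simp
  have "norm (q_deriv q h x - (\<Sum>k<N. x ^ k *\<^sub>R ?b k)) \<le> (2 * C / (1 - q) + norm (a 1)) * \<bar>x\<bar> ^ N" for x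
  proof (cases "x = 0")
    case True
    have "q_deriv q h 0 = a 1"
      using vector_derivative_at[OF expansion_has_derivative[OF assms]] by (simp add: q_deriv_def)
    moreover have "(\<Sum>k<Suc n. 0 ^ k *\<^sub>R ?b k) = a 1" for n
      using q_less_1 by (simp add: sum.lessThan_Suc_shift del: sum.lessThan_Suc)
    moreover have "0 \<le> 2 * C / (1 - q)" using C0 q_less_1 by simp
    ultimately show ?thesis
      using True by (cases N) (simp_all del: sum.lessThan_Suc)
  next
    case False
    have 1: "(\<Sum>k<N. x ^ k *\<^sub>R ?b k) = (1 / ((1 - q) * x)) *\<^sub>R (?p x - ?p (q * x))"
    proof -
      have "?p x - ?p (q * x) = (\<Sum>k<N. x ^ Suc k *\<^sub>R a (Suc k) - (q * x) ^ Suc k *\<^sub>R a (Suc k))"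
        unfolding sum.lessThan_Suc_shift sum_subtractf by simp
      also have "\<dots> = ((1 - q) * x) *\<^sub>R (\<Sum>k<N. x ^ k *\<^sub>R ?b k)"
        unfolding scaleR_sum_right
      proof (rule sum.cong[OF refl])
        fix k
        have "x ^ Suc k *\<^sub>R a (Suc k) - (q * x) ^ Suc k *\<^sub>R a (Suc k) = (x ^ Suc k * (1 - q ^ Suc k)) *\<^sub>R a (Suc k)"
          by (simp only: power_mult_distrib scaleR_diff_left[symmetric]) (simp add: algebra_simps)
        also have "\<dots> = ((1 - q) * x) *\<^sub>R (x ^ k *\<^sub>R ?b k)"
          using q_less_1 by (simp add: mult_ac)
        finally show "x ^ Suc k *\<^sub>R a (Suc k) - (q * x) ^ Suc k *\<^sub>R a (Suc k) = ((1 - q) * x) *\<^sub>R (x ^ k *\<^sub>R ?b k)" .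
      qed
      finally show ?thesis using False q_less_1 by simp
    qed
    have 2: "q_deriv q h x = (1 / ((1 - q) * x)) *\<^sub>R (h x - h (q * x))"
      unfolding q_deriv_nonzero[OF False] using False q_less_1 by simp
    have "q_deriv q h x - (\<Sum>k<N. x ^ k *\<^sub>R ?b k)
        = (1 / ((1 - q) * x)) *\<^sub>R ((h x - ?p x) - (h (q * x) - ?p (q * x)))"
      unfolding 1 2 by (simp only: scaleR_diff_right) simp
    then have "norm (q_deriv q h x - (\<Sum>k<N. x ^ k *\<^sub>R ?b k))
        = 1 / ((1 - q) * \<bar>x\<bar>) * norm ((h x - ?p x) - (h (q * x) - ?p (q * x)))"
      using q_less_1 by (simp add: abs_mult)
    also have "\<dots> \<le> 1 / ((1 - q) * \<bar>x\<bar>) * (2 * C * \<bar>x\<bar> ^ Suc N)"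
    proof (intro mult_left_mono)
      have "\<bar>q * x\<bar> ^ Suc N \<le> \<bar>x\<bar> ^ Suc N"
        using q_pos q_less_1 by (intro power_mono) (auto simp: abs_mult mult_left_le_one_le)
      then have "C * \<bar>q * x\<bar> ^ Suc N \<le> C * \<bar>x\<bar> ^ Suc N" using C0 by (rule mult_left_mono)
      then show "norm ((h x - ?p x) - (h (q * x) - ?p (q * x))) \<le> 2 * C * \<bar>x\<bar> ^ Suc N"
        using C[of x] C[of "q * x"] norm_triangle_ineq4[of "h x - ?p x" "h (q * x) - ?p (q * x)"]
        by linarith
    qed (use q_less_1 in simp)
    also have "\<dots> = 2 * C / (1 - q) * \<bar>x\<bar> ^ N"
      using False q_less_1 by simp
    also have "\<dots> \<le> (2 * C / (1 - q) + norm (a 1)) * \<bar>x\<bar> ^ N"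
      by (intro mult_right_mono) auto
    finally show ?thesis .
  qed
  then show "\<exists>C. \<forall>x. norm (q_deriv q h x - (\<Sum>k<N. x ^ k *\<^sub>R ?b k)) \<le> C * \<bar>x\<bar> ^ N" by blast
qed

end

text \<open>
  A simplified Borel lemma: as no smoothness is asked away from the origin, the truncation order may
  jump with \<open>x\<close>, and no cut-off functions are involved.
\<close>

lemma borel_even_function:
  fixes a :: "nat \<Rightarrow> complex"
  obtains v :: "real \<Rightarrow> complex" where "\<And>x. v (- x) = v x"
    and "\<And>M. \<exists>C. \<forall>x. 0 < \<bar>x\<bar> \<and> \<bar>x\<bar> \<le> 1 \<longrightarrow> norm (v x - (\<Sum>k<M. x ^ (2 * k) *\<^sub>R a k)) \<le> C * \<bar>x\<bar> ^ (2 * M)"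
proof -
  define A where "A n = (\<Sum>k<n. norm (a k))" for n
  have A0: "0 \<le> A n" for n by (simp add: A_def sum_nonneg)
  define S where "S x = {n::nat. real n * \<bar>x\<bar> \<le> 1 \<and> A n * \<bar>x\<bar> \<le> 1}" for x :: real
  define v where "v x = (\<Sum>k<Max (S x). x ^ (2 * k) *\<^sub>R a k)" for x
  let ?d = "\<lambda>M x. v x - (\<Sum>k<M. x ^ (2 * k) *\<^sub>R a k)"
  have fin: "finite (S x)" if "0 < \<bar>x\<bar>" for x
  proof (rule finite_subset)
    show "S x \<subseteq> {..nat \<lceil>1 / \<bar>x\<bar>\<rceil>}"
    proof
      fix n assume "n \<in> S x"
      then have "real n \<le> 1 / \<bar>x\<bar>" using that by (simp add: S_def field_simps)
      then show "n \<in> {..nat \<lceil>1 / \<bar>x\<bar>\<rceil>}" by (simp add: le_nat_iff) linarith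
    qed
  qed simp
  have "0 \<in> S x" for x by (simp add: S_def A_def)
  then have Max: "Max (S x) \<in> S x" if "0 < \<bar>x\<bar>" for x
    using fin[OF that] by (intro Max_in) auto
  have tail: "norm (\<Sum>k=M..<n. x ^ (2 * k) *\<^sub>R a k) \<le> \<bar>x\<bar> ^ (2 * M) * A n" if "\<bar>x\<bar> \<le> 1" for x :: real and M n
  proof -
    have "norm (\<Sum>k=M..<n. x ^ (2 * k) *\<^sub>R a k) \<le> (\<Sum>k=M..<n. \<bar>x\<bar> ^ (2 * M) * norm (a k))"
    proof (rule sum_norm_le)
      fix k assume "k \<in> {M..<n}"
      then have "\<bar>x\<bar> ^ (2 * k) \<le> \<bar>x\<bar> ^ (2 * M)" using that by (intro power_decreasing) auto
      then show "norm (x ^ (2 * k) *\<^sub>R a k) \<le> \<bar>x\<bar> ^ (2 * M) * norm (a k)"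
        by (simp only: norm_scaleR power_abs mult_right_mono norm_ge_zero)
    qed
    also have "\<dots> = \<bar>x\<bar> ^ (2 * M) * (\<Sum>k=M..<n. norm (a k))"
      by (simp only: sum_distrib_left)
    also have "\<dots> \<le> \<bar>x\<bar> ^ (2 * M) * A n"
      unfolding A_def by (intro mult_left_mono sum_mono2) auto
    finally show ?thesis .
  qed
  \<comment> \<open>The number of summands tends to infinity so slowly that one power of \<open>x\<close> absorbs the coefficients.\<close>
  have weak: "\<exists>C. \<forall>x. 0 < \<bar>x\<bar> \<and> \<bar>x\<bar> \<le> 1 \<longrightarrow> norm (?d M x) * \<bar>x\<bar> \<le> C * \<bar>x\<bar> ^ (2 * M)" for M
  proof -
    define D where "D = 1 + real M + A M"
    have D: "1 \<le> D" using A0[of M] by (simp add: D_def)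
    have "norm (?d M x) * \<bar>x\<bar> \<le> (1 + A M) * D ^ (2 * M) * \<bar>x\<bar> ^ (2 * M)" if x: "0 < \<bar>x\<bar>" "\<bar>x\<bar> \<le> 1" for x
    proof (cases "D * \<bar>x\<bar> \<le> 1")
      case True
      have "real M * \<bar>x\<bar> \<le> D * \<bar>x\<bar>" "A M * \<bar>x\<bar> \<le> D * \<bar>x\<bar>"
        using A0[of M] by (auto intro!: mult_right_mono simp: D_def)
      then have "M \<in> S x" using True unfolding S_def by auto
      then have le: "M \<le> Max (S x)" using fin[OF x(1)] by simp
      have "?d M x = (\<Sum>k=M..<Max (S x). x ^ (2 * k) *\<^sub>R a k)"
        unfolding v_def using sum_diff_nat_ivl[of 0 M "Max (S x)" "\<lambda>k. x ^ (2 * k) *\<^sub>R a k"] le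
        by (simp add: atLeast0LessThan)
      then have "norm (?d M x) * \<bar>x\<bar> \<le> \<bar>x\<bar> ^ (2 * M) * A (Max (S x)) * \<bar>x\<bar>"
        using tail[OF x(2)] by (simp add: mult_right_mono)
      also have "\<dots> = \<bar>x\<bar> ^ (2 * M) * (A (Max (S x)) * \<bar>x\<bar>)" by simp
      also have "\<dots> \<le> \<bar>x\<bar> ^ (2 * M) * 1"
        using Max[OF x(1)] by (intro mult_left_mono) (auto simp: S_def)
      also have "\<dots> \<le> \<bar>x\<bar> ^ (2 * M) * ((1 + A M) * D ^ (2 * M))"
      proof (intro mult_left_mono)
        have "1 * 1 \<le> (1 + A M) * D ^ (2 * M)"
          using A0[of M] D by (intro mult_mono one_le_power) auto
        then show "1 \<le> (1 + A M) * D ^ (2 * M)" by simp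
      qed simp
      finally show ?thesis by (simp only: mult_ac)
    next
      case False
      have "norm (v x) \<le> A (Max (S x))"
        using tail[OF x(2), of 0 "Max (S x)"] by (simp add: v_def atLeast0LessThan)
      then have v1: "norm (v x) * \<bar>x\<bar> \<le> 1"
        using Max[OF x(1)] mult_right_mono[of "norm (v x)" "A (Max (S x))" "\<bar>x\<bar>"] by (simp add: S_def)
      have "norm (\<Sum>k<M. x ^ (2 * k) *\<^sub>R a k) \<le> A M"
        using tail[OF x(2), of 0 M] by (simp add: atLeast0LessThan)
      then have p1: "norm (\<Sum>k<M. x ^ (2 * k) *\<^sub>R a k) * \<bar>x\<bar> \<le> A M"
        using x A0[of M] by (meson mult_left_le norm_ge_zero order_trans)
      have "norm (?d M x) * \<bar>x\<bar> \<le> norm (v x) * \<bar>x\<bar> + norm (\<Sum>k<M. x ^ (2 * k) *\<^sub>R a k) * \<bar>x\<bar>"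
        unfolding distrib_right[symmetric] by (intro mult_right_mono norm_triangle_ineq4) simp
      from order_trans[OF this add_mono[OF v1 p1]]
      have "norm (?d M x) * \<bar>x\<bar> \<le> (1 + A M) * 1" by simp
      also have "\<dots> \<le> (1 + A M) * (D * \<bar>x\<bar>) ^ (2 * M)"
        using False A0[of M] by (intro mult_left_mono one_le_power) auto
      finally show ?thesis by (simp only: power_mult_distrib mult.assoc)
    qed
    then show ?thesis by blast
  qed
  have "\<exists>C. \<forall>x. 0 < \<bar>x\<bar> \<and> \<bar>x\<bar> \<le> 1 \<longrightarrow> norm (?d M x) \<le> C * \<bar>x\<bar> ^ (2 * M)" for M
  proof -
    obtain C where C: "\<And>x. 0 < \<bar>x\<bar> \<Longrightarrow> \<bar>x\<bar> \<le> 1 \<Longrightarrow> norm (?d (Suc M) x) * \<bar>x\<bar> \<le> C * \<bar>x\<bar> ^ (2 * Suc M)"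
      using weak[of "Suc M"] by blast
    have "norm (?d (Suc M) 1) \<le> C" using C[of 1] by simp
    then have C0: "0 \<le> C" by (rule order_trans[OF norm_ge_zero])
    have "norm (?d M x) \<le> (norm (a M) + C) * \<bar>x\<bar> ^ (2 * M)" if x: "0 < \<bar>x\<bar>" "\<bar>x\<bar> \<le> 1" for x
    proof -
      have "norm (?d (Suc M) x) * \<bar>x\<bar> \<le> (C * \<bar>x\<bar> ^ (2 * M) * \<bar>x\<bar>) * \<bar>x\<bar>"
        using C[OF x] by (simp add: mult_ac)
      then have "norm (?d (Suc M) x) \<le> C * \<bar>x\<bar> ^ (2 * M) * \<bar>x\<bar>"
        using x(1) by (rule mult_right_le_imp_le)
      also have "\<dots> \<le> C * \<bar>x\<bar> ^ (2 * M)"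
        using x(2) C0 by (intro mult_left_le) auto
      finally have 1: "norm (?d (Suc M) x) \<le> C * \<bar>x\<bar> ^ (2 * M)" .
      have "?d M x = ?d (Suc M) x + x ^ (2 * M) *\<^sub>R a M" by simp
      then have "norm (?d M x) \<le> norm (?d (Suc M) x) + norm (x ^ (2 * M) *\<^sub>R a M)"
        by (simp only: norm_triangle_ineq)
      also have "norm (x ^ (2 * M) *\<^sub>R a M) = norm (a M) * \<bar>x\<bar> ^ (2 * M)"
        by (simp only: norm_scaleR power_abs mult.commute)
      finally show ?thesis using 1 unfolding distrib_right by linarith
    qed
    then show ?thesis by blast
  qed
  moreover have "v (- x) = v x" for x by (simp add: v_def S_def)
  ultimately show thesis using that by blast
qed

context q_base
begin

lemma decay_q_deriv:
  assumes h: "\<And>m. \<exists>B. \<forall>x. (1 + x\<^sup>2) ^ m * norm (h x) \<le> B"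
    and B: "\<And>x. norm (q_deriv q h x) \<le> B"
  shows "\<exists>B. \<forall>x. (1 + x\<^sup>2) ^ m * norm (q_deriv q h x) \<le> B"
proof -
  obtain D where D: "\<And>x. (1 + x\<^sup>2) ^ m * norm (h x) \<le> D"
    using h[of m] by blast
  have D0: "0 \<le> D" using D[of 0] order_trans[OF norm_ge_zero] by force
  have B0: "0 \<le> B" using order_trans[OF norm_ge_zero B] .
  define K where "K = (D + inverse p ^ m * D) / (1 - q)"
  have K0: "0 \<le> K" using D0 q_less_1 by (simp add: K_def)
  have "(1 + x\<^sup>2) ^ m * norm (q_deriv q h x) \<le> 2 ^ m * B + K" for x
  proof (cases "\<bar>x\<bar> \<le> 1")
    case True
    then have "x\<^sup>2 \<le> 1" by (simp add: abs_square_le_1)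
    then have "(1 + x\<^sup>2) ^ m \<le> 2 ^ m" by (intro power_mono) auto
    then have "(1 + x\<^sup>2) ^ m * norm (q_deriv q h x) \<le> 2 ^ m * B"
      using B[of x] by (intro mult_mono) auto
    then show ?thesis using K0 by simp
  next
    case False
    then have x: "x \<noteq> 0" by auto
    have "(1 - q) * 1 * norm (q_deriv q h x) \<le> (1 - q) * \<bar>x\<bar> * norm (q_deriv q h x)"
      using False q_less_1 by (intro mult_right_mono mult_left_mono) auto
    also have "\<dots> = norm (h x - h (q * x))"
      unfolding q_deriv_nonzero[OF x] using q_less_1 by (simp add: abs_mult)
    also have "\<dots> \<le> norm (h x) + norm (h (q * x))" by (rule norm_triangle_ineq4)
    finally have 1: "(1 - q) * norm (q_deriv q h x) \<le> norm (h x) + norm (h (q * x))" by simp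
    have "inverse p * (1 + (q * x)\<^sup>2) = inverse p + x\<^sup>2"
      using q_pos by (simp add: power_mult_distrib field_simps)
    moreover have "1 \<le> inverse p" using qq_less_1 qq_pos by (simp add: one_le_inverse)
    ultimately have "1 + x\<^sup>2 \<le> inverse p * (1 + (q * x)\<^sup>2)" by linarith
    then have "(1 + x\<^sup>2) ^ m \<le> inverse p ^ m * (1 + (q * x)\<^sup>2) ^ m"
      unfolding power_mult_distrib[symmetric] by (intro power_mono) auto
    then have "(1 + x\<^sup>2) ^ m * norm (h (q * x)) \<le> inverse p ^ m * (1 + (q * x)\<^sup>2) ^ m * norm (h (q * x))"
      by (intro mult_right_mono) auto
    also have "\<dots> = inverse p ^ m * ((1 + (q * x)\<^sup>2) ^ m * norm (h (q * x)))" by simp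
    also have "\<dots> \<le> inverse p ^ m * D"
      using D[of "q * x"] by (intro mult_left_mono) auto
    finally have 2: "(1 + x\<^sup>2) ^ m * norm (h (q * x)) \<le> inverse p ^ m * D" .
    have "(1 + x\<^sup>2) ^ m * ((1 - q) * norm (q_deriv q h x)) \<le> (1 + x\<^sup>2) ^ m * (norm (h x) + norm (h (q * x)))"
      using 1 by (intro mult_left_mono) auto
    also have "\<dots> \<le> D + inverse p ^ m * D"
      using 2 D[of x] by (simp add: distrib_left)
    finally have "(1 + x\<^sup>2) ^ m * norm (q_deriv q h x) \<le> K"
      unfolding K_def using q_less_1 by (simp add: pos_le_divide_eq mult_ac)
    then show ?thesis using B0 by (simp add: add_increasing)
  qed
  then show ?thesis by blast
qed

lemma expansion_in_schwartz_line:
  assumes even: "\<And>x. h (- x) = h x" and e: "expansion h a"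
    and d: "\<And>m. \<exists>B. \<forall>x. (1 + x\<^sup>2) ^ m * norm (h x) \<le> B"
  shows "h \<in> q_schwartz_line q"
proof -
  have *: "(\<exists>a. expansion ((q_deriv q ^^ k) h) a) \<and> (\<forall>m. \<exists>B. \<forall>x. (1 + x\<^sup>2) ^ m * norm ((q_deriv q ^^ k) h x) \<le> B)" for k
  proof (induction k)
    case 0
    then show ?case using e d by auto
  next
    case (Suc k)
    let ?h = "(q_deriv q ^^ k) h"
    obtain b where b: "expansion (q_deriv q ?h) b"
      using Suc expansion_q_deriv by blast
    obtain B where "\<And>x. norm (q_deriv q ?h x) \<le> B"
      using expansionD[OF b, of 0] by auto
    then have "\<exists>B. \<forall>x. (1 + x\<^sup>2) ^ m * norm (q_deriv q ?h x) \<le> B" for m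
      using decay_q_deriv Suc by blast
    then show ?case using b by auto
  qed
  have "q_smooth q h"
    unfolding q_smooth_def
    using * expansion_has_derivative has_vector_derivative_def differentiable_def by metis
  moreover have "bdd_above {cmod (of_real ((1 + x\<^sup>2) ^ m) * (q_deriv q ^^ k) h x) | x k. k \<le> n}" for n m
  proof -
    have "\<forall>k. \<exists>B. \<forall>x. (1 + x\<^sup>2) ^ m * norm ((q_deriv q ^^ k) h x) \<le> B" using * by blast
    then obtain B where B: "\<And>k x. (1 + x\<^sup>2) ^ m * norm ((q_deriv q ^^ k) h x) \<le> B k" by metis
    have "cmod (of_real ((1 + x\<^sup>2) ^ m) * (q_deriv q ^^ k) h x) \<le> (\<Sum>k\<le>n. \<bar>B k\<bar>)" if "k \<le> n" for x k
    proof -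
      have "0 \<le> 1 + x\<^sup>2" by (simp add: add_nonneg_nonneg)
      then have "cmod (of_real ((1 + x\<^sup>2) ^ m) * (q_deriv q ^^ k) h x) \<le> B k"
        unfolding norm_mult norm_of_real using B by (simp only: abs_of_nonneg zero_le_power)
      also have "\<dots> \<le> \<bar>B k\<bar>" by simp
      also have "\<dots> \<le> (\<Sum>k\<le>n. \<bar>B k\<bar>)"
        using that by (intro member_le_sum) auto
      finally show ?thesis .
    qed
    then show ?thesis unfolding bdd_above_def by blast
  qed
  ultimately show ?thesis unfolding q_schwartz_line_def using even by simp
qed

text \<open>
  Off the lattice the extension is a Borel sum of the expansion: only its order of contact with
  the lattice values at the origin matters, since nothing is required of it elsewhere but a bound.
\<close>

lemma even_ext_in_schwartz:
  assumes u: "rapid u" and e: "\<And>N. even_expansion u a N" and u0: "u 0 = a 0"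
  shows "even_ext q u \<in> q_schwartz q"
proof -
  obtain v :: "real \<Rightarrow> complex" where v_even: "\<And>x. v (- x) = v x"
    and v: "\<And>M. \<exists>C. \<forall>x. 0 < \<bar>x\<bar> \<and> \<bar>x\<bar> \<le> 1 \<longrightarrow> norm (v x - (\<Sum>k<M. x ^ (2 * k) *\<^sub>R a k)) \<le> C * \<bar>x\<bar> ^ (2 * M)"
    using borel_even_function[of a] by blast
  define h where "h x = (if x \<in> Rq q then u \<bar>x\<bar> else if \<bar>x\<bar> \<le> 1 then v x else 0)" for x
  define a' where "a' k = (if even k then a (k div 2) else 0)" for k
  have poly: "(\<Sum>k<2 * M. x ^ k *\<^sub>R a' k) = (\<Sum>j<M. x ^ (2 * j) *\<^sub>R a j)" for x :: real and M
    unfolding sum_even_odd by (simp add: a'_def)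
  have even: "h (- x) = h x" for x
    unfolding h_def Rq_abs by (simp add: v_even)
  have near: "\<exists>C. \<forall>x. \<bar>x\<bar> \<le> 1 \<longrightarrow> norm (h x - (\<Sum>j<Suc N. x ^ (2 * j) *\<^sub>R a j)) \<le> C * \<bar>x\<bar> ^ (2 * Suc N)" for N
  proof -
    obtain C where C: "\<And>x. x \<in> L \<Longrightarrow> norm (u x - (\<Sum>k<Suc N. x ^ (2 * k) *\<^sub>R a k)) \<le> C * x ^ (2 * Suc N)"
      using e[of "Suc N"] unfolding even_expansion_def power_bound_def by (metis L_even_power)
    obtain D where D: "\<And>x. 0 < \<bar>x\<bar> \<Longrightarrow> \<bar>x\<bar> \<le> 1 \<Longrightarrow> norm (v x - (\<Sum>k<Suc N. x ^ (2 * k) *\<^sub>R a k)) \<le> D * \<bar>x\<bar> ^ (2 * Suc N)"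
      using v[of "Suc N"] by blast
    have C0: "0 \<le> C" using order_trans[OF norm_ge_zero C[OF L_1]] by simp
    have D0: "0 \<le> D" using order_trans[OF norm_ge_zero D[of 1]] by simp
    have "norm (h x - (\<Sum>j<Suc N. x ^ (2 * j) *\<^sub>R a j)) \<le> (C + D) * \<bar>x\<bar> ^ (2 * Suc N)" if x: "\<bar>x\<bar> \<le> 1" for x
    proof (cases "x = 0")
      case True
      have "h 0 = a 0" using u0 by (simp add: h_def Rq_def)
      then show ?thesis using True by (simp add: sum.lessThan_Suc_shift del: sum.lessThan_Suc)
    next
      case False
      have "norm (h x - (\<Sum>j<Suc N. x ^ (2 * j) *\<^sub>R a j)) \<le> max C D * \<bar>x\<bar> ^ (2 * Suc N)"
      proof (cases "x \<in> Rq q")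
        case True
        then have "\<bar>x\<bar> \<in> L" using False unfolding Rq_abs by simp
        from C[OF this] have "norm (h x - (\<Sum>j<Suc N. x ^ (2 * j) *\<^sub>R a j)) \<le> C * \<bar>x\<bar> ^ (2 * Suc N)"
          using True unfolding h_def by (simp only: if_True power_even_abs even_mult_iff even_numeral simp_thms)
        also have "\<dots> \<le> max C D * \<bar>x\<bar> ^ (2 * Suc N)" by (intro mult_right_mono) auto
        finally show ?thesis .
      next
        case x': False
        from D[OF _ x] have "norm (h x - (\<Sum>j<Suc N. x ^ (2 * j) *\<^sub>R a j)) \<le> D * \<bar>x\<bar> ^ (2 * Suc N)"
          using x' x False unfolding h_def by simp
        also have "\<dots> \<le> max C D * \<bar>x\<bar> ^ (2 * Suc N)" by (intro mult_right_mono) auto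
        finally show ?thesis .
      qed
      also have "\<dots> \<le> (C + D) * \<bar>x\<bar> ^ (2 * Suc N)"
        using C0 D0 by (intro mult_right_mono) auto
      finally show ?thesis .
    qed
    then show ?thesis by blast
  qed
  obtain B where B: "\<And>x. \<bar>x\<bar> \<le> 1 \<Longrightarrow> norm (h x) \<le> B"
  proof -
    obtain C where C: "\<And>x. \<bar>x\<bar> \<le> 1 \<Longrightarrow> norm (h x - a 0) \<le> C * \<bar>x\<bar> ^ 2"
      using near[of 0] by auto
    have C0: "0 \<le> C" using order_trans[OF norm_ge_zero C[of 1]] by simp
    have "norm (h x) \<le> C + norm (a 0)" if "\<bar>x\<bar> \<le> 1" for x
    proof -
      have "C * \<bar>x\<bar> ^ 2 \<le> C * 1"
        using C0 that by (intro mult_left_mono) (auto simp: abs_square_le_1)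
      then show ?thesis
        using C[OF that] norm_triangle_ineq2[of "h x" "a 0"] by linarith
    qed
    then show thesis using that by blast
  qed
  have decay: "\<exists>B. \<forall>x. (1 + x\<^sup>2) ^ m * norm (h x) \<le> B" for m
  proof -
    obtain C where C: "\<And>x. x \<in> L \<Longrightarrow> norm (u x) \<le> C * x powr (- real (2 * m))"
      using rapidD[OF u, of "real (2 * m)"] unfolding power_bound_def by auto
    have B0: "0 \<le> B" using order_trans[OF norm_ge_zero B[of 0]] by simp
    have C0: "0 \<le> C" using order_trans[OF norm_ge_zero C[OF L_1]] by simp
    have "(1 + x\<^sup>2) ^ m * norm (h x) \<le> 2 ^ m * (B + C)" for x
    proof (cases "\<bar>x\<bar> \<le> 1")
      case True
      then have "x\<^sup>2 \<le> 1" by (simp add: abs_square_le_1)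
      then show ?thesis
        using B[OF True] C0 by (intro mult_mono power_mono) auto
    next
      case False
      have bound: "norm (h x) * (x\<^sup>2) ^ m \<le> B + C"
      proof (cases "x \<in> Rq q")
        case True
        then have xL: "\<bar>x\<bar> \<in> L" using False unfolding Rq_abs by auto
        have "norm (h x) \<le> C * \<bar>x\<bar> powr (- real (2 * m))"
          using C[OF xL] True by (simp add: h_def)
        also have "\<bar>x\<bar> powr (- real (2 * m)) = inverse ((x\<^sup>2) ^ m)"
          using L_pos[OF xL] by (simp only: powr_minus powr_realpow) (simp add: power_mult)
        finally have "norm (h x) \<le> C * inverse ((x\<^sup>2) ^ m)" .
        then have "norm (h x) * (x\<^sup>2) ^ m \<le> C"
          using L_pos[OF xL] by (simp add: field_simps)
        then show ?thesis using B0 by simp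
      qed (use False B0 C0 in \<open>simp add: h_def\<close>)
      have "(1 + x\<^sup>2) ^ m \<le> 2 ^ m * (x\<^sup>2) ^ m"
      proof -
        have "1 \<le> x\<^sup>2" using False by (metis abs_square_le_1 linear)
        then show ?thesis unfolding power_mult_distrib[symmetric] by (intro power_mono) auto
      qed
      then have "(1 + x\<^sup>2) ^ m * norm (h x) \<le> 2 ^ m * (x\<^sup>2) ^ m * norm (h x)"
        by (rule mult_right_mono) simp
      also have "\<dots> = 2 ^ m * (norm (h x) * (x\<^sup>2) ^ m)"
        by (simp only: mult_ac)
      also have "\<dots> \<le> 2 ^ m * (B + C)"
        using bound by (rule mult_left_mono) simp
      finally show ?thesis .
    qed
    then show ?thesis by blast
  qed
  have "expansion h a'"
  proof -
    obtain B' where "\<And>x. norm (h x) \<le> B'" using decay[of 0] by auto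
    then show ?thesis
    proof (rule expansion_if_near_0)
      fix N
      obtain C where C: "\<And>x. \<bar>x\<bar> \<le> 1 \<Longrightarrow> norm (h x - (\<Sum>k<2 * Suc N. x ^ k *\<^sub>R a' k)) \<le> C * \<bar>x\<bar> ^ (2 * Suc N)"
        using near[of N] unfolding poly by blast
      have C0: "0 \<le> C" using order_trans[OF norm_ge_zero C[of 1]] by simp
      have "norm (h x - (\<Sum>k<2 * Suc N. x ^ k *\<^sub>R a' k)) \<le> C * \<bar>x\<bar> ^ N" if "\<bar>x\<bar> \<le> 1" for x
      proof -
        have "C * \<bar>x\<bar> ^ (2 * Suc N) \<le> C * \<bar>x\<bar> ^ N"
          using C0 that by (intro mult_left_mono power_decreasing) auto
        then show ?thesis using C[OF that] by linarith
      qed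
      moreover have "N \<le> 2 * Suc N" by simp
      ultimately show "\<exists>M\<ge>N. \<exists>C. \<forall>x. \<bar>x\<bar> \<le> 1 \<longrightarrow> norm (h x - (\<Sum>k<M. x ^ k *\<^sub>R a' k)) \<le> C * \<bar>x\<bar> ^ N"
        by blast
    qed
  qed
  then have "h \<in> q_schwartz_line q"
    using expansion_in_schwartz_line even decay by blast
  moreover have "even_ext q u = restrict h (Rq q)"
    unfolding even_ext_def h_def by (rule restrict_ext) simp
  ultimately show ?thesis unfolding q_schwartz_def by blast
qed

end

section \<open>The q-binomial theorem\<close>

definition qbinomial_series :: "real \<Rightarrow> real \<Rightarrow> real \<Rightarrow> real" where
  "qbinomial_series q a z = (\<Sum>n. qpoch a (q\<^sup>2) n / qpoch (q\<^sup>2) (q\<^sup>2) n * z ^ n)"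

context q_base
begin

lemma summable_qbinomial:
  assumes "\<bar>z\<bar> < 1"
  shows "summable (\<lambda>n. \<bar>qpoch a p n / qpoch p p n * z ^ n\<bar>)"
proof (rule summable_ratio_limit)
  let ?r = "\<lambda>n. (1 - a * p ^ n) / (1 - p ^ Suc n) * z"
  show "qpoch a p (Suc n) / qpoch p p (Suc n) * z ^ Suc n
      = ?r n * (qpoch a p n / qpoch p p n * z ^ n)" for n
    unfolding qpoch_Suc by simp
  have "?r \<longlonglongrightarrow> (1 - a * 0) / (1 - 0) * z"
    by (intro tendsto_intros qq_tendsto LIMSEQ_Suc[OF qq_tendsto]) auto
  then show "?r \<longlonglongrightarrow> z" by simp
qed fact

lemma qbinomial_sums:
  assumes "\<bar>z\<bar> < 1"
  shows "(\<lambda>n. qpoch a p n / qpoch p p n * z ^ n) sums qbinomial_series q a z"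
  unfolding qbinomial_series_def
  by (rule summable_sums[OF summable_rabs_cancel[OF summable_qbinomial[OF assms]]])

lemma qbinomial_step:
  assumes z: "\<bar>z\<bar> < 1"
  shows "(1 - z) * qbinomial_series q a z = (1 - a * z) * qbinomial_series q a (p * z)"
proof -
  let ?d = "\<lambda>n. qpoch a p n / qpoch p p n"
  let ?G = "qbinomial_series q a"
  have "p * \<bar>z\<bar> \<le> 1 * \<bar>z\<bar>" using qq_less_1 by (intro mult_right_mono) auto
  then have qz: "\<bar>q\<^sup>2 * z\<bar> < 1" using z by (simp add: abs_mult)
  have d: "?d (Suc n) * (1 - p ^ Suc n) = ?d n * (1 - a * p ^ n)" for n
  proof -
    have "u * v / (w * x) * w = v / x * u" if "w \<noteq> 0" for u v w x :: real
      using that by simp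
    moreover have "qpoch p p (Suc n) = (1 - p ^ Suc n) * qpoch p p n"
      by (simp add: qpoch_Suc)
    ultimately show ?thesis
      using one_minus_qq_power[of n] unfolding qpoch_Suc[of a] by (metis less_irrefl)
  qed
  have "(\<lambda>n. ?d n * z ^ n - ?d n * (p * z) ^ n) sums (?G z - ?G (p * z))"
    by (intro sums_diff qbinomial_sums z qz)
  moreover have "(\<lambda>n. ?d n * z ^ n - ?d n * (p * z) ^ n) = (\<lambda>n. ?d n * (1 - p ^ n) * z ^ n)"
    by (simp add: power_mult_distrib algebra_simps diff_divide_distrib)
  ultimately have "(\<lambda>n. ?d (Suc n) * (1 - p ^ Suc n) * z ^ Suc n) sums (?G z - ?G (p * z))"
    using sums_Suc_iff[of "\<lambda>n. ?d n * (1 - p ^ n) * z ^ n"] by simp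
  moreover have "?d (Suc n) * (1 - p ^ Suc n) * z ^ Suc n
      = z * (?d n * z ^ n) - a * z * (?d n * (p * z) ^ n)" for n
    unfolding d by (simp add: power_mult_distrib algebra_simps diff_divide_distrib)
  moreover have "(\<lambda>n. z * (?d n * z ^ n) - a * z * (?d n * (p * z) ^ n)) sums (z * ?G z - a * z * ?G (p * z))"
    by (intro sums_diff sums_mult qbinomial_sums z qz)
  ultimately have "?G z - ?G (p * z) = z * ?G z - a * z * ?G (p * z)"
    by (simp add: sums_unique2)
  then show ?thesis by (simp add: algebra_simps)
qed

lemma qbinomial_power:
  assumes z: "\<bar>z\<bar> < 1"
  shows "qpoch z p n * qbinomial_series q a z = qpoch (a * z) p n * qbinomial_series q a (z * p ^ n)"
proof (induction n)
  case (Suc n)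
  have "\<bar>z\<bar> * p ^ n \<le> \<bar>z\<bar> * 1"
    using qq_pos qq_less_1 q_pos q_less_1 by (intro mult_left_mono power_le_one) auto
  then have "\<bar>z * p ^ n\<bar> < 1" using z by (simp add: abs_mult)
  from qbinomial_step[OF this, of a]
  have "(1 - z * p ^ n) * qbinomial_series q a (z * p ^ n)
      = (1 - a * z * p ^ n) * qbinomial_series q a (z * p ^ Suc n)"
    by (simp add: mult_ac)
  then show ?case
    unfolding qpoch_Suc using Suc.IH by (metis mult.assoc mult.left_commute)
qed simp

text \<open>
  Both sides satisfy the same first-order \<open>q\<^sup>2\<close>-difference equation; iterating it moves the argument to
  the origin, where the series equals \<open>1\<close>.
\<close>

theorem qbinomial_theorem:
  assumes z: "\<bar>z\<bar> < 1"
  shows "euler_series q z * qbinomial_series q a z = euler_series q (a * z)"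
proof -
  let ?d = "\<lambda>n. qpoch a p n / qpoch p p n"
  have "isCont (qbinomial_series q a) 0"
    unfolding qbinomial_series_def
    by (rule isCont_powser[where K = "1 / 2"])
      (use summable_qbinomial[of "1 / 2" a] summable_rabs_cancel in auto)
  moreover have "(\<lambda>n. z * p ^ n) \<longlonglongrightarrow> 0"
    using tendsto_mult_right_zero[OF qq_tendsto] by simp
  ultimately have "(\<lambda>n. qbinomial_series q a (z * p ^ n)) \<longlonglongrightarrow> qbinomial_series q a 0"
    using isCont_tendsto_compose by blast
  moreover have "qbinomial_series q a 0 = 1"
    using powser_zero[of ?d] by (simp add: qbinomial_series_def)
  ultimately have "(\<lambda>n. qpoch (a * z) p n * qbinomial_series q a (z * p ^ n)) \<longlonglongrightarrow> euler_series q (a * z) * 1"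
    by (intro tendsto_mult qpoch_tendsto_euler) simp
  then have "(\<lambda>n. qpoch z p n * qbinomial_series q a z) \<longlonglongrightarrow> euler_series q (a * z)"
    unfolding qbinomial_power[OF z] by simp
  moreover have "(\<lambda>n. qpoch z p n * qbinomial_series q a z) \<longlonglongrightarrow> euler_series q z * qbinomial_series q a z"
    by (intro tendsto_intros qpoch_tendsto_euler)
  ultimately show ?thesis using LIMSEQ_unique by blast
qed

lemma euler_series_near_1:
  assumes "\<bar>z\<bar> \<le> 1"
  shows "\<bar>euler_series q z - 1\<bar> \<le> (\<Sum>n. \<bar>euler_coeff q (Suc n)\<bar>) * \<bar>z\<bar>"
proof -
  have s1: "summable (\<lambda>n. \<bar>euler_coeff q (Suc n)\<bar>)"
    using summable_euler[of 1] by (subst summable_Suc_iff) simp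
  have s2: "summable (\<lambda>n. \<bar>euler_coeff q (Suc n) * z ^ Suc n\<bar>)"
    using summable_euler[of z] summable_Suc_iff[of "\<lambda>n. \<bar>euler_coeff q n * z ^ n\<bar>"] by simp
  have "(\<lambda>n. euler_coeff q (Suc n) * z ^ Suc n) sums (euler_series q z - 1)"
    using euler_sums[of z] sums_Suc_iff[of "\<lambda>n. euler_coeff q n * z ^ n"] by (simp add: euler_coeff_0)
  then have "\<bar>euler_series q z - 1\<bar> \<le> (\<Sum>n. \<bar>euler_coeff q (Suc n) * z ^ Suc n\<bar>)"
    using summable_rabs[OF s2] by (simp add: sums_iff)
  also have "\<dots> \<le> (\<Sum>n. \<bar>euler_coeff q (Suc n)\<bar> * \<bar>z\<bar>)"
  proof (rule suminf_le[OF _ s2 summable_mult2[OF s1]])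
    fix n
    have "\<bar>z\<bar> * \<bar>z\<bar> ^ n \<le> \<bar>z\<bar> * 1"
      using assms by (intro mult_left_mono power_le_one) auto
    then have "\<bar>euler_coeff q (Suc n)\<bar> * (\<bar>z\<bar> * \<bar>z\<bar> ^ n) \<le> \<bar>euler_coeff q (Suc n)\<bar> * \<bar>z\<bar>"
      by (intro mult_left_mono) auto
    then show "\<bar>euler_coeff q (Suc n) * z ^ Suc n\<bar> \<le> \<bar>euler_coeff q (Suc n)\<bar> * \<bar>z\<bar>"
      by (simp add: abs_mult power_abs)
  qed
  also have "\<dots> = (\<Sum>n. \<bar>euler_coeff q (Suc n)\<bar>) * \<bar>z\<bar>"
    by (rule suminf_mult2[OF s1, symmetric])
  finally show ?thesis .
qed

lemma L_infsum_causal: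
  fixes f :: "real \<Rightarrow> real"
  assumes "\<And>u. u \<in> L \<Longrightarrow> 1 < u \<Longrightarrow> f u = 0"
  shows "(\<Sum>\<^sub>\<infinity>u\<in>L. f u) = (\<Sum>\<^sub>\<infinity>n. f (q ^ n))"
proof -
  have "(\<Sum>\<^sub>\<infinity>u\<in>L. f u) = (\<Sum>\<^sub>\<infinity>u\<in>range (\<lambda>n::nat. q ^ n). f u)"
  proof (rule infsum_cong_neutral)
    fix u assume u: "u \<in> L - range (\<lambda>n::nat. q ^ n)"
    then have "u \<in> L" by simp
    then show "f u = 0"
    proof (cases rule: L_cases)
      case (small n)
      then show ?thesis using u by simp
    next
      case (large n)
      have "n \<noteq> 0"
      proof
        assume "n = 0"
        then have "u = q ^ 0" using large by simp
        then show False using u by blast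
      qed
      then have "q ^ n < 1" using q_pos q_less_1 by (simp add: power_less_one_iff)
      then have "1 < u" unfolding large using q_pos by (simp add: one_less_inverse)
      then show ?thesis using assms \<open>u \<in> L\<close> by simp
    qed
  qed (use L_power in auto)
  also have "\<dots> = (\<Sum>\<^sub>\<infinity>n. f (q ^ n))"
    by (simp add: infsum_reindex[OF inj_q_power] o_def)
  finally show ?thesis .
qed

end

lemma (in q_bessel_fn) J_series:
  "summable (\<lambda>k. \<bar>J_coeff k * y ^ (2 * k)\<bar>)" "(\<lambda>k. J_coeff k * y ^ (2 * k)) sums J y"
proof -
  have e: "J_coeff k * y ^ (2 * k) = bessel_coeff q (q powr (2 * \<beta> + 2)) k * (((1 - q) * y)\<^sup>2) ^ k" for k
    unfolding J_coeff_def by (simp add: power_mult_distrib power_mult[symmetric])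
  show "summable (\<lambda>k. \<bar>J_coeff k * y ^ (2 * k)\<bar>)"
    unfolding e by (rule summable_bessel)
  show "(\<lambda>k. J_coeff k * y ^ (2 * k)) sums J y"
    unfolding e J_eq by (rule bessel_sums)
qed

section \<open>The q-Weyl transform\<close>

text \<open>
  The kernel depends on \<open>x\<close> and \<open>t\<close> only through \<open>u = x / t\<close>. It vanishes for \<open>u > 1\<close> on the lattice,
  so that the integral from \<open>q x\<close> to infinity is an integral over all of the lattice.
\<close>

definition weyl_kernel :: "real \<Rightarrow> real \<Rightarrow> real \<Rightarrow> real" where
  "weyl_kernel q \<alpha> u = euler_series q (q\<^sup>2 * u\<^sup>2) / euler_series q (q powr (2 * \<alpha> + 1) * u\<^sup>2)"

definition weyl_const :: "real \<Rightarrow> real \<Rightarrow> real" where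
  "weyl_const q \<alpha> = q * (1 + inverse q) powr (- \<alpha> + 1/2) / qGamma (q\<^sup>2) (\<alpha> + 1/2)"

locale q_weyl_transform = q_base +
  fixes \<alpha> :: real
  assumes alpha: "- 1/2 < \<alpha>" and one_minus_q_in_L: "1 - q \<in> Rq_pos q"
begin

sublocale Bes: q_bessel_fn q \<alpha>
  by unfold_locales (use alpha one_minus_q_in_L in auto)

sublocale Cos: q_bessel_fn q "- 1/2"
  by unfold_locales (use one_minus_q_in_L in auto)

abbreviation "A \<equiv> q powr (2 * \<alpha> + 1)"
abbreviation "w \<equiv> weyl_kernel q \<alpha>"

lemma A_pos: "0 < A" and A_less_1: "A < 1"
  using q_pos q_less_1 alpha by (simp_all add: powr01_less_one)

lemma Aq: "A * q < 1"
  using mult_strict_mono[of A 1 q 1] A_less_1 q_less_1 q_pos by simp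

lemma w_0: "w 0 = 1"
proof -
  have "euler_series q 0 = 1"
    using powser_zero[of "euler_coeff q"] by (simp add: euler_series_def euler_coeff_0)
  then show ?thesis by (simp add: weyl_kernel_def)
qed

lemma w_power: "w (q ^ n) = euler_series q p / euler_series q A * (qpoch A p n / qpoch p p n)"
proof -
  have "(q ^ n)\<^sup>2 = p ^ n" by (simp add: power_mult[symmetric] mult.commute)
  moreover have "0 < qpoch A p n"
    using A_less_1 qq_pos qq_less_1 by (intro qpoch_pos) auto
  moreover have "0 < euler_series q A" by (rule euler_series_pos[OF A_less_1])
  ultimately show ?thesis
    unfolding weyl_kernel_def euler_series_power[of "p" n] euler_series_power[of A n]
    using qq_poch_pos[of n] by simp
qed

lemma w_eq_0: "w (inverse (q ^ Suc n)) = 0"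
proof -
  have "p * (inverse (q ^ Suc n))\<^sup>2 = inverse (p ^ n)"
    using q_pos by (simp add: power_mult_distrib power_inverse power_mult[symmetric] mult.commute[of 2])
  then show ?thesis by (simp add: weyl_kernel_def euler_series_eq_0)
qed

lemma w_causal:
  assumes "u \<in> L" "1 < u"
  shows "w u = 0"
  using assms(1)
proof (cases rule: L_cases)
  case (small n)
  then have "u \<le> 1" using q_pos q_less_1 by (simp add: power_le_one)
  then show ?thesis using assms(2) by simp
next
  case (large n)
  then show ?thesis using assms(2) w_eq_0 by (cases n) auto
qed

lemma w_near_1: "power_bound (\<lambda>u. w u - 1) 2"
proof -
  define M where "M = (\<Sum>n. \<bar>euler_coeff q (Suc n)\<bar>)"
  have M0: "0 \<le> M"
    unfolding M_def using summable_euler[of 1] by (intro suminf_nonneg) (subst summable_Suc_iff, simp_all)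
  define E where "E = euler_series q A"
  have E0: "0 < E" unfolding E_def by (rule euler_series_pos[OF A_less_1])
  have "\<bar>w u - 1\<bar> \<le> max 1 (2 * M / E) * u\<^sup>2" if u: "u \<in> L" for u
  proof (cases "u \<le> 1")
    case False
    then have "1 \<le> u\<^sup>2" by simp
    have "\<bar>w u - 1\<bar> = 1 * 1" using w_causal[OF u] False by simp
    also have "\<dots> \<le> max 1 (2 * M / E) * u\<^sup>2"
      using \<open>1 \<le> u\<^sup>2\<close> by (intro mult_mono) auto
    finally show ?thesis .
  next
    case True
    have u0: "0 < u" using L_pos[OF u] .
    have u2: "u\<^sup>2 \<le> 1" using True u0 by (simp add: power_le_one)
    obtain n where n: "u = q ^ n"
      using u
    proof (cases rule: L_cases)
      case (large n)
      have "q ^ n \<le> 1" using q_pos q_less_1 by (simp add: power_le_one)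
      then have "1 \<le> u" unfolding large using q_pos by (simp add: one_le_inverse)
      then show thesis using True that[of 0] by simp
    qed (use that in blast)
    have Au: "\<bar>A * u\<^sup>2\<bar> \<le> 1 * u\<^sup>2" and qu: "\<bar>q\<^sup>2 * u\<^sup>2\<bar> \<le> 1 * u\<^sup>2"
      using A_pos A_less_1 qq_pos qq_less_1 unfolding abs_mult abs_power2
      by (intro mult_right_mono; simp)+
    have lower: "E \<le> euler_series q (A * u\<^sup>2)"
    proof -
      have "0 < qpoch A p n"
        using A_less_1 qq_pos qq_less_1 by (intro qpoch_pos) auto
      moreover have "qpoch A p n \<le> 1"
        unfolding qpoch_def using A_pos A_less_1 qq_pos qq_less_1 q_pos q_less_1
        by (intro prod_le_1) (auto intro!: mult_le_one power_le_one)
      moreover have "A * p ^ n = A * u\<^sup>2"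
        unfolding n by (simp add: power_mult[symmetric] mult.commute)
      then have E: "E = qpoch A p n * euler_series q (A * u\<^sup>2)"
        unfolding E_def using euler_series_power[of A n] by (simp only:)
      ultimately have "0 < euler_series q (A * u\<^sup>2)" using E0 by (simp add: zero_less_mult_iff)
      then show ?thesis
        unfolding E using \<open>qpoch A p n \<le> 1\<close> \<open>0 < qpoch A p n\<close> by (simp add: mult_left_le_one_le)
    qed
    have "\<bar>euler_series q (p * u\<^sup>2) - 1\<bar> \<le> M * u\<^sup>2"
      using euler_series_near_1[of "p * u\<^sup>2"] qu u2 mult_left_mono[OF qu M0] by (simp add: M_def)
    moreover have "\<bar>euler_series q (A * u\<^sup>2) - 1\<bar> \<le> M * u\<^sup>2"
      using euler_series_near_1[of "A * u\<^sup>2"] Au u2 mult_left_mono[OF Au M0] by (simp add: M_def)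
    ultimately have num: "\<bar>euler_series q (p * u\<^sup>2) - euler_series q (A * u\<^sup>2)\<bar> \<le> 2 * M * u\<^sup>2"
      by linarith
    have "w u - 1 = (euler_series q (p * u\<^sup>2) - euler_series q (A * u\<^sup>2)) / euler_series q (A * u\<^sup>2)"
      unfolding weyl_kernel_def using lower E0 by (simp add: diff_divide_distrib)
    then have "\<bar>w u - 1\<bar> = \<bar>euler_series q (p * u\<^sup>2) - euler_series q (A * u\<^sup>2)\<bar> / euler_series q (A * u\<^sup>2)"
      using lower E0 by simp
    also have "\<dots> \<le> 2 * M * u\<^sup>2 / E"
      using num lower E0 M0 by (intro frac_le) auto
    also have "\<dots> = 2 * M / E * u\<^sup>2" by simp
    also have "\<dots> \<le> max 1 (2 * M / E) * u\<^sup>2" by (intro mult_right_mono) auto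
    finally show ?thesis .
  qed
  moreover have "u powr 2 = u\<^sup>2" if "u \<in> L" for u using L_pos[OF that] by simp
  ultimately show ?thesis by (intro power_boundI[of _ "max 1 (2 * M / E)"]) simp
qed

lemma w_bounded: "power_bound w 0"
proof -
  obtain C where C: "0 \<le> C" "\<And>u. u \<in> L \<Longrightarrow> norm (w u - 1) \<le> C * u powr 2"
    using w_near_1 by (rule power_boundE) blast
  show ?thesis
  proof (rule power_boundI)
    fix u assume u: "u \<in> L"
    show "norm (w u) \<le> (1 + C) * u powr 0"
    proof (cases "u \<le> 1")
      case True
      then have "C * u powr 2 \<le> C * 1"
        using C(1) L_pos[OF u] by (intro mult_left_mono) (auto simp: power_le_one)
      moreover have "\<bar>w u\<bar> \<le> \<bar>w u - 1\<bar> + 1" by linarith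
      ultimately show ?thesis using C(2)[OF u] L_pos[OF u] by simp
    qed (use w_causal[OF u] C in auto)
  qed
qed

lemma w_decay:
  assumes "0 \<le> s"
  shows "power_bound w (- s)"
proof -
  obtain C where C: "0 \<le> C" "\<And>u. u \<in> L \<Longrightarrow> norm (w u) \<le> C"
    using w_bounded by (rule power_bound_0E) blast
  show ?thesis
  proof (rule power_boundI)
    fix u assume u: "u \<in> L"
    show "norm (w u) \<le> C * u powr (- s)"
    proof (cases "u \<le> 1")
      case True
      then have "1 \<le> u powr (- s)"
        using powr_mono'[of "- s" 0 u] L_pos[OF u] assms by simp
      then have "C * 1 \<le> C * u powr (- s)" using C(1) by (rule mult_left_mono)
      then show ?thesis using C(2)[OF u] by simp
    qed (use w_causal[OF u] C in auto)
  qed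
qed

lemma w_power_summable: "0 < s \<Longrightarrow> (\<lambda>u. u powr s * \<bar>w u\<bar>) summable_on L"
  using power_bound_summable[OF w_decay[of "s + 1"] w_bounded, of s] by simp

text \<open>
  The sum of \<open>u * w u\<close> over the lattice, in the closed form that the \<open>q\<close>-binomial theorem gives.
\<close>

definition weyl_mass :: real where
  "weyl_mass = euler_series q p / euler_series q A * (euler_series q (A * q) / euler_series q q)"

lemma weyl_moments:
  "(\<Sum>\<^sub>\<infinity>n. (q ^ (2 * k + 1)) ^ n * w (q ^ n)) = weyl_mass * (qpoch q p k / qpoch (A * q) p k)"
proof -
  have z: "\<bar>q ^ (2 * k + 1)\<bar> < 1"
    using power_Suc_less_one[OF q_pos q_less_1, of "2 * k"] q_pos by simp
  let ?d = "\<lambda>n. qpoch A p n / qpoch p p n"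
  have "(\<Sum>\<^sub>\<infinity>n. ?d n * (q ^ (2 * k + 1)) ^ n) = qbinomial_series q A (q ^ (2 * k + 1))"
    by (rule infsumI[OF norm_summable_imp_has_sum[OF _ qbinomial_sums[OF z]]])
      (use summable_qbinomial[OF z, of A] in simp)
  moreover have "(q ^ (2 * k + 1)) ^ n * w (q ^ n)
      = euler_series q p / euler_series q A * (?d n * (q ^ (2 * k + 1)) ^ n)" for n
    unfolding w_power by (simp only: mult_ac)
  ultimately have S: "(\<Sum>\<^sub>\<infinity>n. (q ^ (2 * k + 1)) ^ n * w (q ^ n))
      = euler_series q p / euler_series q A * qbinomial_series q A (q ^ (2 * k + 1))"
    by (simp only: infsum_cmult_right')
  have e1: "q ^ (2 * k + 1) = q * p ^ k" by (simp add: power_mult)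
  have "euler_series q (q * p ^ k) * qbinomial_series q A (q ^ (2 * k + 1)) = euler_series q (A * q * p ^ k)"
    using qbinomial_theorem[OF z, of A] unfolding e1 by (simp add: mult_ac)
  moreover have "0 < euler_series q (q * p ^ k)"
    using z unfolding e1 by (intro euler_series_pos) auto
  ultimately have "qbinomial_series q A (q ^ (2 * k + 1)) = euler_series q (A * q * p ^ k) / euler_series q (q * p ^ k)"
    by (metis less_irrefl nonzero_mult_div_cancel_left)
  also have "\<dots> = euler_series q (A * q) / euler_series q q * (qpoch q p k / qpoch (A * q) p k)"
  proof -
    have "0 < qpoch q p k" "0 < qpoch (A * q) p k"
      using Aq q_less_1 qq_pos qq_less_1 by (auto intro!: qpoch_pos)
    then show ?thesis
      using euler_series_power[of "A * q" k] euler_series_power[of q k] by simp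
  qed
  finally show ?thesis unfolding S weyl_mass_def by simp
qed

text \<open>
  The \<open>q\<close>-analogue of Sonine's integral: \<open>J\<close> of index \<open>\<alpha>\<close> is a weighted average of dilated
  \<open>q\<close>-cosines. Term by term it is the \<open>q\<close>-binomial theorem.
\<close>

lemma q_sonine:
  assumes z: "z \<in> L"
  shows "(\<Sum>\<^sub>\<infinity>u\<in>L. Cos.J (z * u) * (u * w u)) = weyl_mass * Bes.J z"
proof -
  obtain W where W: "0 \<le> W" "\<And>u. u \<in> L \<Longrightarrow> \<bar>w u\<bar> \<le> W"
    using w_bounded unfolding real_norm_def[symmetric] by (rule power_bound_0E) blast
  define t where "t n k = Cos.J_coeff k * z ^ (2 * k) * ((q ^ (2 * k + 1)) ^ n * w (q ^ n))" for n k
  have sk: "(\<lambda>k. \<bar>Cos.J_coeff k * y ^ (2 * k)\<bar>) summable_on UNIV" for y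
    by (rule summable_nonneg_imp_summable_on[OF Cos.J_series(1)]) simp
  have sn: "(\<lambda>n. W * q ^ n) summable_on UNIV"
    using q_pos q_less_1 by (intro summable_on_cmult_right norm_summable_imp_summable_on) (simp add: summable_geometric)
  have "(\<lambda>(n, k). W * q ^ n * \<bar>Cos.J_coeff k * z ^ (2 * k)\<bar>) summable_on UNIV \<times> UNIV"
    by (intro summable_on_Times_nonneg sk sn) (use W q_pos in auto)
  then have "(\<lambda>x. norm (case x of (n, k) \<Rightarrow> t n k)) summable_on UNIV \<times> UNIV"
  proof (rule Infinite_Sum.abs_summable_on_comparison_test')
    fix x :: "nat \<times> nat"
    obtain n k where x: "x = (n, k)" by fastforce
    have "(q ^ (2 * k + 1)) ^ n = q ^ n * (q ^ (2 * k)) ^ n"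
      by (simp add: power_mult_distrib)
    moreover have "(q ^ (2 * k)) ^ n \<le> 1" using q_pos q_less_1 by (intro power_le_one) auto
    ultimately have "(q ^ (2 * k + 1)) ^ n \<le> q ^ n"
      using q_pos by (simp add: mult_left_le)
    then have "(q ^ (2 * k + 1)) ^ n * \<bar>w (q ^ n)\<bar> \<le> q ^ n * W"
      using W(2)[OF L_power[of n]] q_pos by (intro mult_mono) auto
    then have "\<bar>Cos.J_coeff k * z ^ (2 * k)\<bar> * ((q ^ (2 * k + 1)) ^ n * \<bar>w (q ^ n)\<bar>)
        \<le> \<bar>Cos.J_coeff k * z ^ (2 * k)\<bar> * (q ^ n * W)"
      by (rule mult_left_mono) simp
    moreover have "\<bar>(q ^ (2 * k + 1)) ^ n\<bar> = (q ^ (2 * k + 1)) ^ n"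
      using q_pos by (intro abs_of_nonneg zero_le_power) simp
    ultimately show "norm (case x of (n, k) \<Rightarrow> t n k)
        \<le> (case x of (n, k) \<Rightarrow> W * q ^ n * \<bar>Cos.J_coeff k * z ^ (2 * k)\<bar>)"
      unfolding x t_def prod.case real_norm_def abs_mult by (simp only: mult_ac)
  qed
  then have "(\<lambda>(n, k). t n k) summable_on UNIV \<times> UNIV"
    by (rule abs_summable_summable)
  then have swap: "(\<Sum>\<^sub>\<infinity>n. \<Sum>\<^sub>\<infinity>k. t n k) = (\<Sum>\<^sub>\<infinity>k. \<Sum>\<^sub>\<infinity>n. t n k)"
    by (rule infsum_swap_banach)
  have inf_J: "(\<Sum>\<^sub>\<infinity>k. Cos.J_coeff k * y ^ (2 * k)) = Cos.J y" for y
    by (rule infsumI[OF norm_summable_imp_has_sum[OF _ Cos.J_series(2)]])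
      (use Cos.J_series(1)[of y] in simp)
  have inf_J': "(\<Sum>\<^sub>\<infinity>k. Bes.J_coeff k * y ^ (2 * k)) = Bes.J y" for y
    by (rule infsumI[OF norm_summable_imp_has_sum[OF _ Bes.J_series(2)]])
      (use Bes.J_series(1)[of y] in simp)
  have "(\<Sum>\<^sub>\<infinity>k. t n k) = Cos.J (z * q ^ n) * (q ^ n * w (q ^ n))" for n
  proof -
    have "t n k = Cos.J_coeff k * (z * q ^ n) ^ (2 * k) * (q ^ n * w (q ^ n))" for k
      unfolding t_def by (simp add: power_mult_distrib power_mult[symmetric] mult_ac)
    then show ?thesis by (simp only: infsum_cmult_left' inf_J)
  qed
  moreover have "(\<Sum>\<^sub>\<infinity>n. t n k) = weyl_mass * (Bes.J_coeff k * z ^ (2 * k))" for k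
  proof -
    have b: "q powr (2 * (- 1/2) + 2) = q" "q powr (2 * \<alpha> + 2) = A * q"
      using q_pos powr_add[of q "2 * \<alpha> + 1" 1] by (simp_all add: add_ac)
    have "0 < qpoch q p k"
      using q_less_1 qq_pos qq_less_1 by (intro qpoch_pos) auto
    then have J: "Cos.J_coeff k * (qpoch q p k / qpoch (A * q) p k) = Bes.J_coeff k"
      unfolding Cos.J_coeff_def Bes.J_coeff_def bessel_coeff_def b by simp
    have "(\<Sum>\<^sub>\<infinity>n. t n k) = Cos.J_coeff k * z ^ (2 * k) * (weyl_mass * (qpoch q p k / qpoch (A * q) p k))"
      unfolding t_def by (simp only: infsum_cmult_right' weyl_moments)
    then show ?thesis unfolding J[symmetric] by (simp only: mult_ac)
  qed
  ultimately have "(\<Sum>\<^sub>\<infinity>n. Cos.J (z * q ^ n) * (q ^ n * w (q ^ n))) = weyl_mass * Bes.J z"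
    using swap by (simp only: infsum_cmult_right' inf_J')
  moreover have "(\<Sum>\<^sub>\<infinity>u\<in>L. Cos.J (z * u) * (u * w u)) = (\<Sum>\<^sub>\<infinity>n. Cos.J (z * q ^ n) * (q ^ n * w (q ^ n)))"
    by (rule L_infsum_causal) (simp add: w_causal)
  ultimately show ?thesis by simp
qed

text \<open>
  The constants in the two transforms and in the Weyl transform fit together through the \<open>q\<close>-beta
  integral; with \<open>(1 - q) (1 + q) = 1 - q\<^sup>2\<close> all powers of \<open>1 + 1/q\<close> and \<open>1 - q\<^sup>2\<close> cancel.
\<close>

lemma weyl_normalization: "Cos.cF * (weyl_const q \<alpha> * (1 - q)) * weyl_mass = Bes.cF"
proof -
  have pw: "p powr s = q powr (2 * s)" for s
    using q_pos by (simp add: powr_powr powr_realpow[symmetric] flip: powr_numeral)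
  define e where "e = euler_series q p"
  define eA where "eA = euler_series q A"
  define eq where "eq = euler_series q q"
  define eAq where "eAq = euler_series q (A * q)"
  define r where "r = 1 + inverse q"
  define v where "v = 1 - p"
  have pos: "0 < e" "0 < eA" "0 < eq" "0 < eAq" "0 < r" "0 < v"
    unfolding e_def eA_def eq_def eAq_def r_def v_def
    using euler_series_pos qq_less_1 A_less_1 q_less_1 Aq q_pos by (auto simp: add_pos_pos)
  have g1: "qGamma p (\<alpha> + 1/2) = e / eA * (v powr (1/2) * v powr (- \<alpha>))"
    unfolding qGamma_def qpoch_inf_eq_euler pw e_def eA_def v_def powr_add[symmetric]
    by (simp add: algebra_simps)
  have g2: "qGamma p (- 1/2 + 1) = e / eq * v powr (1/2)"
    unfolding qGamma_def qpoch_inf_eq_euler pw e_def eq_def v_def using q_pos by simp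
  have "q powr (2 * (\<alpha> + 1)) = A * q"
    using q_pos powr_add[of q "2 * \<alpha> + 1" 1] by (simp add: algebra_simps)
  then have g3: "qGamma p (\<alpha> + 1) = e / eAq * v powr (- \<alpha>)"
    unfolding qGamma_def qpoch_inf_eq_euler pw e_def eAq_def v_def by simp
  have r: "r powr (1/2) * (r powr (- \<alpha>) * r powr (1/2)) = r * r powr (- \<alpha>)"
    using pos by (simp add: powr_half_sqrt)
  have v: "v powr (1/2) * v powr (1/2) = v"
    using pos by (simp add: powr_half_sqrt)
  have qr: "q * r * (1 - q) = v"
    unfolding r_def v_def using q_pos by (simp add: algebra_simps power2_eq_square)
  have "Cos.cF * (weyl_const q \<alpha> * (1 - q)) * weyl_mass
      = (r powr (1/2) / (e / eq * v powr (1/2)) * (1 - q)) *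
        (q * (r powr (- \<alpha>) * r powr (1/2)) / (e / eA * (v powr (1/2) * v powr (- \<alpha>))) * (1 - q)) *
        (e / eA * (eAq / eq))"
    unfolding Cos.cF_def c_bessel_def weyl_const_def weyl_mass_def g1 g2 powr_add[symmetric]
    by (simp add: r_def e_def eA_def eAq_def eq_def)
  also have "\<dots> = (q * (r powr (1/2) * (r powr (- \<alpha>) * r powr (1/2))) * (1 - q)) * (1 - q) * eAq
      / (e * (v powr (1/2) * v powr (1/2)) * v powr (- \<alpha>))"
    using pos by (simp add: field_simps)
  also have "\<dots> = (q * r * (1 - q)) * r powr (- \<alpha>) * (1 - q) * eAq / (e * v * v powr (- \<alpha>))"
    unfolding r v by (simp only: mult_ac)
  also have "\<dots> = r powr (- \<alpha>) * (1 - q) * eAq / (e * v powr (- \<alpha>))"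
    unfolding qr using pos by simp
  also have "\<dots> = Bes.cF"
    unfolding Bes.cF_def c_bessel_def g3 using pos by (simp add: r_def)
  finally show ?thesis .
qed

end

context q_weyl_transform
begin

abbreviation W :: "(real \<Rightarrow> complex) \<Rightarrow> real \<Rightarrow> complex" where "W \<equiv> q_weyl q \<alpha>"

lemma W_eq:
  assumes x: "x \<in> insert 0 L"
  shows "W f x = (weyl_const q \<alpha> * (1 - q)) *\<^sub>R (\<Sum>\<^sub>\<infinity>t\<in>L. (w (x / t) * t powr (2 * \<alpha> + 1)) *\<^sub>R f t)"
proof -
  define g where "g t = (qpoch_inf (p * x\<^sup>2 / t\<^sup>2) p / qpoch_inf (A * x\<^sup>2 / t\<^sup>2) p * t powr (2 * \<alpha>)) *\<^sub>R f t" for t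
  have g: "g t = (w (x / t) * t powr (2 * \<alpha>)) *\<^sub>R f t" for t
    unfolding g_def qpoch_inf_eq_euler weyl_kernel_def by (simp add: power_divide)
  have "jackson_to q (q * x) g = 0"
  proof (cases "x = 0")
    case False
    then have "x \<noteq> 0" by simp
    then have "x / (q * x * q ^ n) = inverse (q ^ Suc n)" for n
      using q_pos by (simp add: field_simps)
    then have "g (q * x * q ^ n) = 0" for n
      unfolding g by (simp only: w_eq_0) simp
    then show ?thesis by (simp add: jackson_to_def)
  qed (simp add: jackson_to_def)
  then have "jackson_from q (q * x) g = (1 - q) *\<^sub>R (\<Sum>\<^sub>\<infinity>t\<in>L. t *\<^sub>R g t)"
    unfolding jackson_from_def jackson_eq by simp
  also have "(\<Sum>\<^sub>\<infinity>t\<in>L. t *\<^sub>R g t) = (\<Sum>\<^sub>\<infinity>t\<in>L. (w (x / t) * t powr (2 * \<alpha> + 1)) *\<^sub>R f t)"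
  proof (rule infsum_cong)
    fix t assume t: "t \<in> L"
    have "t powr (2 * \<alpha> + 1) = t * t powr (2 * \<alpha>)"
      using L_pos[OF t] by (simp add: powr_add)
    then show "t *\<^sub>R g t = (w (x / t) * t powr (2 * \<alpha> + 1)) *\<^sub>R f t"
      unfolding g by (simp add: mult_ac)
  qed
  finally have j: "jackson_from q (q * x) g = (1 - q) *\<^sub>R (\<Sum>\<^sub>\<infinity>t\<in>L. (w (x / t) * t powr (2 * \<alpha> + 1)) *\<^sub>R f t)" .
  have "\<bar>x\<bar> = x" "x \<in> Rq q"
    using x L_pos[of x] unfolding Rq_abs by auto
  then have "W f x = weyl_const q \<alpha> *\<^sub>R jackson_from q (q * x) g"
    unfolding q_weyl_def even_ext_def weyl_const_def g_def by simp
  then show ?thesis unfolding j by simp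
qed

abbreviation weyl_entry :: "real \<Rightarrow> (real \<Rightarrow> complex) \<Rightarrow> real \<Rightarrow> real \<Rightarrow> complex" where
  "weyl_entry s f t x \<equiv> (x powr s * (w (x / t) * t powr (2 * \<alpha> + 1))) *\<^sub>R f t"

lemma norm_weyl_entry:
  assumes "t \<in> L" "x \<in> L"
  shows "norm (weyl_entry s f t x)
    = t powr (2 * \<alpha> + 1 + s) * norm (f t) * ((x * inverse t) powr s * \<bar>w (x * inverse t)\<bar>)"
proof -
  have e: "(x * inverse t) powr s * t powr (2 * \<alpha> + 1 + s) = x powr s * t powr (2 * \<alpha> + 1)"
    using L_pos[OF assms(1)] L_pos[OF assms(2)]
    by (simp add: divide_inverse[symmetric] powr_divide powr_add)
  have "norm (weyl_entry s f t x)
      = x powr s * t powr (2 * \<alpha> + 1) * (norm (f t) * \<bar>w (x * inverse t)\<bar>)"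
    by (simp add: abs_mult divide_inverse)
  then show ?thesis unfolding e[symmetric] by (simp only: mult_ac)
qed

lemma weyl_fubini:
  fixes r :: "real \<Rightarrow> real \<Rightarrow> 'a::banach"
  assumes f: "rapid f" and s: "0 < s" and B: "0 \<le> B"
    and r: "\<And>t x. t \<in> L \<Longrightarrow> x \<in> L \<Longrightarrow> norm (r t x) \<le> B * norm (weyl_entry s f t x)"
  shows "(\<Sum>\<^sub>\<infinity>t\<in>L. \<Sum>\<^sub>\<infinity>x\<in>L. r t x) = (\<Sum>\<^sub>\<infinity>x\<in>L. \<Sum>\<^sub>\<infinity>t\<in>L. r t x)"
    and "(\<lambda>x. \<Sum>\<^sub>\<infinity>t\<in>L. norm (r t x)) summable_on L"
    and "\<And>x. x \<in> L \<Longrightarrow> (\<lambda>t. norm (r t x)) summable_on L"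
proof -
  have u: "(\<lambda>t. B * (t powr (2 * \<alpha> + 1 + s) * norm (f t))) summable_on L"
    using alpha s by (intro summable_on_cmult_right rapid_summable f) auto
  have r': "norm (r t x) \<le> B * (t powr (2 * \<alpha> + 1 + s) * norm (f t)) * ((x * inverse t) powr s * \<bar>w (x * inverse t)\<bar>)"
    if "t \<in> L" "x \<in> L" for t x
    using r[OF that] unfolding norm_weyl_entry[OF that] by (simp only: mult.assoc)
  note fub = L_fubini[where \<phi> = inverse, OF u w_power_summable[OF s]]
  show "(\<Sum>\<^sub>\<infinity>t\<in>L. \<Sum>\<^sub>\<infinity>x\<in>L. r t x) = (\<Sum>\<^sub>\<infinity>x\<in>L. \<Sum>\<^sub>\<infinity>t\<in>L. r t x)"
    by (rule fub(1), simp add: B, simp, erule L_inverse, erule (1) r')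
  show "(\<lambda>x. \<Sum>\<^sub>\<infinity>t\<in>L. norm (r t x)) summable_on L"
    by (rule fub(2), simp add: B, simp, erule L_inverse, erule (1) r')
  show "(\<lambda>t. norm (r t x)) summable_on L" if "x \<in> L" for x
    by (rule fub(3)[OF _ _ _ _ that], simp add: B, simp, erule L_inverse, erule (1) r')
qed

lemma W_l1:
  assumes f: "rapid f"
  shows "Cos.l1 (W f)"
proof -
  let ?t = "weyl_entry (- 1/2 + 1) f"
  let ?c = "weyl_const q \<alpha> * (1 - q)"
  have "norm (?t t x) \<le> 1 * norm (?t t x)" for t x by simp
  note fub = weyl_fubini[OF f _ _ this]
  have sx: "(\<lambda>x. \<Sum>\<^sub>\<infinity>t\<in>L. norm (?t t x)) summable_on L" by (rule fub(2)) auto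
  show ?thesis
    unfolding Cos.l1_def
  proof (rule infsum_dominated(1)[OF summable_on_cmult_right[OF sx, of "\<bar>?c\<bar>"]])
    fix x assume x: "x \<in> L"
    have st: "(\<lambda>t. norm (?t t x)) summable_on L" by (rule fub(3)[OF _ _ x]) auto
    have e: "(\<Sum>\<^sub>\<infinity>t\<in>L. ?t t x) = x powr (- 1/2 + 1) *\<^sub>R (\<Sum>\<^sub>\<infinity>t\<in>L. (w (x / t) * t powr (2 * \<alpha> + 1)) *\<^sub>R f t)"
      by (simp only: infsum_scaleR_right[symmetric] scaleR_scaleR)
    have "x powr (- 1/2 + 1) *\<^sub>R W f x = ?c *\<^sub>R (\<Sum>\<^sub>\<infinity>t\<in>L. ?t t x)"
      unfolding W_eq[OF insertI2[OF x]] e by (simp only: scaleR_scaleR mult.commute)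
    then have "norm (x powr (- 1/2 + 1) *\<^sub>R W f x) = \<bar>?c\<bar> * norm (\<Sum>\<^sub>\<infinity>t\<in>L. ?t t x)"
      by (simp only: norm_scaleR)
    also have "\<dots> \<le> \<bar>?c\<bar> * (\<Sum>\<^sub>\<infinity>t\<in>L. norm (?t t x))"
      by (intro mult_left_mono norm_infsum_bound[OF st]) simp
    finally show "norm (x powr (- 1/2 + 1) * norm (W f x)) \<le> \<bar>?c\<bar> * (\<Sum>\<^sub>\<infinity>t\<in>L. norm (?t t x))"
      by (simp only: norm_scaleR real_norm_def abs_mult abs_norm_cancel)
  qed
qed

text \<open>
  The factorization of the \<open>q\<close>-Bessel transform through the \<open>q\<close>-cosine transform: the Weyl transform
  is the transpose of the averaging operator in Sonine's integral.
\<close>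

theorem cosine_transform_weyl:
  assumes f: "rapid f" and l: "l \<in> L"
  shows "Cos.F (W f) l = Bes.F f l"
proof -
  let ?c = "weyl_const q \<alpha> * (1 - q)"
  let ?t = "\<lambda>t x. (Cos.J (l * x) * x * w (x / t) * t powr (2 * \<alpha> + 1)) *\<^sub>R f t"
  obtain B where B: "0 \<le> B" "\<And>x. x \<in> L \<Longrightarrow> \<bar>Cos.J x\<bar> \<le> B"
    using Cos.J_bounded unfolding real_norm_def[symmetric] by (rule power_bound_0E) blast
  have le: "norm (?t t x) \<le> B * norm (weyl_entry 1 f t x)" if t: "t \<in> L" and x: "x \<in> L" for t x
  proof -
    have "norm (?t t x) = \<bar>Cos.J (l * x)\<bar> * norm (weyl_entry 1 f t x)"
      using L_pos[OF x] by (simp add: abs_mult)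
    then show ?thesis
      using B(2)[OF L_mult[OF l x]] by (simp only: mult_right_mono norm_ge_zero)
  qed
  have swap: "(\<Sum>\<^sub>\<infinity>t\<in>L. \<Sum>\<^sub>\<infinity>x\<in>L. ?t t x) = (\<Sum>\<^sub>\<infinity>x\<in>L. \<Sum>\<^sub>\<infinity>t\<in>L. ?t t x)"
    by (rule weyl_fubini(1)[OF f _ B(1) le]) simp
  have "(Cos.J (l * x) * x powr (2 * (- 1/2) + 2)) *\<^sub>R W f x = ?c *\<^sub>R (\<Sum>\<^sub>\<infinity>t\<in>L. ?t t x)" if x: "x \<in> L" for x
  proof -
    have "?t t x = (Cos.J (l * x) * x) *\<^sub>R ((w (x / t) * t powr (2 * \<alpha> + 1)) *\<^sub>R f t)" for t
      by (simp add: mult_ac)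
    then have e: "(\<Sum>\<^sub>\<infinity>t\<in>L. ?t t x) = (Cos.J (l * x) * x) *\<^sub>R (\<Sum>\<^sub>\<infinity>t\<in>L. (w (x / t) * t powr (2 * \<alpha> + 1)) *\<^sub>R f t)"
      by (simp only: infsum_scaleR_right)
    have p: "x powr (2 * (- 1/2) + 2) = x"
      using L_pos[OF x] by simp
    show ?thesis
      unfolding W_eq[OF insertI2[OF x]] e p by (simp only: scaleR_scaleR mult.commute)
  qed
  then have "(\<Sum>\<^sub>\<infinity>x\<in>L. (Cos.J (l * x) * x powr (2 * (- 1/2) + 2)) *\<^sub>R W f x)
      = (\<Sum>\<^sub>\<infinity>x\<in>L. ?c *\<^sub>R (\<Sum>\<^sub>\<infinity>t\<in>L. ?t t x))"
    by (rule infsum_cong)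
  then have "Cos.F (W f) l = Cos.cF *\<^sub>R (\<Sum>\<^sub>\<infinity>x\<in>L. ?c *\<^sub>R (\<Sum>\<^sub>\<infinity>t\<in>L. ?t t x))"
    unfolding Cos.F_eq by (rule arg_cong)
  also have "\<dots> = (Cos.cF * ?c) *\<^sub>R (\<Sum>\<^sub>\<infinity>t\<in>L. \<Sum>\<^sub>\<infinity>x\<in>L. ?t t x)"
    unfolding swap by (simp only: infsum_scaleR_right scaleR_scaleR)
  also have "(\<Sum>\<^sub>\<infinity>t\<in>L. \<Sum>\<^sub>\<infinity>x\<in>L. ?t t x) = (\<Sum>\<^sub>\<infinity>t\<in>L. weyl_mass *\<^sub>R ((Bes.J (l * t) * t powr (2 * \<alpha> + 2)) *\<^sub>R f t))"
  proof (rule infsum_cong)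
    fix t assume t: "t \<in> L"
    have t0: "0 < t" using L_pos[OF t] .
    let ?g = "\<lambda>u. Cos.J (l * t * u) * (u * w u)"
    have gs: "?g summable_on L"
    proof (rule infsum_dominated(1)[OF summable_on_cmult_right[OF w_power_summable[of 1], of B]])
      fix u assume u: "u \<in> L"
      have "\<bar>Cos.J (l * t * u)\<bar> * \<bar>u * w u\<bar> \<le> B * \<bar>u * w u\<bar>"
        by (intro mult_right_mono B(2) L_mult l t u) simp
      then show "norm (?g u) \<le> B * (u powr 1 * \<bar>w u\<bar>)"
        using L_pos[OF u] by (simp add: abs_mult)
    qed simp
    have "?t t x = ?g (inverse t * x) *\<^sub>R (t powr (2 * \<alpha> + 2) *\<^sub>R f t)" if "x \<in> L" for x
    proof -
      have "t powr (2 * \<alpha> + 2) = t * t powr (2 * \<alpha> + 1)"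
        using t0 powr_add[of t 1 "2 * \<alpha> + 1"] by (simp add: add_ac)
      moreover have "l * t * (inverse t * x) = l * x" "inverse t * x = x / t"
        using t0 by (simp_all add: divide_inverse)
      ultimately show ?thesis using t0 by simp
    qed
    then have "(\<Sum>\<^sub>\<infinity>x\<in>L. ?t t x) = (\<Sum>\<^sub>\<infinity>x\<in>L. ?g (inverse t * x) *\<^sub>R (t powr (2 * \<alpha> + 2) *\<^sub>R f t))"
      by (rule infsum_cong)
    also have "\<dots> = (\<Sum>\<^sub>\<infinity>u\<in>L. ?g u *\<^sub>R (t powr (2 * \<alpha> + 2) *\<^sub>R f t))"
      by (rule L_infsum_scale[OF L_inverse[OF t]])
    also have "\<dots> = (\<Sum>\<^sub>\<infinity>u\<in>L. ?g u) *\<^sub>R (t powr (2 * \<alpha> + 2) *\<^sub>R f t)"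
      by (rule infsum_scaleR_left[OF gs])
    also have "(\<Sum>\<^sub>\<infinity>u\<in>L. ?g u) = weyl_mass * Bes.J (l * t)"
      by (rule q_sonine[OF L_mult[OF l t]])
    finally show "(\<Sum>\<^sub>\<infinity>x\<in>L. ?t t x) = weyl_mass *\<^sub>R ((Bes.J (l * t) * t powr (2 * \<alpha> + 2)) *\<^sub>R f t)"
      by (simp add: mult_ac)
  qed
  also have "\<dots> = weyl_mass *\<^sub>R (\<Sum>\<^sub>\<infinity>t\<in>L. (Bes.J (l * t) * t powr (2 * \<alpha> + 2)) *\<^sub>R f t)"
    by (rule infsum_scaleR_right)
  finally show ?thesis
    unfolding Bes.F_eq weyl_normalization[symmetric] by (simp only: scaleR_scaleR)
qed

lemma W_continuous_at_0:
  assumes f: "rapid f"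
  shows "(\<lambda>n. W f (q ^ n)) \<longlonglongrightarrow> W f 0"
proof -
  \<comment> \<open>Interpolating between the bounds of orders \<open>2\<close> and \<open>0\<close> keeps the weight integrable at the origin.\<close>
  define s where "s = min 1 ((2 * \<alpha> + 1) / 2)"
  have s: "0 < s" "s \<le> 2" "0 < 2 * \<alpha> + 1 - s" using alpha by (auto simp: s_def min_def)
  let ?c = "weyl_const q \<alpha> * (1 - q)"
  let ?t = "\<lambda>x t. (w (x / t) * t powr (2 * \<alpha> + 1)) *\<^sub>R f t"
  have "power_bound (\<lambda>_. 1 :: real) 0"
    by (rule power_boundI[of _ 1]) (use L_not_0 in simp)
  then have "power_bound (\<lambda>u. w u - 1) s"
    using s by (intro power_bound_interpolate[OF power_bound_diff[OF w_bounded] w_near_1]) auto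
  then obtain C where C: "\<And>u. u \<in> L \<Longrightarrow> norm (w u - 1) \<le> C * u powr s"
    by (rule power_boundE) blast
  define M where "M = (\<Sum>\<^sub>\<infinity>t\<in>L. t powr (2 * \<alpha> + 1 - s) * norm (f t))"
  have sM: "(\<lambda>t. t powr (2 * \<alpha> + 1 - s) * norm (f t)) summable_on L"
    by (rule rapid_summable[OF f s(3)])
  have s0: "?t 0 summable_on L"
    by (rule infsum_dominated(1)[OF rapid_summable[OF f, of "2 * \<alpha> + 1"]]) (use alpha in \<open>simp_all add: w_0\<close>)
  have bound: "norm (W f x - W f 0) \<le> \<bar>?c\<bar> * (C * M) * x powr s" if x: "x \<in> L" for x
  proof -
    have le: "norm (?t x t - ?t 0 t) \<le> C * x powr s * (t powr (2 * \<alpha> + 1 - s) * norm (f t))" if t: "t \<in> L" for t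
    proof -
      have "?t x t - ?t 0 t = ((w (x / t) - 1) * t powr (2 * \<alpha> + 1)) *\<^sub>R f t"
        by (simp add: w_0 algebra_simps)
      then have "norm (?t x t - ?t 0 t) = norm (w (x / t) - 1) * (t powr (2 * \<alpha> + 1) * norm (f t))"
        by (simp add: abs_mult)
      also have "\<dots> \<le> (C * (x / t) powr s) * (t powr (2 * \<alpha> + 1) * norm (f t))"
        by (intro mult_right_mono C L_divide x t) simp
      also have "(x / t) powr s = x powr s * t powr (- s)"
        using L_pos[OF x] L_pos[OF t] by (simp add: powr_divide powr_minus_divide)
      also have "C * (x powr s * t powr (- s)) * (t powr (2 * \<alpha> + 1) * norm (f t))
          = C * x powr s * ((t powr (2 * \<alpha> + 1) * t powr (- s)) * norm (f t))"
        by (simp only: mult_ac)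
      also have "t powr (2 * \<alpha> + 1) * t powr (- s) = t powr (2 * \<alpha> + 1 - s)"
        by (simp only: powr_add[symmetric]) simp
      finally show ?thesis .
    qed
    note d = infsum_dominated[OF summable_on_cmult_right[OF sM] le]
    have "(\<Sum>\<^sub>\<infinity>t\<in>L. ?t x t) = (\<Sum>\<^sub>\<infinity>t\<in>L. (?t x t - ?t 0 t) + ?t 0 t)" by simp
    also have "\<dots> = (\<Sum>\<^sub>\<infinity>t\<in>L. ?t x t - ?t 0 t) + (\<Sum>\<^sub>\<infinity>t\<in>L. ?t 0 t)"
      by (rule infsum_add[OF d(1) s0])
    finally have "W f x - W f 0 = ?c *\<^sub>R (\<Sum>\<^sub>\<infinity>t\<in>L. ?t x t - ?t 0 t)"
      unfolding W_eq[OF insertI2[OF x]] W_eq[OF insertI1] by (simp only: scaleR_add_right add_diff_cancel_right')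
    then have "norm (W f x - W f 0) = \<bar>?c\<bar> * norm (\<Sum>\<^sub>\<infinity>t\<in>L. ?t x t - ?t 0 t)"
      by (simp only: norm_scaleR)
    also have "\<dots> \<le> \<bar>?c\<bar> * (C * x powr s * M)"
      using d(2) unfolding M_def infsum_cmult_right' by (rule mult_left_mono[OF _ abs_ge_zero])
    finally show ?thesis by (simp only: mult_ac)
  qed
  show ?thesis by (rule power_bound_tendsto[OF s(1) power_boundI[OF bound]])
qed

text \<open>
  The Bessel transform factors through \<open>W\<close> and is injective; this determines a function at the points
  of the positive lattice, hence by parity and continuity at the origin everywhere.
\<close>

lemma W_injective: "inj_on W (q_schwartz0 q \<alpha>)"
proof (rule inj_onI)
  fix f g assume f: "f \<in> q_schwartz0 q \<alpha>" and g: "g \<in> q_schwartz0 q \<alpha>" and eq: "W f = W g"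
  note f' = schwartz0_properties[OF f] and g' = schwartz0_properties[OF g]
  have "Bes.F f l = Bes.F g l" if "l \<in> L" for l
    using cosine_transform_weyl[OF f'(1) that] cosine_transform_weyl[OF g'(1) that] eq by simp
  then have L: "f x = g x" if "x \<in> L" for x
    using Bes.F_injective[of f g x] Bes.l1_imp_linf Bes.rapid_imp_l1 f'(1) g'(1) that by blast
  have "f 0 = g 0"
    using LIMSEQ_unique[OF f'(6)] g'(6) L[OF L_power] by simp
  then have L0: "f \<bar>x\<bar> = g \<bar>x\<bar>" if "x \<in> Rq q" for x
    using that L unfolding Rq_abs by auto
  show "f = g"
  proof (rule extensionalityI[OF f'(4) g'(4)])
    fix x assume x: "x \<in> Rq q"
    show "f x = g x"
      using L0[OF x] f'(5)[OF x] g'(5)[OF x] by (cases "0 \<le> x") auto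
  qed
qed

section \<open>Wavelet transforms as Fourier multipliers\<close>

lemma bessel_wavelet_transform_eq:
  assumes f: "rapid f" and g: "rapid g" and a: "a \<in> L" and b: "b \<in> insert 0 L"
  shows "bessel_wavelet_transform q \<alpha> g f a b
    = (1 / Bes.F_norm) *\<^sub>R Bes.F (\<lambda>l. Bes.F f l * cnj (sqrt a *\<^sub>R Bes.F g (a * l))) b"
proof -
  define h where "h y = a powr (- 2 * \<alpha> - 2) *\<^sub>R g (y / a)" for y
  let ?T = "q_translate q \<alpha> b h"
  have h: "Bes.l1 h"
    unfolding h_def by (intro Bes.l1_scaleR Bes.l1_dilate[OF a, of g] Bes.rapid_imp_l1 g)
  have Fh: "Bes.F h l = Bes.F g (a * l)" for l
  proof -
    have "a powr (- 2 * \<alpha> - 2) * a powr (2 * \<alpha> + 2) = 1"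
      using L_pos[OF a] by (simp add: powr_add[symmetric])
    then show ?thesis
      unfolding h_def Bes.F_scaleR Bes.F_dilate[OF a, of g] by (simp only: scaleR_scaleR scaleR_one)
  qed
  have "x *\<^sub>R (x powr (2 * \<alpha> + 1) *\<^sub>R (f x * cnj (sqrt a *\<^sub>R ?T x)))
      = sqrt a *\<^sub>R (x powr (2 * \<alpha> + 2) *\<^sub>R (f x * cnj (?T x)))" if "x \<in> L" for x
  proof -
    have "x powr (2 * \<alpha> + 2) = x * x powr (2 * \<alpha> + 1)"
      using L_pos[OF that] powr_add[of x 1 "2 * \<alpha> + 1"] by (simp add: add_ac)
    then show ?thesis by (simp add: mult_ac)
  qed
  then have "(\<Sum>\<^sub>\<infinity>x\<in>L. x *\<^sub>R (x powr (2 * \<alpha> + 1) *\<^sub>R (f x * cnj (sqrt a *\<^sub>R ?T x))))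
      = (\<Sum>\<^sub>\<infinity>x\<in>L. sqrt a *\<^sub>R (x powr (2 * \<alpha> + 2) *\<^sub>R (f x * cnj (?T x))))"
    by (rule infsum_cong)
  also have "\<dots> = sqrt a *\<^sub>R (\<Sum>\<^sub>\<infinity>x\<in>L. x powr (2 * \<alpha> + 2) *\<^sub>R (f x * cnj (?T x)))"
    by (rule infsum_scaleR_right)
  finally have "bessel_wavelet_transform q \<alpha> g f a b
      = sqrt a *\<^sub>R (Bes.cF *\<^sub>R (\<Sum>\<^sub>\<infinity>x\<in>L. x powr (2 * \<alpha> + 2) *\<^sub>R (f x * cnj (?T x))))"
    unfolding bessel_wavelet_transform_def bessel_atom_def h_def[symmetric] jackson_eq Bes.cF_def
    by (simp only: scaleR_scaleR mult_ac)
  also have "\<dots> = (1 / Bes.F_norm) *\<^sub>R (sqrt a *\<^sub>R Bes.F (\<lambda>l. Bes.F f l * cnj (Bes.F h l)) b)"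
    unfolding Bes.pairing_with_translate[OF Bes.rapid_imp_l1[OF f] h b] by simp
  also have "sqrt a *\<^sub>R Bes.F (\<lambda>l. Bes.F f l * cnj (Bes.F h l)) b
      = Bes.F (\<lambda>l. sqrt a *\<^sub>R (Bes.F f l * cnj (Bes.F h l))) b"
    by (rule Bes.F_scaleR[symmetric])
  finally show ?thesis unfolding Fh by simp
qed

lemma cosine_wavelet_transform_eq:
  assumes f: "Cos.l1 f" and g: "Cos.l1 g" and a: "a \<in> L" and b: "b \<in> insert 0 L"
  shows "cosine_wavelet_transform q g f a b
    = (1 / Cos.F_norm) *\<^sub>R Cos.F (\<lambda>l. Cos.F f l * cnj (sqrt a *\<^sub>R Cos.F g (a * l))) b"
proof -
  define h where "h y = (1 / sqrt a) *\<^sub>R g (y / a)" for y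
  let ?T = "q_translate q (- 1/2) b h"
  have h: "Cos.l1 h"
    unfolding h_def by (intro Cos.l1_scaleR Cos.l1_dilate[OF a, of g] g)
  have Fh: "Cos.F h l = sqrt a *\<^sub>R Cos.F g (a * l)" for l
  proof -
    have "1 / sqrt a * a powr (2 * (- 1/2) + 2) = sqrt a"
      using L_pos[OF a] by (simp add: real_div_sqrt)
    then show ?thesis
      unfolding h_def Cos.F_scaleR Cos.F_dilate[OF a, of g] by (simp only: scaleR_scaleR)
  qed
  have "x *\<^sub>R (f x * cnj (?T x)) = x powr (2 * (- 1/2) + 2) *\<^sub>R (f x * cnj (?T x))" if "x \<in> L" for x
  proof -
    have "x powr (2 * (- 1/2) + 2) = x" using L_pos[OF that] by simp
    then show ?thesis by (simp only:)
  qed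
  then have "(\<Sum>\<^sub>\<infinity>x\<in>L. x *\<^sub>R (f x * cnj (?T x)))
      = (\<Sum>\<^sub>\<infinity>x\<in>L. x powr (2 * (- 1/2) + 2) *\<^sub>R (f x * cnj (?T x)))"
    by (rule infsum_cong)
  then have "cosine_wavelet_transform q g f a b
      = Cos.cF *\<^sub>R (\<Sum>\<^sub>\<infinity>x\<in>L. x powr (2 * (- 1/2) + 2) *\<^sub>R (f x * cnj (?T x)))"
    unfolding cosine_wavelet_transform_def cosine_atom_def h_def[symmetric] jackson_eq Cos.cF_def
    by (simp only: scaleR_scaleR)
  also have "\<dots> = (1 / Cos.F_norm) *\<^sub>R Cos.F (\<lambda>l. Cos.F f l * cnj (Cos.F h l)) b"
    by (rule Cos.pairing_with_translate[OF f h b])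
  finally show ?thesis unfolding Fh .
qed

text \<open>
  The Bessel transform of one wavelet transform and the cosine transform of the other are the same
  function \<open>G\<close>. Besides this, the inverse
  Weyl transform requires its value to be in the Schwartz space with vanishing moments,
  which follows from the decay and the flatness of \<open>G\<close>. The value at \<open>0\<close> is not seen by the transforms
  and is recovered by continuity along \<open>q\<^sup>n\<close>.
\<close>

lemma schwartz0_wavelet_identity:
  assumes f: "f \<in> q_schwartz0 q \<alpha>" and g: "g \<in> q_schwartz0 q \<alpha>" and a: "a \<in> L"
  shows "even_ext q (bessel_wavelet_transform q \<alpha> g f a) =
    q_weyl_inv q \<alpha> (even_ext q (cosine_wavelet_transform q (W g) (W f) a))"
proof -
  note f' = schwartz0_properties[OF f] and g' = schwartz0_properties[OF g]
  define G where "G l = Bes.F f l * cnj (sqrt a *\<^sub>R Bes.F g (a * l))" for l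
  define H where "H l = (1 / Bes.F_norm) *\<^sub>R G l" for l
  define \<Psi> where "\<Psi> = bessel_wavelet_transform q \<alpha> g f a"
  define \<Phi> where "\<Phi> = cosine_wavelet_transform q (W g) (W f) a"
  have \<Psi>: "\<Psi> b = Bes.F H b" if "b \<in> insert 0 L" for b
    unfolding \<Psi>_def H_def Bes.F_scaleR G_def by (rule bessel_wavelet_transform_eq[OF f'(1) g'(1) a that])
  have \<Phi>: "\<Phi> b = (1 / Cos.F_norm) *\<^sub>R Cos.F G b" if "b \<in> insert 0 L" for b
  proof -
    have "Cos.F (W f) l * cnj (sqrt a *\<^sub>R Cos.F (W g) (a * l)) = G l" if "l \<in> L" for l
      unfolding G_def cosine_transform_weyl[OF f'(1) that] cosine_transform_weyl[OF g'(1) L_mult[OF a that]] ..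
    then have "Cos.F (\<lambda>l. Cos.F (W f) l * cnj (sqrt a *\<^sub>R Cos.F (W g) (a * l))) b = Cos.F G b"
      by (rule Cos.F_cong)
    then show ?thesis
      unfolding \<Phi>_def cosine_wavelet_transform_eq[OF W_l1[OF f'(1)] W_l1[OF g'(1)] a that]
      by (rule arg_cong)
  qed
  have Ff: "rapid (Bes.F f)" "flat (Bes.F f)" and Fg: "rapid (Bes.F g)"
    using Bes.F_rapid Bes.F_flat f' g' by blast+
  have scaled: "rapid (\<lambda>l. r *\<^sub>R G l)" "flat (\<lambda>l. r *\<^sub>R G l)" for r
  proof -
    let ?h = "\<lambda>l. r *\<^sub>R cnj (sqrt a *\<^sub>R Bes.F g (a * l))"
    obtain B where B: "\<And>x. x \<in> L \<Longrightarrow> norm (Bes.F g (a * x)) \<le> B"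
      using power_bound_dilate[OF a rapid_bounded[OF Fg]] by (rule power_bound_0E) blast
    have "power_bound ?h 0"
    proof (rule power_boundI)
      fix l assume l: "l \<in> L"
      then show "norm (?h l) \<le> \<bar>r\<bar> * (\<bar>sqrt a\<bar> * B) * l powr 0"
        using B[OF l] L_not_0[OF l] by (simp add: mult_left_mono abs_mult mult.assoc)
    qed
    then show "rapid (\<lambda>l. r *\<^sub>R G l)" "flat (\<lambda>l. r *\<^sub>R G l)"
      using rapid_mult_bounded[OF Ff(1), of ?h] flat_mult_bounded[OF Ff(2), of ?h] by (simp_all add: G_def)
  qed
  have G: "rapid G" using scaled(1)[of 1] by simp
  have H: "rapid H" "flat H" unfolding H_def by (rule scaled)+
  have FH: "rapid (Bes.F H)"
    using Bes.F_rapid[OF H(1)] flat_even_expansion[OF H(2)] by blast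
  have \<Psi>_in: "even_ext q \<Psi> \<in> q_schwartz0 q \<alpha>"
  proof -
    have \<Psi>_L: "\<Psi> x = Bes.F H x" if "x \<in> L" for x using \<Psi> that by blast
    have "rapid \<Psi>"
      using FH \<Psi>_L unfolding rapid_def by (simp add: power_bound_def)
    moreover have "even_expansion \<Psi> (Bes.taylor_coeff H) N" for N
      using Bes.F_even_expansion[OF H(1)] \<Psi>_L by (simp add: even_expansion_def power_bound_def)
    moreover have "\<Psi> 0 = Bes.taylor_coeff H 0"
      unfolding \<Psi>[OF insertI1] Bes.F_at_0 ..
    ultimately have "even_ext q \<Psi> \<in> q_schwartz q"
      by (rule even_ext_in_schwartz)
    moreover have "jackson q (\<lambda>x. (x powr (2 * real k + 2 * \<alpha> + 1)) *\<^sub>R even_ext q \<Psi> x) = 0" for k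
    proof -
      have "(\<Sum>\<^sub>\<infinity>x\<in>L. x powr (2 * \<alpha> + 2 + 2 * real k) *\<^sub>R even_ext q \<Psi> x)
          = (\<Sum>\<^sub>\<infinity>x\<in>L. x powr (2 * \<alpha> + 2 + 2 * real k) *\<^sub>R Bes.F H x)"
        by (rule infsum_cong) (simp only: even_ext_on_L \<Psi>_L)
      then show ?thesis unfolding jackson_moment Bes.F_moments[OF H(2,1)] by simp
    qed
    ultimately show ?thesis by (simp add: q_schwartz0_def)
  qed
  note \<Psi>' = schwartz0_properties[OF \<Psi>_in]
  have W_L: "W (even_ext q \<Psi>) x = \<Phi> x" if x: "x \<in> L" for x
  proof -
    let ?\<Phi> = "\<lambda>b. (1 / Cos.F_norm) *\<^sub>R Cos.F G b"
    have G1: "Cos.l1 G" by (rule Cos.rapid_imp_l1[OF G])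
    have "Cos.F (W (even_ext q \<Psi>)) l = Cos.F ?\<Phi> l" if l: "l \<in> L" for l
    proof -
      have "Cos.F (W (even_ext q \<Psi>)) l = Bes.F (even_ext q \<Psi>) l"
        by (rule cosine_transform_weyl[OF \<Psi>'(1) l])
      also have "\<dots> = Bes.F (Bes.F H) l"
        by (rule Bes.F_cong) (simp add: even_ext_on_L \<Psi>)
      also have "\<dots> = G l"
        unfolding Bes.F_inversion[OF Bes.l1_imp_linf[OF Bes.rapid_imp_l1[OF H(1)]] l]
        using Bes.F_norm_pos by (simp add: H_def)
      also have "\<dots> = Cos.F ?\<Phi> l"
        unfolding Cos.F_scaleR Cos.F_inversion[OF Cos.l1_imp_linf[OF G1] l]
        using Cos.F_norm_pos by simp
      finally show ?thesis .
    qed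
    from Cos.F_injective[OF Cos.l1_imp_linf[OF W_l1[OF \<Psi>'(1)]]
        Cos.l1_imp_linf[OF Cos.l1_scaleR[OF Cos.F_l1[OF G1]]] this x]
    show ?thesis unfolding \<Phi>[OF insertI2[OF x]] .
  qed
  have "W (even_ext q \<Psi>) 0 = \<Phi> 0"
  proof -
    have "(\<lambda>n. Cos.F G (q ^ n)) \<longlonglongrightarrow> Cos.F G 0"
      by (rule Cos.F_continuous_at_0[OF G])
    then have "(\<lambda>n. \<Phi> (q ^ n)) \<longlonglongrightarrow> \<Phi> 0"
      unfolding \<Phi>[OF insertI1] \<Phi>[OF insertI2[OF L_power]] by (intro tendsto_intros)
    moreover have "(\<lambda>n. \<Phi> (q ^ n)) \<longlonglongrightarrow> W (even_ext q \<Psi>) 0"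
      using W_continuous_at_0[OF \<Psi>'(1)] unfolding W_L[OF L_power] .
    ultimately show ?thesis using LIMSEQ_unique by blast
  qed
  then have W_Rq: "W (even_ext q \<Psi>) \<bar>x\<bar> = \<Phi> \<bar>x\<bar>" if "x \<in> Rq q" for x
    using that W_L unfolding Rq_abs by auto
  have "W (even_ext q \<Psi>) = even_ext q \<Phi>"
  proof
    fix x
    show "W (even_ext q \<Psi>) x = even_ext q \<Phi> x"
    proof (cases "x \<in> Rq q")
      case True
      then have "\<bar>x\<bar> \<in> Rq q" unfolding Rq_abs by simp
      then have "W (even_ext q \<Psi>) x = W (even_ext q \<Psi>) \<bar>x\<bar>"
        using True unfolding q_weyl_def by (simp add: even_ext_def)
      then show ?thesis using W_Rq[OF True] True by (simp add: even_ext_def)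
    qed (simp add: q_weyl_def even_ext_def)
  qed
  then show ?thesis
    unfolding q_weyl_inv_def \<Psi>_def[symmetric] \<Phi>_def[symmetric]
    using the_inv_into_f_eq[OF W_injective _ \<Psi>_in] by simp
qed

end

theorem proposition12:
  fixes q \<alpha> :: real and f g :: "real \<Rightarrow> complex" and a :: real
  assumes "0 < q" and "q < 1" and "ln (1 - q) / ln q \<in> \<int>" and "\<alpha> > - 1/2"
    and "q_wavelet q \<alpha> g" and "g \<in> q_schwartz0 q \<alpha>"
    and "f \<in> q_schwartz0 q \<alpha>"
    and "a \<in> Rq_pos q"
  shows "even_ext q (bessel_wavelet_transform q \<alpha> g f a) =
    q_weyl_inv q \<alpha>
      (even_ext q (cosine_wavelet_transform q (q_weyl q \<alpha> g) (q_weyl q \<alpha> f) a))"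
proof -
  obtain k where k: "ln (1 - q) / ln q = of_int k"
    using assms(3) by (auto elim: Ints_cases)
  have "ln q < 0" using assms(1,2) by simp
  then have "ln (1 - q) = of_int k * ln q" using k by (simp add: field_simps)
  then have "1 - q = exp (of_int k * ln q)" using assms(2) by (metis diff_gt_0_iff_gt exp_ln)
  also have "\<dots> = q powr of_int k" using assms(1) by (simp add: powr_def)
  also have "\<dots> = q powi k" using assms(1) by (simp add: powr_real_of_int')
  finally have "1 - q \<in> Rq_pos q" by (auto simp: Rq_pos_def)
  then interpret q_weyl_transform q \<alpha>
    using assms by unfold_locales auto
  show ?thesis
    by (rule schwartz0_wavelet_identity) fact+
qed

end
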